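(* Let $M\ge 2$ be an integer and let $E\subset[0,1]^2$ be the planar fractal percolation with parameters $M,p$. For every $0<p\le 1$, for almost every realization of $E$ conditioned on $E\neq\emptyset$, the following holds simultaneously for all straight lines $\ell\subset\mathbb{R}^2$: $$\dim_{\rm H}(E_\ell)=\min\{1,\dim_{\rm H}(E)\},$$ where $E_\ell$ denotes the orthogonal projection of $E$ to the line $\ell$ and $\dim_{\rm H}$ is Hausdorff dimension.
   Context: Planar fractal (Mandelbrot) percolation with parameters $M,p$: the closed unit square $K=[0,1]^2$ is divided into $M^2$ congruent closed squares of side $M^{-1}$; each is retained with probability $p$ and discarded with probability $1-p$, independently. $E_1$ is the union of retained squares. Each retained square is divided into $M^2$ congruent closed squares of side $M^{-2}$, each retained with probability $p$ independently of everything else; $E_2$ is the union of the retained level-2 squares; and so on ad infinitum. Then $E:=\bigcap_{n\ge1}E_n$. "For almost every realization conditioned on $E\ne\emptyset$" means: outside an event of probability zero, whenever $E\neq\emptyset$. *)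

theory Defs
  imports "HOL-Probability.Probability"
begin

section \<open>Hausdorff dimension\<close>

(* The library functional diameter is meaningful only for bounded sets, hence the
   boundedness requirement on covers below. The power d^s is taken with 0^0 = 1 on
   nonempty sets (powr would give 0), so that the case s = 0 is counting measure. *)
definition diam_power :: "real \<Rightarrow> 'a::metric_space set \<Rightarrow> ennreal" where
  "diam_power s U =
     (if U = {} then 0 else if s = 0 then 1 else ennreal (diameter U powr s))"

definition hausdorff_premeasure :: "real \<Rightarrow> real \<Rightarrow> 'a::metric_space set \<Rightarrow> ennreal" where
  "hausdorff_premeasure s \<delta> A =
     (INF U \<in> {U :: nat \<Rightarrow> 'a set.
                 A \<subseteq> (\<Union>i. U i) \<and> (\<forall>i. bounded (U i) \<and> diameter (U i) \<le> \<delta>)}.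
        \<Sum>i. diam_power s (U i))"

definition hausdorff_measure :: "real \<Rightarrow> 'a::metric_space set \<Rightarrow> ennreal" where
  "hausdorff_measure s A = (SUP \<delta> \<in> {0<..}. hausdorff_premeasure s \<delta> A)"

definition hausdorff_dim :: "'a::metric_space set \<Rightarrow> ennreal" where
  "hausdorff_dim A = (INF s \<in> {s. 0 \<le> s \<and> hausdorff_measure s A = 0}. ennreal s)"


section \<open>Orthogonal projection\<close>

(* Well defined for nonempty affine subspaces L, in particular for straight lines
   (which need not pass through the origin). *)
definition orth_proj :: "'a::euclidean_space set \<Rightarrow> 'a \<Rightarrow> 'a" where
  "orth_proj L x = (THE y. y \<in> L \<and> (\<forall>z\<in>L. (x - y) \<bullet> (z - y) = 0))"


section \<open>Fractal percolation\<close>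

definition cell :: "nat \<Rightarrow> nat \<Rightarrow> nat \<times> nat \<Rightarrow> (real ^ 2) set" where
  "cell M n = (\<lambda>(i, j). {x.
      real i / real M ^ n \<le> x $ 1 \<and> x $ 1 \<le> real (i + 1) / real M ^ n \<and>
      real j / real M ^ n \<le> x $ 2 \<and> x $ 2 \<le> real (j + 1) / real M ^ n})"

definition cell_indices :: "nat \<Rightarrow> nat \<Rightarrow> (nat \<times> nat) set" where
  "cell_indices M n = {..<M ^ n} \<times> {..<M ^ n}"

(* R n (i, j) is the outcome of the retain/discard decision for the level-n square (i, j).
   The level-n square containing the level-(n+1) square (i, j) is (i div M, j div M).
   Decisions attached to descendants of discarded squares are never consulted. *)
primrec retained :: "nat \<Rightarrow> (nat \<Rightarrow> nat \<times> nat \<Rightarrow> bool) \<Rightarrow> nat \<Rightarrow> (nat \<times> nat) set" where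
  "retained M R 0 = {(0, 0)}"
| "retained M R (Suc n) =
     {(i, j). (i, j) \<in> cell_indices M (Suc n) \<and>
              (i div M, j div M) \<in> retained M R n \<and> R (Suc n) (i, j)}"

definition percolation_stage ::
    "nat \<Rightarrow> (nat \<Rightarrow> nat \<times> nat \<Rightarrow> bool) \<Rightarrow> nat \<Rightarrow> (real ^ 2) set" where
  "percolation_stage M R n = (\<Union>c \<in> retained M R n. cell M n c)"

definition percolation_set :: "nat \<Rightarrow> (nat \<Rightarrow> nat \<times> nat \<Rightarrow> bool) \<Rightarrow> (real ^ 2) set" where
  "percolation_set M R = (\<Inter>n \<in> {1..}. percolation_stage M R n)"

(* The decisions live on an arbitrary probability space. *)
locale fractal_percolation = prob_space \<Omega>
  for \<Omega> :: "'w measure" +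
  fixes M :: nat and p :: real and X :: "nat \<Rightarrow> nat \<times> nat \<Rightarrow> 'w \<Rightarrow> bool"
  assumes indep_decisions:
    "indep_vars (\<lambda>_. count_space UNIV) (\<lambda>(n, c). X n c) (SIGMA n:{1..}. cell_indices M n)"
  and prob_decision:
    "\<And>n c. 1 \<le> n \<Longrightarrow> c \<in> cell_indices M n \<Longrightarrow> prob {\<omega> \<in> space \<Omega>. X n c \<omega>} = p"

end

theory Submission
  imports Defs "HOL-Real_Asymp.Real_Asymp"
begin

text \<open>
  Write \<open>\<tau> = max 0 (1 + log\<^sub>M p)\<close>, so that \<open>M\<close> to the power \<open>\<tau>\<close> is \<open>max 1 (M p)\<close>.

  A strip of width \<open>1 / M ^ n\<close> meets of the order of \<open>M ^ n\<close> cells of level \<open>n\<close>, each of which survives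
  with probability \<open>p ^ n\<close>. Bounding all moments of the number of survivors and taking a union bound over
  polynomially many (in \<open>M ^ n\<close>) discretized strips shows that, almost surely, for every \<open>\<epsilon> > 0\<close> and all
  large \<open>n\<close>, every such strip contains at most \<open>M ^ n\<close> to the power \<open>\<tau> + \<epsilon>\<close> retained cells.
  Pulling covers of a projection back to covers of \<open>E\<close> by cells gives, for all lines at once,
  \<open>dim E \<le> dim (proj E) + \<tau>\<close>. As projections are Lipschitz maps into lines, this settles the case
  \<open>\<tau> = 0\<close>.

  If \<open>\<tau> > 0\<close>, it remains to see that \<open>dim E \<ge> 1 + \<tau>\<close> almost surely on \<open>E \<noteq> {}\<close>. For
  \<open>1 < s < 1 + \<tau>\<close> consider the minimal cost of a cutset of the tree of retained cells, where a cell of level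
  \<open>n\<close> costs \<open>M ^ n\<close> to the power \<open>- s\<close>. Its expectation stays bounded away from 0 as the depth of the tree
  grows, and both the event that the cost tends to 0 and the event of extinction are inherited by subtrees.
  The probability of an inherited event is a fixed point of the offspring generating function, which has only
  one fixed point below 1, so the two events agree almost surely. Compactness turns a positive limit of the
  cost into a positive Hausdorff measure.
\<close>

section \<open>Hausdorff measure and dimension\<close>

text \<open>One null set has to serve uncountably many lines. At scale \<open>M ^ n\<close> the
  lines reduce to about \<open>M ^ (3 * n)\<close> integer triples, so the tail of a single strip
  count must beat a fixed power of \<open>M ^ n\<close> even after a loss of only
  \<open>M ^ (\<epsilon> * n)\<close>; hence moments of arbitrarily high order. The maximum with 1
  in the exponent reflects that, given one survivor, the count is at least 1 even when
  \<open>M * p < 1\<close>. The window for \<open>s\<close> has two ends of different origin. With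
  \<open>\<theta> = (1 / M) powr s\<close> and \<open>M ^ 2\<close> children,
  \<open>s < 2 + log M p\<close> says \<open>p * \<theta> * M ^ 2 > 1\<close>, so that the mean cost
  is not driven to 0, while \<open>s > 1\<close> gives
  \<open>p * \<theta>\<^sup>2 * M ^ 2 < 1\<close>, which controls variances. The window is nonempty
  when \<open>\<tau> > 0\<close>. The alternative between vanishing cost and extinction is proved on
  a canonical product space, in which every subtree is a copy of the whole tree. The given
  percolation has no decision at its root and is tied to that space through the subtrees of its
  first-level cells.\<close>

lemma hausdorff_measure_eq_0_iff:
  "hausdorff_measure s A = 0 \<longleftrightarrow> (\<forall>\<delta>>0. hausdorff_premeasure s \<delta> A = 0)"
  unfolding hausdorff_measure_def bot_ennreal[symmetric] by (auto simp: SUP_bot_conv)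

lemma hausdorff_premeasure_le:
  assumes "A \<subseteq> (\<Union>i. U i)" "\<And>i. bounded (U i)" "\<And>i. diameter (U i) \<le> \<delta>"
  shows "hausdorff_premeasure s \<delta> A \<le> (\<Sum>i. diam_power s (U i))"
  unfolding hausdorff_premeasure_def by (rule INF_lower) (use assms in auto)

lemma hausdorff_premeasure_lessE:
  assumes "hausdorff_premeasure s \<delta> A < e"
  obtains U where "A \<subseteq> (\<Union>i. U i)" "\<And>i. bounded (U i)" "\<And>i. diameter (U i) \<le> \<delta>"
    "(\<Sum>i. diam_power s (U i)) < e"
  using assms unfolding hausdorff_premeasure_def INF_less_iff by auto

lemma hausdorff_premeasure_antimono:
  assumes "\<delta> \<le> \<delta>'"
  shows "hausdorff_premeasure s \<delta>' A \<le> hausdorff_premeasure s \<delta> A"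
  unfolding hausdorff_premeasure_def
  by (rule INF_superset_mono) (use assms in \<open>auto intro: order_trans\<close>)

lemma diam_power_pos:
  assumes "s > 0"
  shows "diam_power s U = ennreal (diameter U powr s)"
  using assms by (auto simp: diam_power_def)

lemma diam_power_mono_set:
  assumes "s \<ge> 0" "bounded U" "bounded V" "diameter V \<le> diameter U" "U = {} \<Longrightarrow> V = {}"
  shows "diam_power s V \<le> diam_power s U"
  using assms
  by (auto simp: diam_power_def intro!: ennreal_leI powr_mono2 diameter_ge_0)

lemma hausdorff_measure_0_mono:
  assumes "hausdorff_measure s A = 0" "0 \<le> s" "s \<le> t"
  shows "hausdorff_measure t A = 0"
  unfolding hausdorff_measure_eq_0_iff
proof safe
  fix \<delta> :: real assume "\<delta> > 0"
  \<comment> \<open>Sets of diameter at most 1 are cheaper at the larger exponent. For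
    \<open>s = 0\<close> every nonempty set costs 1 by convention, hence the separate case
    below.\<close>
  define d where "d = min \<delta> 1"
  have d: "0 < d" "d \<le> 1" "d \<le> \<delta>" using \<open>\<delta> > 0\<close> by (auto simp: d_def)
  have le: "diam_power t U \<le> diam_power s U" if "bounded U" "diameter U \<le> d" for U :: "'a set"
  proof (cases "s = 0")
    case True
    then show ?thesis using assms that d diameter_ge_0[OF that(1)]
      by (auto simp: diam_power_def ennreal_le_1 intro!: powr_le1)
  next
    case False
    then show ?thesis using assms that d diameter_ge_0[OF that(1)]
      by (auto simp: diam_power_def intro!: ennreal_leI powr_mono')
  qed
  have "hausdorff_premeasure t \<delta> A \<le> hausdorff_premeasure t d A"
    by (rule hausdorff_premeasure_antimono) (use d in auto)
  also have "\<dots> \<le> hausdorff_premeasure s d A"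
    unfolding hausdorff_premeasure_def
    by (rule INF_superset_mono) (auto intro!: suminf_le le)
  also have "\<dots> = 0" using assms(1) d(1) by (simp add: hausdorff_measure_eq_0_iff)
  finally show "hausdorff_premeasure t \<delta> A = 0" by simp
qed

section \<open>Dimension under 1-Lipschitz maps and inclusion\<close>

lemma hausdorff_dim_le:
  assumes "0 \<le> s" "hausdorff_measure s A = 0"
  shows "hausdorff_dim A \<le> ennreal s"
  unfolding hausdorff_dim_def by (rule INF_lower) (use assms in auto)

lemma hausdorff_dim_ge:
  assumes "\<And>t. 0 \<le> t \<Longrightarrow> hausdorff_measure t A = 0 \<Longrightarrow> e \<le> ennreal t"
  shows "e \<le> hausdorff_dim A"
  unfolding hausdorff_dim_def by (rule INF_greatest) (use assms in auto)

lemma hausdorff_dim_image_le: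
  fixes f :: "'a::metric_space \<Rightarrow> 'b::metric_space"
  assumes lip: "\<And>x y. x \<in> A \<Longrightarrow> y \<in> A \<Longrightarrow> dist (f x) (f y) \<le> dist x y"
  shows "hausdorff_dim (f ` A) \<le> hausdorff_dim A"
proof (rule hausdorff_dim_ge)
  fix s :: real assume s: "0 \<le> s" "hausdorff_measure s A = 0"
  have "hausdorff_measure s (f ` A) = 0"
    unfolding hausdorff_measure_eq_0_iff
  proof safe
    fix \<delta> :: real assume \<delta>: "\<delta> > 0"
    have "hausdorff_premeasure s \<delta> (f ` A) \<le> hausdorff_premeasure s \<delta> A"
      unfolding hausdorff_premeasure_def[of s \<delta> A]
    proof (rule INF_greatest, safe)
      fix U :: "nat \<Rightarrow> 'a set"
      assume U: "A \<subseteq> (\<Union>i. U i)" "\<forall>i. bounded (U i) \<and> diameter (U i) \<le> \<delta>"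
      \<comment> \<open>The Lipschitz bound holds on \<open>A\<close> only, and \<open>U i\<close>
        may stick out of \<open>A\<close>.\<close>
      define V where "V i = f ` (A \<inter> U i)" for i
      have dV: "dist x y \<le> diameter (U i)" if xy: "x \<in> V i" "y \<in> V i" for x y i
      proof -
        obtain a b where ab: "a \<in> A \<inter> U i" "b \<in> A \<inter> U i" "x = f a" "y = f b"
          using xy unfolding V_def by blast
        then have "dist x y \<le> dist a b" using lip by auto
        also have "\<dots> \<le> diameter (U i)" using ab U(2) by (intro diameter_bounded_bound) auto
        finally show ?thesis .
      qed
      have bV: "bounded (V i)" for i
        unfolding bounded_two_points using dV by blast
      have diam: "diameter (V i) \<le> diameter (U i)" for i
      proof (cases "V i = {}")
        case True then show ?thesis using U(2) by (simp add: diameter_ge_0)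
      next
        case False
        then show ?thesis unfolding diameter_def[of "V i"] using dV by (auto intro!: cSUP_least)
      qed
      have "hausdorff_premeasure s \<delta> (f ` A) \<le> (\<Sum>i. diam_power s (V i))"
      proof (intro hausdorff_premeasure_le bV)
        show "f ` A \<subseteq> (\<Union>i. V i)" using U(1) by (force simp: V_def)
        show "diameter (V i) \<le> \<delta>" for i using order_trans[OF diam] U(2) by blast
      qed
      also have "\<dots> \<le> (\<Sum>i. diam_power s (U i))"
        using U(2) s(1) bV diam by (intro suminf_le diam_power_mono_set) (auto simp: V_def)
      finally show "hausdorff_premeasure s \<delta> (f ` A) \<le> (\<Sum>i. diam_power s (U i))" .
    qed
    then show "hausdorff_premeasure s \<delta> (f ` A) = 0"
      using s(2) \<delta> by (simp add: hausdorff_measure_eq_0_iff)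
  qed
  then show "hausdorff_dim (f ` A) \<le> ennreal s" using s(1) by (rule hausdorff_dim_le[rotated])
qed

lemma hausdorff_dim_mono:
  assumes "A \<subseteq> B"
  shows "hausdorff_dim A \<le> hausdorff_dim B"
proof (rule hausdorff_dim_ge)
  fix s :: real assume s: "0 \<le> s" "hausdorff_measure s B = 0"
  have "hausdorff_premeasure s \<delta> A \<le> hausdorff_premeasure s \<delta> B" for \<delta>
    unfolding hausdorff_premeasure_def by (rule INF_superset_mono) (use assms in force)+
  then have "hausdorff_measure s A = 0"
    using s(2) unfolding hausdorff_measure_eq_0_iff by (metis le_zero_eq)
  then show "hausdorff_dim A \<le> ennreal s" using s(1) by (rule hausdorff_dim_le[rotated])
qed

text \<open>Covers are sequences of sets, but pulling one set back along a projection produces a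
  finite batch of cells. The batches are padded with empty sets, which cost 0 and have diameter 0
  (whence \<open>0 \<le> \<delta>\<close>), and then flattened by
  \<open>prod_decode\<close>.\<close>

lemma hausdorff_premeasure_le_finite_families:
  fixes F :: "nat \<Rightarrow> 'a::metric_space set set"
  assumes A: "A \<subseteq> (\<Union>i. \<Union>(F i))" and fin: "\<And>i. finite (F i)"
    and bd: "\<And>i V. V \<in> F i \<Longrightarrow> bounded V" and diam: "\<And>i V. V \<in> F i \<Longrightarrow> diameter V \<le> \<delta>"
    and "0 \<le> \<delta>"
  shows "hausdorff_premeasure s \<delta> A \<le> (\<Sum>i. \<Sum>V\<in>F i. diam_power s V)"
proof -
  have "\<exists>e. bij_betw e {..<card (F i)} (F i)" for i
    using ex_bij_betw_nat_finite[OF fin[of i]] by (auto simp: atLeast0LessThan)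
  then obtain e where e: "\<And>i. bij_betw (e i) {..<card (F i)} (F i)" by metis
  define U where "U i j = (if j < card (F i) then e i j else {})" for i j
  define W where "W k = U (fst (prod_decode k)) (snd (prod_decode k))" for k
  have U: "U i j \<in> F i \<or> U i j = {}" for i j
    using bij_betw_apply[OF e, of j i] by (auto simp: U_def)
  have "hausdorff_premeasure s \<delta> A \<le> (\<Sum>k. diam_power s (W k))"
  proof (rule hausdorff_premeasure_le)
    show "A \<subseteq> (\<Union>k. W k)"
    proof
      fix x assume "x \<in> A"
      then obtain i V where "V \<in> F i" "x \<in> V" using A by blast
      then obtain j where "j < card (F i)" "e i j = V"
        using e[of i] by (metis bij_betw_def imageE lessThan_iff)
      then have "x \<in> W (prod_encode (i, j))" using \<open>x \<in> V\<close> by (auto simp: W_def U_def)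
      then show "x \<in> (\<Union>k. W k)" by blast
    qed
    show "bounded (W k)" for k using U[of "fst (prod_decode k)" "snd (prod_decode k)"] bd
      by (auto simp: W_def)
    show "diameter (W k) \<le> \<delta>" for k using U[of "fst (prod_decode k)" "snd (prod_decode k)"] diam \<open>0 \<le> \<delta>\<close>
      by (auto simp: W_def)
  qed
  also have "\<dots> = (\<Sum>i. \<Sum>j. diam_power s (U i j))"
    using suminf_ennreal_2dimen[of "\<lambda>i. \<Sum>j. diam_power s (U i j)" "\<lambda>(i,j). diam_power s (U i j)"]
    by (simp add: W_def case_prod_beta comp_def)
  also have "(\<lambda>i. \<Sum>j. diam_power s (U i j)) = (\<lambda>i. \<Sum>V\<in>F i. diam_power s V)"
  proof
    fix i
    have "(\<Sum>j. diam_power s (U i j)) = (\<Sum>j<card (F i). diam_power s (U i j))"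
      by (rule suminf_finite) (auto simp: U_def diam_power_def)
    also have "\<dots> = (\<Sum>j<card (F i). diam_power s (e i j))" by (simp add: U_def)
    also have "\<dots> = (\<Sum>V\<in>F i. diam_power s V)" by (rule sum.reindex_bij_betw[OF e])
    finally show "(\<Sum>j. diam_power s (U i j)) = (\<Sum>V\<in>F i. diam_power s V)" .
  qed
  finally show ?thesis .
qed

text \<open>All sets of a batch share one scale \<open>r i\<close>, so the cost becomes a real
  series and applications meet neither extended reals nor exact diameters.\<close>

lemma hausdorff_measure_0I:
  fixes A :: "'a::metric_space set"
  assumes s: "s > 0"
    and cov: "\<And>\<delta> \<eta>::real. \<delta> > 0 \<Longrightarrow> \<eta> > 0 \<Longrightarrow>
      \<exists>F r. A \<subseteq> (\<Union>i::nat. \<Union>(F i)) \<and>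
        (\<forall>i. finite (F i) \<and> 0 \<le> r i \<and> r i \<le> \<delta> \<and> (\<forall>V\<in>F i. bounded V \<and> diameter V \<le> r i)) \<and>
        summable (\<lambda>i. real (card (F i)) * r i powr s) \<and>
        (\<Sum>i. real (card (F i)) * r i powr s) \<le> \<eta>"
  shows "hausdorff_measure s A = 0"
  unfolding hausdorff_measure_eq_0_iff
proof safe
  fix \<delta> :: real assume \<delta>: "\<delta> > 0"
  have eps: "hausdorff_premeasure s \<delta> A \<le> 0 + ennreal \<eta>" if "\<eta> > 0" for \<eta>
  proof -
    from cov[OF \<open>\<delta> > 0\<close> \<open>\<eta> > 0\<close>]
    obtain F :: "nat \<Rightarrow> 'a set set" and r where F0: "A \<subseteq> (\<Union>i::nat. \<Union>(F i)) \<and>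
        (\<forall>i. finite (F i) \<and> 0 \<le> r i \<and> r i \<le> \<delta> \<and> (\<forall>V\<in>F i. bounded V \<and> diameter V \<le> r i)) \<and>
        summable (\<lambda>i. real (card (F i)) * r i powr s) \<and>
        (\<Sum>i. real (card (F i)) * r i powr s) \<le> \<eta>"
      by (elim exE) (rule that)
    then have F: "A \<subseteq> (\<Union>i::nat. \<Union>(F i))"
        "\<And>i. finite (F i)" "\<And>i. 0 \<le> r i" "\<And>i. r i \<le> \<delta>"
        "\<And>i V. V\<in>F i \<Longrightarrow> bounded V" "\<And>i V. V\<in>F i \<Longrightarrow> diameter V \<le> r i"
        "summable (\<lambda>i. real (card (F i)) * r i powr s)"
        "(\<Sum>i. real (card (F i)) * r i powr s) \<le> \<eta>"
      by simp_all
    have "hausdorff_premeasure s \<delta> A \<le> (\<Sum>i. \<Sum>V\<in>F i. diam_power s V)"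
      using F(1-5) order_trans[OF F(6,4)] \<delta> by (intro hausdorff_premeasure_le_finite_families) auto
    also have "\<dots> \<le> (\<Sum>i. ennreal (real (card (F i)) * r i powr s))"
    proof (intro suminf_le)
      fix i
      have "(\<Sum>V\<in>F i. diam_power s V) \<le> (\<Sum>V\<in>F i. ennreal (r i powr s))"
        using s F(5,6) by (intro sum_mono)
          (auto simp: diam_power_pos intro!: ennreal_leI powr_mono2 diameter_ge_0)
      also have "\<dots> = ennreal (real (card (F i)) * r i powr s)"
        by (simp add: ennreal_mult' ennreal_of_nat_eq_real_of_nat)
      finally show "(\<Sum>V\<in>F i. diam_power s V) \<le> ennreal (real (card (F i)) * r i powr s)" .
    qed auto
    also have "\<dots> = ennreal (\<Sum>i. real (card (F i)) * r i powr s)"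
      by (intro suminf_ennreal2 F) auto
    also have "\<dots> \<le> 0 + ennreal \<eta>" using F(8) by (simp add: ennreal_leI)
    finally show ?thesis .
  qed
  have "hausdorff_premeasure s \<delta> A \<le> 0"
    by (rule ennreal_le_epsilon) (rule eps)
  then show "hausdorff_premeasure s \<delta> A = 0" by simp
qed

text \<open>A small diameter can be traded for a power of \<open>1 / M\<close> at the price of a
  factor \<open>M powr s\<close>. The extra \<open>e\<close> serves the case \<open>d = 0\<close>,
  where no power of \<open>1 / M\<close> is comparable with \<open>d\<close>.\<close>

lemma scale_choice:
  fixes M :: nat
  assumes M: "M \<ge> 2" and s: "s > 0" and d: "0 \<le> d" "d \<le> (1 / real M) ^ n0" and e: "e > 0"
  obtains n where "n \<ge> n0" "d \<le> (1 / real M) ^ n"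
    "((1 / real M) ^ n) powr s \<le> real M powr s * d powr s + e"
proof -
  define x where "x = 1 / real M"
  have x: "0 < x" "x < 1" "real M * x = 1" using M by (auto simp: x_def)
  show thesis
  proof (cases "d = 0")
    case True
    have "x powr s < 1" using x s powr_less_mono2[of s x 1] by simp
    then obtain k where k: "(x powr s) ^ k < e"
      using real_arch_pow_inv[OF e] by blast
    have "(x ^ max k n0) powr s = (x powr s) ^ max k n0"
      using x by (simp add: powr_powr powr_realpow[symmetric] mult.commute)
    also have "\<dots> \<le> (x powr s) ^ k"
      using \<open>x powr s < 1\<close> x by (intro power_decreasing) auto
    finally show ?thesis using that[of "max k n0"] k True x e by (simp add: x_def[symmetric])
  next
    case False
    then have "d > 0" using d by simp
    then obtain k where "x ^ k < d" using real_arch_pow_inv x by blast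
    then have ex: "\<exists>k. x ^ k < d" by blast
    \<comment> \<open>The first power to fall below \<open>d\<close>; its predecessor is at least
      \<open>d\<close> and at most \<open>M * d\<close>.\<close>
    define N where "N = (LEAST k. x ^ k < d)"
    have N: "x ^ N < d" unfolding N_def by (rule LeastI_ex[OF ex])
    have "N > n0"
    proof (rule ccontr)
      assume "\<not> N > n0"
      then have "x ^ n0 \<le> x ^ N" using x by (intro power_decreasing) auto
      then show False using N d by (simp add: x_def)
    qed
    then obtain n where n: "N = Suc n" "n \<ge> n0" by (cases N) auto
    have dn: "d \<le> x ^ n" using not_less_Least[of n "\<lambda>k. x ^ k < d"] n N_def by force
    have "x ^ n = real M * x ^ Suc n" using x by simp
    also have "\<dots> \<le> real M * d" using N n by (intro mult_left_mono) auto
    finally have "(x ^ n) powr s \<le> (real M * d) powr s" using x s by (intro powr_mono2) auto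
    also have "\<dots> = real M powr s * d powr s" using d by (simp add: powr_mult)
    finally show ?thesis using that[of n] n dn e by (simp add: x_def)
  qed
qed

text \<open>Widths that are powers of \<open>1 / M\<close> allow each covering set to be matched
  with cells of a single level, and \<open>n0\<close> forces all these levels to be deep.\<close>

lemma hausdorff_null_scaled_cover:
  fixes A :: "'a::metric_space set" and M :: nat
  assumes M: "M \<ge> 2" and s: "s > 0" and null: "hausdorff_measure s A = 0" and \<eta>: "\<eta> > 0"
  obtains U :: "nat \<Rightarrow> 'a set" and n :: "nat \<Rightarrow> nat"
  where "A \<subseteq> (\<Union>i. U i)" "\<And>i. bounded (U i)" "\<And>i. diameter (U i) \<le> (1 / real M) ^ n i"
    "\<And>i. n i \<ge> n0" "summable (\<lambda>i. ((1 / real M) ^ n i) powr s)"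
    "(\<Sum>i. ((1 / real M) ^ n i) powr s) \<le> \<eta>"
proof -
  \<comment> \<open>\<open>M powr s\<close> is the rounding factor of \<open>scale_choice\<close>,
    and 2 is the sum of the errors \<open>(1/2) ^ i\<close> allotted to the individual sets.\<close>
  define \<eta>' where "\<eta>' = \<eta> / (real M powr s + 2)"
  have den: "real M powr s + 2 > 0" by (simp add: add_nonneg_pos)
  have \<eta>': "\<eta>' > 0" "real M powr s * \<eta>' + 2 * \<eta>' = \<eta>"
  proof -
    show "\<eta>' > 0" using \<eta> den by (simp add: \<eta>'_def)
    have "(real M powr s + 2) * \<eta>' = \<eta>" using den by (simp add: \<eta>'_def)
    then show "real M powr s * \<eta>' + 2 * \<eta>' = \<eta>" by (simp add: algebra_simps)
  qed
  have "hausdorff_premeasure s ((1 / real M) ^ n0) A = 0"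
    using null M unfolding hausdorff_measure_eq_0_iff by simp
  then have "hausdorff_premeasure s ((1 / real M) ^ n0) A < ennreal \<eta>'" using \<eta>' by simp
  then obtain U where U: "A \<subseteq> (\<Union>i. U i)" "\<And>i. bounded (U i)"
    "\<And>i. diameter (U i) \<le> (1 / real M) ^ n0" "(\<Sum>i. diam_power s (U i)) < ennreal \<eta>'"
    by (rule hausdorff_premeasure_lessE) blast
  have sum: "(\<Sum>i. ennreal (diameter (U i) powr s)) < ennreal \<eta>'"
    using U(4) s by (simp add: diam_power_pos)
  then have smb: "summable (\<lambda>i. diameter (U i) powr s)"
    using less_trans[OF sum ennreal_less_top] by (intro summable_suminf_not_top) auto
  have le: "(\<Sum>i. diameter (U i) powr s) \<le> \<eta>'"
  proof -
    have "(\<Sum>i. ennreal (diameter (U i) powr s)) = ennreal (\<Sum>i. diameter (U i) powr s)"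
      by (rule suminf_ennreal2[OF _ smb]) simp
    then have "ennreal (\<Sum>i. diameter (U i) powr s) \<le> ennreal \<eta>'"
      using less_imp_le[OF sum] by (rule ord_eq_le_trans[OF sym])
    then show ?thesis using \<eta>'(1) by (subst (asm) ennreal_le_iff) auto
  qed
  have "\<exists>n. n \<ge> n0 \<and> diameter (U i) \<le> (1 / real M) ^ n \<and>
      ((1 / real M) ^ n) powr s \<le> real M powr s * diameter (U i) powr s + \<eta>' * (1/2) ^ i" for i
    by (rule scale_choice[OF M s diameter_ge_0[OF U(2)] U(3), of "\<eta>' * (1/2) ^ i" i]) (use \<eta>' in auto)
  then obtain n where n: "\<And>i. n i \<ge> n0" "\<And>i. diameter (U i) \<le> (1 / real M) ^ n i"
    "\<And>i. ((1 / real M) ^ n i) powr s \<le> real M powr s * diameter (U i) powr s + \<eta>' * (1/2) ^ i"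
    by metis
  have smb2: "summable (\<lambda>i. real M powr s * diameter (U i) powr s + \<eta>' * (1/2) ^ i)"
    by (intro summable_add summable_mult smb summable_geometric) auto
  have smb3: "summable (\<lambda>i. ((1 / real M) ^ n i) powr s)"
    by (rule summable_comparison_test'[OF smb2, of 0]) (use n in auto)
  have "(\<Sum>i. ((1 / real M) ^ n i) powr s)
      \<le> (\<Sum>i. real M powr s * diameter (U i) powr s + \<eta>' * (1/2) ^ i)"
    by (intro suminf_le n smb2 smb3)
  also have "\<dots> = real M powr s * (\<Sum>i. diameter (U i) powr s) + \<eta>' * (\<Sum>i. (1/2) ^ i)"
    by (subst suminf_add[symmetric])
       (auto intro!: summable_mult smb summable_geometric simp: suminf_mult smb summable_geometric)
  also have "(\<Sum>i. (1/2::real) ^ i) = 2" by (subst suminf_geometric) auto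
  also have "real M powr s * (\<Sum>i. diameter (U i) powr s) + \<eta>' * 2 \<le> real M powr s * \<eta>' + \<eta>' * 2"
    by (intro add_mono mult_left_mono le) (use \<eta>' in auto)
  also have "\<dots> = \<eta>" using \<eta>' by simp
  finally show thesis using that[OF U(1,2) n(2,1) smb3] by blast
qed

lemma hausdorff_dim_interval_le:
  fixes a b :: real
  shows "hausdorff_dim {a..b} \<le> 1"
proof (rule ccontr)
  assume "\<not> hausdorff_dim {a..b} \<le> 1"
  then have "ennreal 1 < hausdorff_dim {a..b}" by simp
  then obtain s' where s': "ennreal 1 < s'" "s' < hausdorff_dim {a..b}" using dense by blast
  then obtain s where s: "s' = ennreal s" "s \<ge> 0" by (cases s') auto
  then have "s > 1" using s' by (simp add: ennreal_less_iff)
  have "hausdorff_measure s {a..b} = 0"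
  proof (rule hausdorff_measure_0I)
    show "s > 0" using \<open>s > 1\<close> by simp
    fix \<delta> \<eta> :: real assume pos: "\<delta> > 0" "\<eta> > 0"
    \<comment> \<open>The \<open>+ 1\<close> makes \<open>c\<close> exceed \<open>b - a\<close>
      strictly: then the right endpoint also falls into one of the \<open>n\<close> pieces, and
      \<open>c\<close> is positive for degenerate and empty intervals.\<close>
    define c where "c = \<bar>b - a\<bar> + 1"
    have c: "c > 0" by (simp add: c_def)
    have "(\<lambda>n. c powr s * real n powr (1 - s)) \<longlonglongrightarrow> c powr s * 0"
      using \<open>s > 1\<close> by (intro tendsto_intros tendsto_neg_powr filterlim_real_sequentially) auto
    then have "\<forall>\<^sub>F n in sequentially. c powr s * real n powr (1 - s) < \<eta>"
      using pos by (intro order_tendstoD) auto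
    moreover have "\<forall>\<^sub>F n in sequentially. c / \<delta> < real n"
      using filterlim_real_sequentially by (simp add: filterlim_at_top_dense)
    moreover have "\<forall>\<^sub>F n in sequentially. n > (0::nat)" by (rule eventually_gt_at_top)
    ultimately have "\<forall>\<^sub>F n in sequentially. c powr s * real n powr (1 - s) < \<eta> \<and> c / \<delta> < real n \<and> n > 0"
      by eventually_elim simp
    then obtain n where n: "c powr s * real n powr (1 - s) < \<eta>" "c / \<delta> < real n" "n > 0"
      using eventually_happens'[OF sequentially_bot] by blast
    define V where "V k = {a + c * real k / real n .. a + c * real (Suc k) / real n}" for k
    define F where "F i = (if i = 0 then V ` {..<n} else {})" for i :: nat
    define r where "r i = (if i = 0 then c / real n else 0)" for i :: nat
    have cover: "{a..b} \<subseteq> (\<Union>i. \<Union>(F i))"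
    proof
      fix x assume x: "x \<in> {a..b}"
      define k where "k = nat \<lfloor>(x - a) * real n / c\<rfloor>"
      have "(x - a) * real n / c \<ge> 0" using x c by simp
      then have k: "real k \<le> (x - a) * real n / c" "(x - a) * real n / c < real k + 1"
        unfolding k_def by linarith+
      have "(x - a) * real n / c < real n"
      proof -
        have "(x - a) / c < 1" using x c by (simp add: c_def)
        then show ?thesis using n(3) mult_strict_right_mono[of "(x - a) / c" 1 "real n"] by simp
      qed
      then have "k < n" using k by linarith
      moreover have "x \<in> V k"
        using k c n(3) by (simp add: V_def field_simps)
      ultimately have "x \<in> \<Union>(F 0)" by (auto simp: F_def)
      then show "x \<in> (\<Union>i. \<Union>(F i))" by blast
    qed
    have r: "c / real n \<le> \<delta>" using n pos by (simp add: field_simps)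
    have dV: "diameter (V k) = c / real n" for k
    proof -
      have "c * real k / real n \<le> c * real (Suc k) / real n"
        using c by (intro divide_right_mono mult_left_mono) auto
      moreover have "c * real (Suc k) / real n - c * real k / real n = c / real n"
        by (simp add: add_divide_distrib distrib_left)
      ultimately show ?thesis
        unfolding V_def by (subst diameter_closed_interval) auto
    qed
    have "card (V ` {..<n}) \<le> n" using card_image_le[of "{..<n}" V] by simp
    then have "real (card (V ` {..<n})) * (c / real n) powr s \<le> real n * (c / real n) powr s"
      by (intro mult_right_mono) auto
    also have "\<dots> = c powr s * real n powr (1 - s)"
      using c n(3) by (simp add: powr_divide powr_diff)
    also have "\<dots> \<le> \<eta>" using n by simp
    finally have le: "real (card (V ` {..<n})) * (c / real n) powr s \<le> \<eta>" .
    have eq: "(\<lambda>i. real (card (F i)) * r i powr s)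
        = (\<lambda>i. if i = 0 then real (card (V ` {..<n})) * (c / real n) powr s else 0)"
      by (auto simp: F_def r_def)
    have sums: "(\<lambda>i. real (card (F i)) * r i powr s) sums (real (card (V ` {..<n})) * (c / real n) powr s)"
      unfolding eq using sums_If_finite[of "\<lambda>i. i = 0" "\<lambda>_. real (card (V ` {..<n})) * (c / real n) powr s"] by simp
    have "(\<forall>i. finite (F i) \<and> 0 \<le> r i \<and> r i \<le> \<delta> \<and> (\<forall>V\<in>F i. bounded V \<and> diameter V \<le> r i))"
      using r c n pos dV by (auto simp: F_def r_def) (auto simp: V_def)
    then show "\<exists>F r. {a..b} \<subseteq> (\<Union>i::nat. \<Union>(F i)) \<and>
        (\<forall>i. finite (F i) \<and> 0 \<le> r i \<and> r i \<le> \<delta> \<and> (\<forall>V\<in>F i. bounded V \<and> diameter V \<le> r i)) \<and>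
        summable (\<lambda>i. real (card (F i)) * r i powr s) \<and>
        (\<Sum>i. real (card (F i)) * r i powr s) \<le> \<eta>"
      using cover le sums_summable[OF sums] sums_unique[OF sums, symmetric]
      by (intro exI[of _ F] exI[of _ r]) simp
  qed
  then have "hausdorff_dim {a..b} \<le> ennreal s" using s by (intro hausdorff_dim_le) auto
  then show False using s s' by simp
qed

section \<open>Cells, strips and lines\<close>

definition ancestor :: "nat \<Rightarrow> nat \<Rightarrow> nat \<Rightarrow> nat \<times> nat \<Rightarrow> nat \<times> nat" where
  "ancestor M n m Q = (fst Q div M ^ (n - m), snd Q div M ^ (n - m))"

text \<open>Levels start at 1, because the unit square itself is subject to no decision.\<close>

definition lineage :: "nat \<Rightarrow> nat \<Rightarrow> nat \<times> nat \<Rightarrow> (nat \<times> nat \<times> nat) set" where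
  "lineage M n Q = (\<lambda>m. (m, ancestor M n m Q)) ` {1..n}"

text \<open>One-dimensional growth at every scale: below a cell of level \<open>m\<close> there are
  of the order of \<open>M ^ (n - m)\<close> cells, not the full
  \<open>(M ^ (n - m))\<^sup>2\<close>. This is the property of strips that the moment bound rests
  on.\<close>

definition thin :: "nat \<Rightarrow> nat \<Rightarrow> nat \<Rightarrow> (nat \<times> nat) set \<Rightarrow> bool" where
  "thin K M n S \<longleftrightarrow> S \<subseteq> cell_indices M n \<and>
     (\<forall>m\<le>n. \<forall>c. card {Q \<in> S. ancestor M n m Q = c} \<le> K * M ^ (n - m))"

text \<open>With \<open>N = M ^ n\<close>, the triple encodes a direction
  \<open>(\<alpha>, \<beta>) / N\<close> and an offset \<open>\<gamma> / N\<close>. Divided by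
  \<open>N\<^sup>2\<close>, the inequality says that the inner product of the direction with the
  lower left corner of the cell is within \<open>6 / N\<close> of the offset. The 6 is 1 for the
  half-width of the original strip, 2 for the position inside the cell and 3 for rounding the three
  parameters.\<close>

definition strip_cells :: "nat \<Rightarrow> nat \<Rightarrow> int \<times> int \<times> int \<Rightarrow> (nat \<times> nat) set" where
  "strip_cells M n = (\<lambda>(\<alpha>, \<beta>, \<gamma>). {(i, j) \<in> cell_indices M n.
     \<bar>int i * \<alpha> + int j * \<beta> - \<gamma> * int M ^ n\<bar> \<le> 6 * int M ^ n})"

text \<open>A unit vector has a component of modulus at least \<open>5/8\<close>, as
  \<open>2 * (5/8)\<^sup>2 < 1\<close>; rounding it to a multiple of \<open>1 / N\<close> with
  \<open>N = M ^ n \<ge> 2\<close> leaves at least \<open>1/8\<close>. The 2 bounds the offset of a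
  line through the unit square.\<close>

definition line_params :: "nat \<Rightarrow> nat \<Rightarrow> (int \<times> int \<times> int) set" where
  "line_params M n = {(\<alpha>, \<beta>, \<gamma>). \<bar>\<alpha>\<bar> \<le> int M ^ n \<and> \<bar>\<beta>\<bar> \<le> int M ^ n \<and> \<bar>\<gamma>\<bar> \<le> 2 * int M ^ n \<and>
     (int M ^ n \<le> 8 * \<bar>\<alpha>\<bar> \<or> int M ^ n \<le> 8 * \<bar>\<beta>\<bar>)}"

section \<open>Ancestors and lineages of cells\<close>

lemma finite_cell_indices [simp]: "finite (cell_indices M n)"
  by (simp add: cell_indices_def)

lemma retained_subset: "retained M R n \<subseteq> cell_indices M n"
  by (cases n) (auto simp: cell_indices_def)

lemma finite_retained [simp]: "finite (retained M R n)"
  by (rule finite_subset[OF retained_subset]) simp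

lemma ancestor_self [simp]: "ancestor M n n Q = Q"
  by (simp add: ancestor_def)

lemma ancestor_0: "Q \<in> cell_indices M n \<Longrightarrow> ancestor M n 0 Q = (0, 0)"
  by (auto simp: ancestor_def cell_indices_def)

lemma ancestor_Suc: "m \<le> n \<Longrightarrow> ancestor M (Suc n) m Q = ancestor M n m (ancestor M (Suc n) n Q)"
  by (auto simp: ancestor_def Suc_diff_le div_mult2_eq)

lemma ancestor_in_cell_indices:
  assumes "Q \<in> cell_indices M n" "m \<le> n"
  shows "ancestor M n m Q \<in> cell_indices M m"
proof -
  have "M ^ n = M ^ m * M ^ (n - m)" using assms(2) by (simp add: power_add[symmetric])
  then show ?thesis using assms by (auto simp: ancestor_def cell_indices_def intro!: less_mult_imp_div_less)
qed

text \<open>Unfolds the recursion into a conjunction of separate decisions, the form in which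
  independence applies.\<close>

lemma retained_iff:
  "Q \<in> retained M R n \<longleftrightarrow> Q \<in> cell_indices M n \<and> (\<forall>(m, c)\<in>lineage M n Q. R m c)"
proof (induction n arbitrary: Q)
  case 0
  then show ?case by (auto simp: cell_indices_def lineage_def)
next
  case (Suc n)
  obtain i j where Q: "Q = (i, j)" by (cases Q)
  have anc: "ancestor M (Suc n) n Q = (i div M, j div M)" by (simp add: Q ancestor_def Suc_diff_le)
  have "(\<forall>(m, c)\<in>lineage M (Suc n) Q. R m c) \<longleftrightarrow>
      (\<forall>(m, c)\<in>lineage M n (i div M, j div M). R m c) \<and> R (Suc n) Q"
    using ancestor_Suc[of _ n M Q] anc
    by (auto simp: lineage_def atLeastAtMostSuc_conv)
  then show ?case
    using Suc.IH[of "(i div M, j div M)"] ancestor_in_cell_indices[of Q M "Suc n" n] anc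
    by (auto simp: Q)
qed

section \<open>Counting the cells of a strip\<close>

lemma card_le_spread:
  fixes A :: "nat set"
  assumes "\<And>x y. x \<in> A \<Longrightarrow> y \<in> A \<Longrightarrow> x \<le> y + d"
  shows "finite A \<and> card A \<le> d + 1"
proof (cases "A = {}")
  case False
  define a where "a = (LEAST x. x \<in> A)"
  have a: "a \<in> A" "\<And>x. x \<in> A \<Longrightarrow> a \<le> x"
    using False unfolding a_def by (auto intro: LeastI Least_le)
  have "A \<subseteq> {a..a + d}" using a assms by auto
  then show ?thesis using card_mono[of "{a..a + d}" A] finite_subset[of A "{a..a+d}"] by auto
qed auto

lemma card_le_by_columns:
  assumes "finite J" "\<And>i j. (i, j) \<in> B \<Longrightarrow> j \<in> J"
    and "\<And>j. j \<in> J \<Longrightarrow> finite {i. (i, j) \<in> B} \<and> card {i. (i, j) \<in> B} \<le> c"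
  shows "card B \<le> c * card J"
proof -
  have "B = prod.swap ` (SIGMA j:J. {i. (i, j) \<in> B})" using assms(2) by force
  then have "card B = card (SIGMA j:J. {i. (i, j) \<in> B})"
    by (metis card_image inj_swap)
  also have "\<dots> = (\<Sum>j\<in>J. card {i. (i, j) \<in> B})"
    using assms by (intro card_SigmaI) auto
  also have "\<dots> \<le> (\<Sum>j\<in>J. c)" by (intro sum_mono) (use assms in auto)
  finally show ?thesis by (simp add: mult.commute)
qed

lemma card_le_by_rows:
  assumes "finite J" "\<And>i j. (i, j) \<in> B \<Longrightarrow> i \<in> J"
    and "\<And>i. i \<in> J \<Longrightarrow> finite {j. (i, j) \<in> B} \<and> card {j. (i, j) \<in> B} \<le> c"
  shows "card B \<le> c * card J"
proof -
  have "card (prod.swap ` B) \<le> c * card J"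
  proof (rule card_le_by_columns)
    have eq: "{i. (i, j) \<in> prod.swap ` B} = {i. (j, i) \<in> B}" for j by force
    show "finite {i. (i, j) \<in> prod.swap ` B} \<and> card {i. (i, j) \<in> prod.swap ` B} \<le> c" if "j \<in> J" for j
      unfolding eq by (rule assms(3)[OF that])
  qed (use assms in auto)
  then show ?thesis by (simp add: card_image)
qed

lemma div_fibre:
  fixes L c :: nat
  assumes "L > 0"
  shows "finite {j. j div L = c}" "card {j. j div L = c} = L"
proof -
  have "{j. j div L = c} = {c * L..<c * L + L}"
  proof safe
    show "j \<in> {j div L * L..<j div L * L + L}" for j
      using assms dividend_less_div_times[of L j] by auto
    show "j div L = c" if "j \<in> {c * L..<c * L + L}" for j
      using that by (intro div_nat_eqI) (auto simp: mult.commute)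
  qed
  then show "finite {j. j div L = c}" "card {j. j div L = c} = L" by auto
qed

text \<open>Two solutions differ by at most \<open>12 * N / \<bar>\<alpha>\<bar> \<le> 96\<close>,
  which leaves room for 97 consecutive integers.\<close>

lemma near_multiple_spread:
  fixes \<alpha> y N :: int
  assumes "N > 0" "N \<le> 8 * \<bar>\<alpha>\<bar>"
  shows "finite {i::nat. \<bar>int i * \<alpha> + y\<bar> \<le> 6 * N} \<and> card {i::nat. \<bar>int i * \<alpha> + y\<bar> \<le> 6 * N} \<le> 97"
proof -
  have "i \<le> i' + 96" if i: "\<bar>int i * \<alpha> + y\<bar> \<le> 6 * N" and i': "\<bar>int i' * \<alpha> + y\<bar> \<le> 6 * N" for i i' :: nat
  proof (rule ccontr)
    assume "\<not> ?thesis"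
    then have "97 * \<bar>\<alpha>\<bar> \<le> \<bar>int i - int i'\<bar> * \<bar>\<alpha>\<bar>" by (intro mult_right_mono) auto
    also have "\<dots> = \<bar>(int i * \<alpha> + y) - (int i' * \<alpha> + y)\<bar>"
      by (simp add: abs_mult[symmetric] algebra_simps)
    also have "\<dots> \<le> 12 * N" using i i' by linarith
    finally show False using assms by linarith
  qed
  then show ?thesis using card_le_spread[of "{i::nat. \<bar>int i * \<alpha> + y\<bar> \<le> 6 * N}" 96] by auto
qed

lemma card_mono_finite: "finite B \<and> card B \<le> c \<Longrightarrow> A \<subseteq> B \<Longrightarrow> finite A \<and> card A \<le> c"
  by (meson card_mono finite_subset le_trans)

text \<open>Below a fixed ancestor either index takes \<open>M ^ (n - m)\<close> values. If
  \<open>\<alpha>\<close> is the large coefficient, a fixed \<open>j\<close> admits at most 97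
  values of \<open>i\<close>; if \<open>\<beta>\<close> is, a fixed \<open>i\<close> admits at most
  97 values of \<open>j\<close>.\<close>

lemma thin_strip_cells:
  assumes M: "M \<ge> 1" and "v \<in> line_params M n"
  shows "thin 97 M n (strip_cells M n v)"
  unfolding thin_def
proof (intro conjI allI impI)
  obtain \<alpha> \<beta> \<gamma> where v: "v = (\<alpha>, \<beta>, \<gamma>)" by (cases v)
  define N where "N = int M ^ n"
  have N: "N > 0" using M by (simp add: N_def)
  show "strip_cells M n v \<subseteq> cell_indices M n" by (auto simp: strip_cells_def v)
  fix m c assume "m \<le> n"
  define L where "L = M ^ (n - m)"
  have L: "L > 0" using M by (simp add: L_def)
  define B where "B = {Q \<in> strip_cells M n v. ancestor M n m Q = c}"
  have B: "fst Q div L = fst c" "snd Q div L = snd c"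
      "\<bar>int (fst Q) * \<alpha> + int (snd Q) * \<beta> - \<gamma> * N\<bar> \<le> 6 * N" if "Q \<in> B" for Q
    using that by (auto simp: B_def strip_cells_def v ancestor_def L_def N_def)
  from assms(2) have "N \<le> 8 * \<bar>\<alpha>\<bar> \<or> N \<le> 8 * \<bar>\<beta>\<bar>" by (auto simp: line_params_def v N_def)
  then have "card B \<le> 97 * L"
  proof
    assume \<alpha>: "N \<le> 8 * \<bar>\<alpha>\<bar>"
    have "card B \<le> 97 * card {j. j div L = snd c}"
    proof (rule card_le_by_columns)
      fix j
      show "finite {i. (i, j) \<in> B} \<and> card {i. (i, j) \<in> B} \<le> 97"
        by (rule card_mono_finite[OF near_multiple_spread[OF N \<alpha>, of "int j * \<beta> - \<gamma> * N"]])
           (use B(3) in \<open>auto simp: algebra_simps\<close>)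
    qed (use B div_fibre[OF L] in auto)
    then show ?thesis using div_fibre[OF L] by simp
  next
    assume \<beta>: "N \<le> 8 * \<bar>\<beta>\<bar>"
    have "card B \<le> 97 * card {j. j div L = fst c}"
    proof (rule card_le_by_rows)
      fix i
      show "finite {j. (i, j) \<in> B} \<and> card {j. (i, j) \<in> B} \<le> 97"
        by (rule card_mono_finite[OF near_multiple_spread[OF N \<beta>, of "int i * \<alpha> - \<gamma> * N"]])
           (use B(3) in \<open>auto simp: algebra_simps\<close>)
    qed (use B div_fibre[OF L] in auto)
    then show ?thesis using div_fibre[OF L] by simp
  qed
  then show "card {Q \<in> strip_cells M n v. ancestor M n m Q = c} \<le> 97 * M ^ (n - m)"
    by (simp add: B_def L_def)
qed

lemma finite_line_params_card:
  assumes "M \<ge> 1"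
  shows "finite (line_params M n) \<and> card (line_params M n) \<le> 45 * (M ^ n) ^ 3"
proof -
  define N where "N = M ^ n"
  have N: "N \<ge> 1" using assms by (simp add: N_def)
  define W where "W = {- int N..int N} \<times> {- int N..int N} \<times> {- 2 * int N..2 * int N}"
  have sub: "line_params M n \<subseteq> W" by (auto simp: line_params_def W_def N_def)
  have "card W = (2 * N + 1) * ((2 * N + 1) * (4 * N + 1))"
    by (simp add: W_def card_cartesian_product nat_add_distrib nat_mult_distrib)
  also have "\<dots> \<le> (3 * N) * ((3 * N) * (5 * N))"
    using N by (intro mult_mono) auto
  also have "\<dots> = 45 * N ^ 3" by (simp add: power3_eq_cube)
  finally have "card W \<le> 45 * N ^ 3" .
  moreover have "finite W" by (simp add: W_def)
  ultimately show ?thesis using sub card_mono_finite unfolding N_def by blast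
qed

section \<open>Discretizing the strips\<close>

lemma inner_vec2: "x \<bullet> (y :: real ^ 2) = x $ 1 * y $ 1 + x $ 2 * y $ 2"
  by (simp add: inner_vec_def sum_2)

lemma norm_vec2_bounds:
  fixes u :: "real ^ 2"
  assumes "norm u = 1"
  shows "\<bar>u $ 1\<bar> \<le> 1" "\<bar>u $ 2\<bar> \<le> 1" "5/8 \<le> \<bar>u $ 1\<bar> \<or> 5/8 \<le> \<bar>u $ 2\<bar>"
proof -
  have sq: "(u $ 1)\<^sup>2 + (u $ 2)\<^sup>2 = 1"
    using assms by (simp add: norm_eq_1 inner_vec2 power2_eq_square)
  show "\<bar>u $ 1\<bar> \<le> 1" "\<bar>u $ 2\<bar> \<le> 1"
    using component_le_norm_cart[of u] assms by metis+
  show "5/8 \<le> \<bar>u $ 1\<bar> \<or> 5/8 \<le> \<bar>u $ 2\<bar>"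
  proof (rule ccontr)
    assume "\<not> ?thesis"
    then have "\<bar>u $ 1\<bar>\<^sup>2 \<le> (5/8)\<^sup>2" "\<bar>u $ 2\<bar>\<^sup>2 \<le> (5/8)\<^sup>2" by (intro power_mono; simp)+
    then show False using sq by (simp add: power2_eq_square)
  qed
qed

text \<open>One triple has to serve all cells that meet the strip around \<open>x0\<close>, so it
  comes from rounding the direction \<open>u\<close> and the offset \<open>x0 \<bullet> u\<close>
  alone, before any cell is considered.\<close>

lemma strip_cells_cover:
  fixes x0 u :: "real ^ 2"
  assumes M: "M \<ge> 2" and n: "n \<ge> 1" and u: "norm u = 1"
    and x0: "0 \<le> x0 $ 1" "x0 $ 1 \<le> 1" "0 \<le> x0 $ 2" "x0 $ 2 \<le> 1"
  obtains v where "v \<in> line_params M n"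
    "\<And>c x. c \<in> cell_indices M n \<Longrightarrow> x \<in> cell M n c \<Longrightarrow> \<bar>(x - x0) \<bullet> u\<bar> \<le> (1 / real M) ^ n
       \<Longrightarrow> c \<in> strip_cells M n v"
proof -
  define N where "N = real M ^ n"
  define a where "a = x0 \<bullet> u"
  have "real M ^ 1 \<le> real M ^ n" using M n by (intro power_increasing) auto
  then have N: "N \<ge> 2" using M unfolding N_def power_one_right by linarith
  note ub = norm_vec2_bounds[OF u]
  define \<alpha> \<beta> \<gamma> where "\<alpha> = \<lfloor>u $ 1 * N\<rfloor>" and "\<beta> = \<lfloor>u $ 2 * N\<rfloor>" and "\<gamma> = \<lfloor>a * N\<rfloor>"
  have fl: "real_of_int \<alpha> \<le> u $ 1 * N" "u $ 1 * N < real_of_int \<alpha> + 1"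
    "real_of_int \<beta> \<le> u $ 2 * N" "u $ 2 * N < real_of_int \<beta> + 1"
    "real_of_int \<gamma> \<le> a * N" "a * N < real_of_int \<gamma> + 1"
    unfolding \<alpha>_def \<beta>_def \<gamma>_def by linarith+
  have a2: "\<bar>a\<bar> \<le> 2"
  proof -
    have "\<bar>x0 $ 1 * u $ 1\<bar> \<le> 1 * 1" "\<bar>x0 $ 2 * u $ 2\<bar> \<le> 1 * 1"
      unfolding abs_mult using x0 ub by (intro mult_mono; simp)+
    then show ?thesis unfolding a_def inner_vec2 by linarith
  qed
  have NI: "N = real_of_int (int M ^ n)" by (simp add: N_def)
  have fl_bound: "\<bar>\<lfloor>t * N\<rfloor>\<bar> \<le> k * int M ^ n" if "\<bar>t\<bar> \<le> real_of_int k" for t k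
  proof -
    have "\<bar>t * N\<bar> \<le> real_of_int k * N" unfolding abs_mult using that N by (intro mult_mono) auto
    then have *: "t * N \<le> real_of_int (k * int M ^ n)" "- real_of_int (k * int M ^ n) \<le> t * N" by (auto simp: NI)
    from *(1) have "\<lfloor>t * N\<rfloor> \<le> k * int M ^ n" by linarith
    moreover from *(2) have "- (k * int M ^ n) \<le> \<lfloor>t * N\<rfloor>" by linarith
    ultimately show ?thesis by linarith
  qed
  have big: "int M ^ n \<le> 8 * \<bar>\<lfloor>t * N\<rfloor>\<bar>" if "5/8 \<le> \<bar>t\<bar>" for t
  proof -
    have "5/8 * N \<le> \<bar>t\<bar> * N" using that N by (intro mult_right_mono) auto
    also have "\<dots> = \<bar>t * N\<bar>" using N by (simp add: abs_mult)
    finally have "5/8 * N \<le> \<bar>t * N\<bar>" .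
    moreover have "\<bar>t * N\<bar> \<le> \<bar>real_of_int \<lfloor>t * N\<rfloor>\<bar> + 1" by linarith
    ultimately have "N \<le> real_of_int (8 * \<bar>\<lfloor>t * N\<rfloor>\<bar>)" using N by simp
    then show ?thesis unfolding NI by (simp only: of_int_le_iff)
  qed
  have "(\<alpha>, \<beta>, \<gamma>) \<in> line_params M n"
    using fl_bound[of "u $ 1" 1] fl_bound[of "u $ 2" 1] fl_bound[of a 2] ub a2 big[of "u $ 1"] big[of "u $ 2"]
    by (auto simp: line_params_def \<alpha>_def \<beta>_def \<gamma>_def)
  moreover have "c \<in> strip_cells M n (\<alpha>, \<beta>, \<gamma>)"
    if c: "c \<in> cell_indices M n" "x \<in> cell M n c" "\<bar>(x - x0) \<bullet> u\<bar> \<le> (1 / real M) ^ n" for c x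
  proof -
    obtain i j where ij: "c = (i, j)" by (cases c)
    define \<xi> \<eta> where "\<xi> = N * x $ 1 - real i" and "\<eta> = N * x $ 2 - real j"
    have N0: "N > 0" using N by simp
    have \<xi>: "0 \<le> \<xi>" "\<xi> \<le> 1" "0 \<le> \<eta>" "\<eta> \<le> 1"
      using c(2) N0 unfolding cell_def ij \<xi>_def \<eta>_def N_def[symmetric]
      by (auto simp: field_simps)
    have "i < M ^ n" "j < M ^ n" using c(1) by (auto simp: ij cell_indices_def)
    then have ijN: "real i \<le> N" "real j \<le> N" unfolding N_def of_nat_power[symmetric] by linarith+
    have "N * \<bar>(x - x0) \<bullet> u\<bar> \<le> N * (1 / N)"
      using c(3) N0 by (intro mult_left_mono) (auto simp: N_def power_one_over)
    then have d1: "\<bar>N * (x \<bullet> u) - N * a\<bar> \<le> 1"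
      using N0 by (simp add: a_def inner_diff_left abs_mult[symmetric] right_diff_distrib[symmetric])
         (simp add: abs_mult)
    have "N * (x \<bullet> u) = real i * u $ 1 + real j * u $ 2 + \<xi> * u $ 1 + \<eta> * u $ 2"
      unfolding inner_vec2 \<xi>_def \<eta>_def by (simp add: algebra_simps)
    moreover have "\<bar>\<xi> * u $ 1\<bar> \<le> 1 * 1" "\<bar>\<eta> * u $ 2\<bar> \<le> 1 * 1"
      unfolding abs_mult using \<xi> ub by (intro mult_mono; simp)+
    ultimately have "\<bar>real i * u $ 1 + real j * u $ 2 - N * a\<bar> \<le> 3" using d1 by linarith
    then have "\<bar>real i * u $ 1 + real j * u $ 2 - N * a\<bar> * N \<le> 3 * N" using N0 by (intro mult_right_mono) auto
    then have "\<bar>(real i * u $ 1 + real j * u $ 2 - N * a) * N\<bar> \<le> 3 * N" using N0 by (simp add: abs_mult)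
    moreover have "(real i * u $ 1 + real j * u $ 2 - N * a) * N
        = real i * (u $ 1 * N) + real j * (u $ 2 * N) - N * (a * N)" by (simp add: algebra_simps)
    ultimately have d3: "\<bar>real i * (u $ 1 * N) + real j * (u $ 2 * N) - N * (a * N)\<bar> \<le> 3 * N" by simp
    \<comment> \<open>A rounding error below 1 gets multiplied by an index of size at most
      \<open>N\<close>, so each of the three parameters contributes at most
      \<open>N\<close>.\<close>
    have err: "0 \<le> real k * (t - real_of_int \<tau>) \<and> real k * (t - real_of_int \<tau>) \<le> N"
      if "real k \<le> N" "real_of_int \<tau> \<le> t" "t < real_of_int \<tau> + 1" for k t \<tau>
    proof -
      have "real k * (t - real_of_int \<tau>) \<le> N * 1" using that N0 by (intro mult_mono) auto
      then show ?thesis using that by simp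
    qed
    have e1: "0 \<le> real i * (u $ 1 * N - real_of_int \<alpha>)" "real i * (u $ 1 * N - real_of_int \<alpha>) \<le> N"
      using err[OF ijN(1) fl(1,2)] by auto
    have e2: "0 \<le> real j * (u $ 2 * N - real_of_int \<beta>)" "real j * (u $ 2 * N - real_of_int \<beta>) \<le> N"
      using err[OF ijN(2) fl(3,4)] by auto
    have e3: "0 \<le> N * (a * N - real_of_int \<gamma>)" "N * (a * N - real_of_int \<gamma>) \<le> N"
      using err[of "M ^ n" \<gamma> "a * N"] fl(5,6) by (auto simp: N_def)
    have "\<bar>real i * real_of_int \<alpha> + real j * real_of_int \<beta> - real_of_int \<gamma> * N\<bar> \<le> 6 * N"
    proof -
      have "real i * real_of_int \<alpha> + real j * real_of_int \<beta> - real_of_int \<gamma> * N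
          = (real i * (u $ 1 * N) + real j * (u $ 2 * N) - N * (a * N))
            - real i * (u $ 1 * N - real_of_int \<alpha>) - real j * (u $ 2 * N - real_of_int \<beta>)
            + N * (a * N - real_of_int \<gamma>)" by (simp add: algebra_simps)
      then show ?thesis using d3 e1 e2 e3 N0 by linarith
    qed
    then have "\<bar>real_of_int (int i * \<alpha> + int j * \<beta> - \<gamma> * int M ^ n)\<bar> \<le> real_of_int (6 * int M ^ n)"
      by (simp add: NI)
    then have "\<bar>int i * \<alpha> + int j * \<beta> - \<gamma> * int M ^ n\<bar> \<le> 6 * int M ^ n"
      by linarith
    then show ?thesis using c(1) by (simp add: strip_cells_def ij)
  qed
  ultimately show thesis using that by blast
qed

section \<open>Geometry of the cells and compactness of the stages\<close>

lemma cell_ancestor: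
  assumes M: "M \<ge> 1" and "m \<le> n"
  shows "cell M n Q \<subseteq> cell M m (ancestor M n m Q)"
proof -
  define L where "L = M ^ (n - m)"
  have L: "L > 0" using M by (simp add: L_def)
  have Mn: "real M ^ n = real M ^ m * real L"
    using assms(2) by (simp add: L_def power_add[symmetric])
  have Mm: "real M ^ m > 0" using M by simp
  have lo: "real (i div L) / real M ^ m \<le> real i / real M ^ n" for i
  proof -
    have "real (i div L) * real L \<le> real i" by (metis of_nat_mono of_nat_mult div_times_less_eq_dividend)
    then show ?thesis using L Mm unfolding Mn by (simp add: field_simps)
  qed
  have hi: "real (i + 1) / real M ^ n \<le> real (i div L + 1) / real M ^ m" for i
  proof -
    have "i + 1 \<le> (i div L + 1) * L" using L by (metis Suc_eq_plus1 dividend_less_div_times Suc_leI add.commute mult_Suc)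
    then have "real (i + 1) \<le> real (i div L + 1) * real L" by (metis of_nat_mono of_nat_mult)
    then have "real (i + 1) / (real M ^ m * real L) \<le> (real (i div L + 1) * real L) / (real M ^ m * real L)"
      by (intro divide_right_mono) auto
    then show ?thesis using L unfolding Mn by simp
  qed
  show ?thesis
  proof
    fix x assume x: "x \<in> cell M n Q"
    obtain i j where Q: "Q = (i, j)" by (cases Q)
    have "real i / real M ^ n \<le> x $ 1" "x $ 1 \<le> real (i + 1) / real M ^ n"
        "real j / real M ^ n \<le> x $ 2" "x $ 2 \<le> real (j + 1) / real M ^ n"
      using x by (auto simp: cell_def Q)
    then show "x \<in> cell M m (ancestor M n m Q)"
      using lo[of i] lo[of j] hi[of i] hi[of j]
      unfolding cell_def Q ancestor_def L_def[symmetric] by simp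
  qed
qed

lemma cell_dist_le:
  assumes M: "M \<ge> 1" and "x \<in> cell M n c" "y \<in> cell M n c"
  shows "dist x y \<le> 2 * (1 / real M) ^ n"
proof -
  obtain i j where c: "c = (i, j)" by (cases c)
  have "\<bar>(x - y) $ k\<bar> \<le> (1 / real M) ^ n" for k
    using assms exhaust_2[of k] by (auto simp: cell_def c add_divide_distrib power_one_over abs_le_iff inverse_eq_divide)
  then have "(\<Sum>k\<in>UNIV. \<bar>(x - y) $ k\<bar>) \<le> (\<Sum>k\<in>(UNIV :: 2 set). (1 / real M) ^ n)" by (rule sum_mono)
  \<comment> \<open>Passing through the l1 norm gives the factor 2 in place of
    \<open>sqrt 2\<close>.\<close>
  then show ?thesis using norm_le_l1_cart[of "x - y"] by (simp add: dist_norm)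
qed

lemma bounded_cell: "M \<ge> 1 \<Longrightarrow> bounded (cell M n c)"
  unfolding bounded_two_points using cell_dist_le by blast

lemma diameter_cell_le: "M \<ge> 1 \<Longrightarrow> diameter (cell M n c) \<le> 2 * (1 / real M) ^ n"
  by (rule diameter_le) (auto simp: dist_norm[symmetric] intro!: cell_dist_le)

lemma compact_cell: "M \<ge> 1 \<Longrightarrow> compact (cell M n c)"
proof -
  assume "M \<ge> 1"
  obtain i j where c: "c = (i, j)" by (cases c)
  have "closed (cell M n c)"
    unfolding cell_def c case_prod_conv
    by (intro closed_Collect_conj closed_Collect_le continuous_intros)
  then show ?thesis using bounded_cell[OF \<open>M \<ge> 1\<close>] by (simp add: compact_eq_bounded_closed)
qed

lemma cell_corner: "M \<ge> 1 \<Longrightarrow> vector [real (fst c) / real M ^ n, real (snd c) / real M ^ n] \<in> cell M n c"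
  by (cases c) (auto simp: cell_def divide_right_mono)

text \<open>In units of the cell side, the corner of the cell is within 1 of \<open>x\<close> and
  \<open>x\<close> within 2 of \<open>y\<close> in each coordinate. At most 7 integers lie within 3
  of a given real number, and \<open>49 = 7 * 7\<close>.\<close>

lemma card_cells_near:
  fixes y :: "real ^ 2"
  assumes M: "M \<ge> 1"
  shows "finite {c. \<exists>x\<in>cell M n c. dist x y \<le> 2 * (1 / real M) ^ n} \<and>
    card {c. \<exists>x\<in>cell M n c. dist x y \<le> 2 * (1 / real M) ^ n} \<le> 49"
proof -
  define N where "N = real M ^ n"
  have N: "N > 0" using M by (simp add: N_def)
  define A where "A z = {i::nat. \<bar>real i - N * z\<bar> \<le> 3}" for z
  have A: "finite (A z) \<and> card (A z) \<le> 6 + 1" for z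
    by (rule card_le_spread) (auto simp: A_def)
  have sub: "{c. \<exists>x\<in>cell M n c. dist x y \<le> 2 * (1 / real M) ^ n} \<subseteq> A (y $ 1) \<times> A (y $ 2)"
  proof safe
    fix i j x assume x: "x \<in> cell M n (i, j)" "dist x y \<le> 2 * (1 / real M) ^ n"
    have "\<bar>x $ k - y $ k\<bar> \<le> 2 / N" for k
      using order_trans[OF component_le_norm_cart[of "x - y" k]] x(2)
      by (simp add: dist_norm N_def power_one_over inverse_eq_divide)
    then have d: "\<bar>N * (x $ k) - N * (y $ k)\<bar> \<le> 2" for k
    proof -
      have "N * \<bar>x $ k - y $ k\<bar> \<le> N * (2 / N)" using \<open>\<bar>x $ k - y $ k\<bar> \<le> 2 / N\<close> N by (intro mult_left_mono) auto
      then show ?thesis using N by (simp add: right_diff_distrib[symmetric] abs_mult)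
    qed
    have "real i \<le> N * x $ 1" "N * x $ 1 \<le> real i + 1" "real j \<le> N * x $ 2" "N * x $ 2 \<le> real j + 1"
      using x(1) N unfolding cell_def N_def[symmetric] by (auto simp: field_simps)
    then show "i \<in> A (y $ 1)" "j \<in> A (y $ 2)" using d[of 1] d[of 2] unfolding A_def by auto
  qed
  have "card (A (y $ 1) \<times> A (y $ 2)) \<le> 7 * 7"
    unfolding card_cartesian_product by (intro mult_mono) (use A in auto)
  then show ?thesis using card_mono_finite[OF _ sub] A by simp
qed

lemma compact_percolation_stage: "M \<ge> 1 \<Longrightarrow> compact (percolation_stage M R n)"
  unfolding percolation_stage_def by (intro compact_UN compact_cell) auto

lemma percolation_stage_antimono:
  assumes M: "M \<ge> 1" and "m \<le> n"
  shows "percolation_stage M R n \<subseteq> percolation_stage M R m"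
  using assms(2)
proof (rule lift_Suc_antimono_le[rotated])
  show "percolation_stage M R (Suc k) \<subseteq> percolation_stage M R k" for k
    using cell_ancestor[OF M, of k "Suc k"]
    by (fastforce simp: percolation_stage_def ancestor_def Suc_diff_le)
qed

lemma percolation_set_subset: "M \<ge> 1 \<Longrightarrow> percolation_set M R \<subseteq> percolation_stage M R n"
  using percolation_stage_antimono[of M n "max 1 n" R] unfolding percolation_set_def
  by (intro subset_trans[OF INF_lower[of "max 1 n"]]) auto

lemma percolation_set_unit_square:
  assumes "M \<ge> 1" "x \<in> percolation_set M R"
  shows "0 \<le> x $ 1" "x $ 1 \<le> 1" "0 \<le> x $ 2" "x $ 2 \<le> 1"
  using percolation_set_subset[OF assms(1), of R 0] assms(2)
  by (auto simp: percolation_stage_def cell_def)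

text \<open>Compactness enters twice: an open cover of the intersection already covers some stage,
  since otherwise the stages minus the open union would have a common point; and that stage needs
  only finitely many of the sets. This is the passage from the limit set to a finite level of the
  tree.\<close>

lemma percolation_set_open_cover:
  fixes V :: "nat \<Rightarrow> (real ^ 2) set"
  assumes M: "M \<ge> 1" and V: "\<And>i. open (V i)" and cov: "percolation_set M R \<subseteq> (\<Union>i. V i)"
  obtains I N where "finite I" "\<And>n. n \<ge> N \<Longrightarrow> percolation_stage M R n \<subseteq> (\<Union>i\<in>I. V i)"
proof -
  define W where "W = (\<Union>i. V i)"
  have W: "open W" unfolding W_def using V by auto
  have "\<exists>N. percolation_stage M R N - W = {}"
  proof (rule ccontr)
    assume ne: "\<nexists>N. percolation_stage M R N - W = {}"
    have "(\<Inter>n. percolation_stage M R n - W) \<noteq> {}"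
    proof (rule compact_nest)
      show "compact (percolation_stage M R n - W)" for n
        by (intro compact_diff compact_percolation_stage M W)
      show "percolation_stage M R n - W \<noteq> {}" for n using ne by blast
      show "m \<le> n \<Longrightarrow> percolation_stage M R n - W \<subseteq> percolation_stage M R m - W" for m n
        using percolation_stage_antimono[OF M] by blast
    qed
    then show False using cov by (auto simp: percolation_set_def W_def)
  qed
  then obtain N where N: "percolation_stage M R N \<subseteq> (\<Union>i. V i)" by (auto simp: W_def)
  obtain I where I: "finite I" "percolation_stage M R N \<subseteq> (\<Union>i\<in>I. V i)"
    using compactE_image[OF compact_percolation_stage[OF M], of UNIV V] V N by metis
  show thesis using that[OF I(1), of N] I(2) percolation_stage_antimono[OF M] by blast
qed

section \<open>Projection onto a line in coordinates\<close>

lemma orth_proj_line: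
  fixes L :: "'a::euclidean_space set"
  assumes "affine L" "aff_dim L = 1"
  obtains z u where "norm u = 1" "\<And>x. orth_proj L x = z + ((x - z) \<bullet> u) *\<^sub>R u"
proof -
  have "L \<noteq> {}" using assms(2) by auto
  then obtain z where z: "z \<in> L" by blast
  define S where "S = (\<lambda>x. - z + x) ` L"
  have S: "subspace S" unfolding S_def using affine_diffs_subspace[OF assms(1) z] by simp
  have "int (dim S) = aff_dim S" using aff_dim_subspace[OF S] by simp
  then have "dim S = 1" using assms(2) unfolding S_def aff_dim_translation_eq by simp
  then obtain B where B: "B \<subseteq> S" "pairwise orthogonal B" "\<And>x. x \<in> B \<Longrightarrow> norm x = 1"
      "independent B" "card B = 1" "span B = S"
    using orthonormal_basis_subspace[OF S] by metis
  then obtain u where "B = {u}" by (metis card_1_singletonE)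
  then have u: "norm u = 1" "S = range (\<lambda>t. t *\<^sub>R u)" using B by (auto simp: span_singleton)
  have L: "L = range (\<lambda>t. z + t *\<^sub>R u)"
  proof -
    have "L = (\<lambda>x. z + x) ` S" unfolding S_def by (simp add: image_image)
    then show ?thesis unfolding u(2) by (simp add: image_image)
  qed
  have uu: "u \<bullet> u = 1" using u(1) by (simp add: norm_eq_1)
  have "orth_proj L x = z + ((x - z) \<bullet> u) *\<^sub>R u" for x
    unfolding orth_proj_def
  proof (rule the_equality)
    show "z + ((x - z) \<bullet> u) *\<^sub>R u \<in> L \<and> (\<forall>za\<in>L. (x - (z + ((x - z) \<bullet> u) *\<^sub>R u)) \<bullet> (za - (z + ((x - z) \<bullet> u) *\<^sub>R u)) = 0)"
    proof (intro conjI ballI)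
      show "z + ((x - z) \<bullet> u) *\<^sub>R u \<in> L" unfolding L by blast
      fix w assume "w \<in> L"
      then obtain t where "w = z + t *\<^sub>R u" unfolding L by auto
      then show "(x - (z + ((x - z) \<bullet> u) *\<^sub>R u)) \<bullet> (w - (z + ((x - z) \<bullet> u) *\<^sub>R u)) = 0"
        by (simp add: uu algebra_simps inner_diff_left inner_diff_right inner_add_left inner_add_right)
    qed
  next
    fix y assume y: "y \<in> L \<and> (\<forall>za\<in>L. (x - y) \<bullet> (za - y) = 0)"
    then obtain t where t: "y = z + t *\<^sub>R u" unfolding L by auto
    \<comment> \<open>Testing orthogonality against the point \<open>y + u\<close> of the line
      isolates the direction \<open>u\<close>.\<close>
    have "y + u \<in> L" unfolding L t by (auto intro!: image_eqI[of _ _ "t + 1"] simp: algebra_simps)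
    then have "(x - y) \<bullet> u = 0" using y by (metis add_diff_cancel_left')
    then have "t = (x - z) \<bullet> u" by (simp add: t inner_diff_left inner_add_left uu)
    then show "y = z + ((x - z) \<bullet> u) *\<^sub>R u" using t by simp
  qed
  then show thesis using that u(1) by blast
qed

section \<open>Retained cells in strips\<close>

lemma finite_lineage [simp]: "finite (lineage M n Q)"
  by (simp add: lineage_def)

lemma card_lineage: "card (lineage M n Q) = n"
  unfolding lineage_def by (subst card_image) (auto simp: inj_on_def)

lemma lineage_subset:
  "Q \<in> cell_indices M n \<Longrightarrow> lineage M n Q \<subseteq> (SIGMA m:{1..}. cell_indices M m)"
  by (auto simp: lineage_def intro: ancestor_in_cell_indices)

text \<open>A cell whose deepest ancestor in \<open>V\<close> has level \<open>m\<close> needs at least \<open>n - m\<close> further decisions, and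
  only \<open>K * M ^ (n - m)\<close> cells of a thin set lie below a given ancestor of level \<open>m\<close>.\<close>

lemma thin_lineage_sum_le:
  assumes p: "0 \<le> p" "p \<le> 1" and S: "thin K M n S" and V: "finite V"
  shows "(\<Sum>Q\<in>S. p ^ card (lineage M n Q - V)) \<le> (real (card V) + 1) * (real K * max 1 (real M * p) ^ n)"
proof -
  have fin: "finite S" using S finite_subset unfolding thin_def by (metis finite_cell_indices)
  \<comment> \<open>The root is added so that every lineage has a deepest ancestor in
    \<open>W\<close>.\<close>
  define W where "W = {v \<in> insert (0, (0, 0)) V. fst v \<le> n}"
  \<comment> \<open>The bound that holds if \<open>v\<close> is the deepest ancestor of
    \<open>Q\<close> in \<open>W\<close>. Summing over all of \<open>W\<close> avoids having to know
    which vertex that is.\<close>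
  define h where "h Q v = (if ancestor M n (fst v) Q = snd v then p ^ (n - fst v) else 0)" for Q v
  have W: "finite W" "card W \<le> card V + 1"
  proof -
    have "W \<subseteq> insert (0, (0, 0)) V" by (auto simp: W_def)
    then show "finite W" "card W \<le> card V + 1"
      using V card_mono[of "insert (0, (0, 0)) V" W] card_insert_le_m1[of "card V + 1" V "(0, (0, 0))"]
      by (auto intro: finite_subset)
  qed
  have h0: "h Q v \<ge> 0" for Q v using p by (simp add: h_def)
  have "p ^ card (lineage M n Q - V) \<le> (\<Sum>v\<in>W. h Q v)" if Q: "Q \<in> S" for Q
  proof -
    define T where "T = {m. m \<le> n \<and> (m, ancestor M n m Q) \<in> W}"
    have anc0: "ancestor M n 0 Q = (0, 0)" using Q S by (auto simp: thin_def intro: ancestor_0)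
    have T: "finite T" "0 \<in> T" using anc0 by (auto simp: T_def W_def)
    define m where "m = Max T"
    have m: "m \<in> T" "\<And>k. k \<in> T \<Longrightarrow> k \<le> m" 
    proof -
      have "T \<noteq> {}" using T(2) by blast
      then show "m \<in> T" unfolding m_def by (rule Max_in[OF T(1)])
    qed (use T in \<open>auto simp: m_def\<close>)
    have "(\<lambda>k. (k, ancestor M n k Q)) ` {m<..n} \<subseteq> lineage M n Q - V"
      using m(2) by (fastforce simp: lineage_def T_def W_def)
    then have "card ((\<lambda>k. (k, ancestor M n k Q)) ` {m<..n}) \<le> card (lineage M n Q - V)"
      by (intro card_mono) auto
    moreover have "card ((\<lambda>k. (k, ancestor M n k Q)) ` {m<..n}) = n - m"
      by (subst card_image) (auto simp: inj_on_def)
    ultimately have "p ^ card (lineage M n Q - V) \<le> p ^ (n - m)"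
      using p by (intro power_decreasing) auto
    also have "\<dots> = h Q (m, ancestor M n m Q)" by (simp add: h_def)
    also have "\<dots> \<le> (\<Sum>v\<in>W. h Q v)"
      using m(1) W(1) h0 by (intro member_le_sum) (auto simp: T_def)
    finally show ?thesis .
  qed
  then have "(\<Sum>Q\<in>S. p ^ card (lineage M n Q - V)) \<le> (\<Sum>Q\<in>S. \<Sum>v\<in>W. h Q v)"
    by (rule sum_mono)
  also have "\<dots> = (\<Sum>v\<in>W. \<Sum>Q\<in>S. h Q v)" by (rule sum.swap)
  also have "\<dots> \<le> (\<Sum>v\<in>W. real K * max 1 (real M * p) ^ n)"
  proof (rule sum_mono)
    fix v assume v: "v \<in> W"
    define m where "m = fst v"
    have m: "m \<le> n" using v by (simp add: W_def m_def)
    have "(\<Sum>Q\<in>S. h Q v) = real (card {Q \<in> S. ancestor M n m Q = snd v}) * p ^ (n - m)"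
      unfolding h_def m_def[symmetric] using fin by (simp add: sum.If_cases Int_def)
    also have "\<dots> \<le> real (K * M ^ (n - m)) * p ^ (n - m)"
    proof (intro mult_right_mono)
      have "card {Q \<in> S. ancestor M n m Q = snd v} \<le> K * M ^ (n - m)"
        using S m unfolding thin_def by blast
      then show "real (card {Q \<in> S. ancestor M n m Q = snd v}) \<le> real (K * M ^ (n - m))"
        by (rule of_nat_mono)
    qed (use p in simp)
    also have "\<dots> = real K * (real M * p) ^ (n - m)" by (simp add: power_mult_distrib)
    \<comment> \<open>For \<open>M * p < 1\<close> the worst ancestors are the deepest ones, for
      \<open>M * p > 1\<close> it is the root; the maximum covers both.\<close>
    also have "\<dots> \<le> real K * max 1 (real M * p) ^ (n - m)"
      using p by (intro mult_left_mono power_mono) auto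
    also have "\<dots> \<le> real K * max 1 (real M * p) ^ n"
      by (intro mult_left_mono power_increasing) auto
    finally show "(\<Sum>Q\<in>S. h Q v) \<le> real K * max 1 (real M * p) ^ n" .
  qed
  also have "\<dots> = real (card W) * (real K * max 1 (real M * p) ^ n)" by simp
  also have "\<dots> \<le> (real (card V) + 1) * (real K * max 1 (real M * p) ^ n)"
    using W(2) by (intro mult_right_mono) auto
  finally show ?thesis .
qed

section \<open>Moments and tails of the number of surviving cells\<close>

context fractal_percolation
begin

abbreviation decisions :: "(nat \<times> nat \<times> nat) set" where
  "decisions \<equiv> SIGMA n:{1..}. cell_indices M n"

lemma pred_decision:
  assumes "(n, c) \<in> decisions"
  shows "{\<omega> \<in> space \<Omega>. X n c \<omega>} \<in> events"
proof -
  have "X n c \<in> measurable \<Omega> (count_space UNIV)"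
    using indep_decisions assms unfolding indep_vars_def by fastforce
  then show ?thesis by (rule predE)
qed

lemma decisions_event:
  assumes "finite V" "V \<subseteq> decisions"
  shows "{\<omega> \<in> space \<Omega>. \<forall>(n, c)\<in>V. X n c \<omega>} \<in> events"
proof -
  have "{\<omega> \<in> space \<Omega>. \<forall>v\<in>V. X (fst v) (snd v) \<omega>} \<in> events"
    using assms pred_decision by (intro sets.sets_Collect_finite_All) force+
  then show ?thesis by (simp add: case_prod_beta)
qed

lemma prob_decisions:
  assumes V: "finite V" "V \<subseteq> decisions"
  shows "prob {\<omega> \<in> space \<Omega>. \<forall>(n, c)\<in>V. X n c \<omega>} = p ^ card V"
proof (cases "V = {}")
  case True
  then show ?thesis by (simp add: prob_space)
next
  case False
  have "prob (\<Inter>v\<in>V. (case v of (n, c) \<Rightarrow> X n c) -` {True} \<inter> space \<Omega>)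
      = (\<Prod>v\<in>V. prob ((case v of (n, c) \<Rightarrow> X n c) -` {True} \<inter> space \<Omega>))"
    by (rule indep_varsD_finite[OF indep_vars_subset[OF indep_decisions V(2)]])
       (use False V in auto)
  also have "(\<Inter>v\<in>V. (case v of (n, c) \<Rightarrow> X n c) -` {True} \<inter> space \<Omega>)
      = {\<omega> \<in> space \<Omega>. \<forall>(n, c)\<in>V. X n c \<omega>}"
    using False by auto
  also have "(\<Prod>v\<in>V. prob ((case v of (n, c) \<Rightarrow> X n c) -` {True} \<inter> space \<Omega>)) = (\<Prod>v\<in>V. p)"
  proof (rule prod.cong)
    fix v assume v: "v \<in> V"
    obtain n c where nc: "v = (n, c)" by (cases v)
    have "prob {\<omega> \<in> space \<Omega>. X n c \<omega>} = p" using v V nc by (intro prob_decision) auto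
    moreover have "{\<omega> \<in> space \<Omega>. X n c \<omega>} = X n c -` {True} \<inter> space \<Omega>" by auto
    ultimately show "prob ((case v of (n, c) \<Rightarrow> X n c) -` {True} \<inter> space \<Omega>) = p" by (simp add: nc)
  qed simp
  finally show ?thesis by simp
qed

text \<open>Numerical indicator, so that a union of decision sets becomes a product even when the
  sets overlap.\<close>

definition all_kept :: "(nat \<times> nat \<times> nat) set \<Rightarrow> 'w \<Rightarrow> real" where
  "all_kept V \<omega> = of_bool (\<forall>(n, c)\<in>V. X n c \<omega>)"

lemma all_kept_Un: "all_kept (V \<union> W) \<omega> = all_kept V \<omega> * all_kept W \<omega>"
  by (auto simp: all_kept_def)

lemma all_kept_measurable [measurable]:
  assumes "finite V" "V \<subseteq> decisions"
  shows "all_kept V \<in> borel_measurable \<Omega>"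
proof -
  have "Measurable.pred \<Omega> (\<lambda>\<omega>. \<forall>(n, c)\<in>V. X n c \<omega>)"
    using decisions_event[OF assms] by (simp add: pred_def)
  then show ?thesis unfolding all_kept_def[abs_def] by measurable
qed

lemma expectation_all_kept:
  assumes "finite V" "V \<subseteq> decisions"
  shows "expectation (all_kept V) = p ^ card V"
proof -
  have "expectation (all_kept V) = expectation (indicator {\<omega> \<in> space \<Omega>. \<forall>(n, c)\<in>V. X n c \<omega>})"
    by (intro Bochner_Integration.integral_cong) (auto simp: all_kept_def indicator_def)
  then show ?thesis using decisions_event[OF assms] prob_decisions[OF assms] by simp
qed

definition kept_count :: "nat \<Rightarrow> (nat \<times> nat) set \<Rightarrow> 'w \<Rightarrow> real" where
  "kept_count n S \<omega> = real (card (S \<inter> retained M (\<lambda>m c. X m c \<omega>) n))"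

lemma kept_count_eq:
  assumes "S \<subseteq> cell_indices M n"
  shows "kept_count n S \<omega> = (\<Sum>Q\<in>S. all_kept (lineage M n Q) \<omega>)"
proof -
  have fin: "finite S" using assms finite_subset finite_cell_indices by blast
  have "S \<inter> retained M (\<lambda>m c. X m c \<omega>) n = {Q \<in> S. \<forall>(m, c)\<in>lineage M n Q. X m c \<omega>}"
    using assms by (auto simp: retained_iff)
  then show ?thesis
    using fin by (simp add: kept_count_def all_kept_def of_bool_def sum.If_cases Int_def)
qed

lemma kept_count_measurable:
  assumes "S \<subseteq> cell_indices M n"
  shows "kept_count n S \<in> borel_measurable \<Omega>"
proof -
  have "(\<lambda>\<omega>. \<Sum>Q\<in>S. all_kept (lineage M n Q) \<omega>) \<in> borel_measurable \<Omega>"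
    by (intro borel_measurable_sum all_kept_measurable finite_lineage)
       (use assms lineage_subset in blast)
  then show ?thesis using kept_count_eq[OF assms] by presburger
qed

lemma kept_count_bounds: "0 \<le> kept_count n S \<omega>" "kept_count n S \<omega> \<le> real (card (cell_indices M n))"
  using card_mono[of "cell_indices M n" "S \<inter> retained M (\<lambda>m c. X m c \<omega>) n"] retained_subset
  by (force simp: kept_count_def)+

text \<open>The factor \<open>all_kept V\<close> makes the induction on the exponent \<open>k\<close> possible: expanding one factor
  of the power adds a lineage to \<open>V\<close>.\<close>

lemma kept_count_moment_aux:
  assumes p: "0 \<le> p" "p \<le> 1" and S: "thin K M n S" and V: "finite V" "V \<subseteq> decisions"
  shows "expectation (\<lambda>\<omega>. all_kept V \<omega> * kept_count n S \<omega> ^ k)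
    \<le> p ^ card V * (\<Prod>j<k. (real (card V) + real (j * n) + 1) * (real K * max 1 (real M * p) ^ n))"
  using V
proof (induction k arbitrary: V)
  case 0
  then show ?case by (simp add: expectation_all_kept)
next
  case (Suc k)
  define B where "B = real K * max 1 (real M * p) ^ n"
  have B: "B \<ge> 0" by (simp add: B_def)
  have sub: "S \<subseteq> cell_indices M n" using S by (simp add: thin_def)
  have Vl: "finite (V \<union> lineage M n Q)" "V \<union> lineage M n Q \<subseteq> decisions" if "Q \<in> S" for Q
    using Suc.prems lineage_subset[OF subsetD[OF sub that]] by auto
  have int: "integrable \<Omega> (\<lambda>\<omega>. all_kept W \<omega> * kept_count n S \<omega> ^ k)" if W: "finite W" "W \<subseteq> decisions" for W
  proof (rule integrable_const_bound[where B = "real (card (cell_indices M n)) ^ k"])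
    show "(\<lambda>\<omega>. all_kept W \<omega> * kept_count n S \<omega> ^ k) \<in> borel_measurable \<Omega>"
      using all_kept_measurable[OF W] kept_count_measurable[OF sub] by measurable
    have "kept_count n S \<omega> ^ k \<le> real (card (cell_indices M n)) ^ k" for \<omega>
      by (intro power_mono kept_count_bounds)
    then show "AE \<omega> in \<Omega>. norm (all_kept W \<omega> * kept_count n S \<omega> ^ k) \<le> real (card (cell_indices M n)) ^ k"
      using kept_count_bounds(1) by (auto simp: all_kept_def abs_mult)
  qed
  have "expectation (\<lambda>\<omega>. all_kept V \<omega> * kept_count n S \<omega> ^ Suc k)
      = expectation (\<lambda>\<omega>. \<Sum>Q\<in>S. all_kept (V \<union> lineage M n Q) \<omega> * kept_count n S \<omega> ^ k)"
  proof (intro Bochner_Integration.integral_cong refl)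
    fix \<omega>
    have "all_kept V \<omega> * kept_count n S \<omega> ^ Suc k
      = all_kept V \<omega> * ((\<Sum>Q\<in>S. all_kept (lineage M n Q) \<omega>) * kept_count n S \<omega> ^ k)"
      by (simp add: kept_count_eq[OF sub])
    then show "all_kept V \<omega> * kept_count n S \<omega> ^ Suc k
      = (\<Sum>Q\<in>S. all_kept (V \<union> lineage M n Q) \<omega> * kept_count n S \<omega> ^ k)"
      by (simp add: all_kept_Un sum_distrib_left sum_distrib_right mult.assoc)
  qed
  also have "\<dots> = (\<Sum>Q\<in>S. expectation (\<lambda>\<omega>. all_kept (V \<union> lineage M n Q) \<omega> * kept_count n S \<omega> ^ k))"
    by (intro Bochner_Integration.integral_sum int Vl)
  also have "\<dots> \<le> (\<Sum>Q\<in>S. p ^ card V * p ^ card (lineage M n Q - V) *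
      (\<Prod>j<k. (real (card V) + real (Suc j * n) + 1) * B))"
  proof (rule sum_mono)
    fix Q assume Q: "Q \<in> S"
    have card: "card (V \<union> lineage M n Q) = card V + card (lineage M n Q - V)"
      using Suc.prems(1) card_Un_disjoint[of V "lineage M n Q - V"] by simp
    have "card (lineage M n Q - V) \<le> n"
      using card_mono[of "lineage M n Q" "lineage M n Q - V"] by (simp add: card_lineage)
    then have le: "real (card (V \<union> lineage M n Q)) \<le> real (card V) + real n" using card by simp
    have "expectation (\<lambda>\<omega>. all_kept (V \<union> lineage M n Q) \<omega> * kept_count n S \<omega> ^ k)
      \<le> p ^ card (V \<union> lineage M n Q) * (\<Prod>j<k. (real (card (V \<union> lineage M n Q)) + real (j * n) + 1) * B)"
      using Suc.IH[OF Vl[OF Q]] by (simp add: B_def)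
    also have "\<dots> \<le> p ^ card (V \<union> lineage M n Q) * (\<Prod>j<k. (real (card V) + real (Suc j * n) + 1) * B)"
      using le p B by (intro mult_left_mono prod_mono) (auto intro!: mult_right_mono mult_nonneg_nonneg)
    finally show "expectation (\<lambda>\<omega>. all_kept (V \<union> lineage M n Q) \<omega> * kept_count n S \<omega> ^ k)
      \<le> p ^ card V * p ^ card (lineage M n Q - V) * (\<Prod>j<k. (real (card V) + real (Suc j * n) + 1) * B)"
      by (simp add: card power_add)
  qed
  also have "\<dots> = p ^ card V * (\<Sum>Q\<in>S. p ^ card (lineage M n Q - V)) *
      (\<Prod>j<k. (real (card V) + real (Suc j * n) + 1) * B)"
    by (simp add: sum_distrib_left sum_distrib_right mult.assoc)
  also have "\<dots> \<le> p ^ card V * ((real (card V) + 1) * B) * (\<Prod>j<k. (real (card V) + real (Suc j * n) + 1) * B)"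
    using thin_lineage_sum_le[OF p S Suc.prems(1)] p B unfolding B_def[symmetric]
    by (intro mult_right_mono mult_left_mono prod_nonneg) (auto intro!: mult_nonneg_nonneg)
  \<comment> \<open>The new factor is the one for \<open>j = 0\<close>; the older ones have moved up
    by one index because the added lineage contributes at most \<open>n\<close> decisions to
    \<open>V\<close>.\<close>
  also have "\<dots> = p ^ card V * (\<Prod>j<Suc k. (real (card V) + real (j * n) + 1) * B)"
    by (subst prod.lessThan_Suc_shift) simp
  finally show ?case by (simp add: B_def)
qed

lemma kept_count_moment:
  assumes p: "0 \<le> p" "p \<le> 1" and S: "thin K M n S"
  shows "expectation (\<lambda>\<omega>. kept_count n S \<omega> ^ k)
    \<le> (real (k * n + 1) * (real K * max 1 (real M * p) ^ n)) ^ k"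
proof -
  define B where "B = real K * max 1 (real M * p) ^ n"
  have B: "B \<ge> 0" by (simp add: B_def)
  have "expectation (\<lambda>\<omega>. kept_count n S \<omega> ^ k) \<le> (\<Prod>j<k. (real (j * n) + 1) * B)"
    using kept_count_moment_aux[OF p S, of "{}" k] by (simp add: all_kept_def B_def)
  also have "\<dots> \<le> (\<Prod>j<k. real (k * n + 1) * B)"
    using B by (intro prod_mono) (auto intro!: mult_right_mono mult_nonneg_nonneg)
  finally show ?thesis by (simp add: B_def)
qed

text \<open>Markov's inequality for the \<open>k\<close>-th power. The order \<open>k\<close> stays
  free, to be played off against the number of strips.\<close>

lemma kept_count_tail:
  assumes p: "0 \<le> p" "p \<le> 1" and S: "thin K M n S" and l: "l > 0"
  shows "prob {\<omega> \<in> space \<Omega>. kept_count n S \<omega> \<ge> l * max 1 (real M * p) ^ n} \<le> (real (k * n + 1) * real K / l) ^ k"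
proof -
  define B where "B = max 1 (real M * p) ^ n"
  have B: "B > 0" by (simp add: B_def less_max_iff_disj)
  have sub: "S \<subseteq> cell_indices M n" using S by (simp add: thin_def)
  note [measurable] = kept_count_measurable[OF sub]
  have int: "integrable \<Omega> (\<lambda>\<omega>. kept_count n S \<omega> ^ k)"
  proof (rule integrable_const_bound[where B = "real (card (cell_indices M n)) ^ k"])
    show "AE \<omega> in \<Omega>. norm (kept_count n S \<omega> ^ k) \<le> real (card (cell_indices M n)) ^ k"
      using kept_count_bounds by (auto simp: power_abs intro!: power_mono)
  qed measurable
  have "prob {\<omega> \<in> space \<Omega>. kept_count n S \<omega> \<ge> l * B} \<le> prob {\<omega> \<in> space \<Omega>. kept_count n S \<omega> ^ k \<ge> (l * B) ^ k}"
    using l B by (intro finite_measure_mono) (auto intro!: power_mono)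
  also have "\<dots> \<le> expectation (\<lambda>\<omega>. kept_count n S \<omega> ^ k) / (l * B) ^ k"
    using l B kept_count_bounds(1) int by (intro integral_Markov_inequality_measure[where A = "space \<Omega>"]) auto
  also have "\<dots> \<le> (real (k * n + 1) * (real K * B)) ^ k / (l * B) ^ k"
    using kept_count_moment[OF p S, of k] l B by (intro divide_right_mono) (auto simp: B_def)
  also have "\<dots> = (real (k * n + 1) * real K / l) ^ k"
    using B l by (simp add: power_divide[symmetric])
  finally show ?thesis by (simp add: B_def)
qed

lemma AE_strip_counts:
  assumes M: "M \<ge> 2" and p: "0 \<le> p" "p \<le> 1" and \<epsilon>: "\<epsilon> > 0"
  shows "AE \<omega> in \<Omega>. \<forall>\<^sub>F n in sequentially. \<forall>v\<in>line_params M n.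
    kept_count n (strip_cells M n v) \<omega> \<le> (real M powr \<epsilon>) ^ n * max 1 (real M * p) ^ n"
proof -
  \<comment> \<open>This order makes \<open>l n ^ k\<close> at least \<open>(M ^ n) ^ 4\<close>,
    which outweighs the \<open>45 * (M ^ n) ^ 3\<close> triples of the union bound and leaves a
    factor \<open>(1 / M) ^ n\<close> for summability.\<close>
  obtain k :: nat where k: "4 / \<epsilon> \<le> real k" using real_arch_simple by blast
  then have k\<epsilon>: "4 \<le> \<epsilon> * real k" using \<epsilon> by (simp add: field_simps)
  define l where "l n = (real M powr \<epsilon>) ^ n" for n
  have l: "l n > 0" for n using M by (simp add: l_def)
  define Bad where "Bad n = (\<Union>v\<in>line_params M n. {\<omega> \<in> space \<Omega>.
      kept_count n (strip_cells M n v) \<omega> \<ge> l n * max 1 (real M * p) ^ n})" for n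
  have M1: "M \<ge> 1" using M by simp
  have lp: "finite (line_params M n)" "card (line_params M n) \<le> 45 * (M ^ n) ^ 3" for n
    using finite_line_params_card[OF M1] by auto
  have ev: "{\<omega> \<in> space \<Omega>. kept_count n (strip_cells M n v) \<omega> \<ge> l n * max 1 (real M * p) ^ n} \<in> events"
    if "v \<in> line_params M n" for n v
  proof -
    have "strip_cells M n v \<subseteq> cell_indices M n" using thin_strip_cells[OF M1 that] by (simp add: thin_def)
    note [measurable] = kept_count_measurable[OF this]
    show ?thesis by measurable
  qed
  have Bad_ev: "Bad n \<in> events" for n
    unfolding Bad_def using ev lp by (intro sets.finite_UN) auto
  have bound: "prob (Bad n) \<le> 45 * (real (k * n + 1) * 97) ^ k * (1/2) ^ n" for n
  proof -
    have "prob (Bad n) \<le> (\<Sum>v\<in>line_params M n. prob {\<omega> \<in> space \<Omega>.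
      kept_count n (strip_cells M n v) \<omega> \<ge> l n * max 1 (real M * p) ^ n})"
      unfolding Bad_def using ev lp by (intro finite_measure_subadditive_finite) auto
    also have "\<dots> \<le> (\<Sum>v\<in>line_params M n. (real (k * n + 1) * real 97 / l n) ^ k)"
      by (intro sum_mono kept_count_tail[OF p] thin_strip_cells[OF M1] l)
    also have "\<dots> \<le> real (45 * (M ^ n) ^ 3) * (real (k * n + 1) * 97 / l n) ^ k"
      using lp(2)[of n] l[of n] by (simp del: of_nat_mult of_nat_power add: mult_right_mono)
    also have "\<dots> = 45 * (real (k * n + 1) * 97) ^ k * ((real M ^ n) ^ 3 / l n ^ k)"
      by (simp add: power_divide)
    also have "\<dots> \<le> 45 * (real (k * n + 1) * 97) ^ k * (1/2) ^ n"
    proof (intro mult_left_mono)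
      have M0: "real M > 0" using M by simp
      have "l n ^ k = real M powr (\<epsilon> * real k * real n)"
        using M0 by (simp add: l_def powr_realpow[symmetric] powr_powr mult_ac)
      moreover have "real M powr (4 * real n) \<le> real M powr (\<epsilon> * real k * real n)"
        using M k\<epsilon> by (intro powr_mono mult_right_mono) auto
      moreover have "real M powr (4 * real n) = (real M ^ n) ^ 4"
        using M0 by (simp add: powr_realpow[symmetric] powr_powr mult_ac)
      ultimately have "(real M ^ n) ^ 3 / l n ^ k \<le> (real M ^ n) ^ 3 / (real M ^ n) ^ 4"
        using M0 by (intro divide_left_mono) auto
      also have "\<dots> = (1 / real M) ^ n" using M0 by (simp add: power_one_over field_simps eval_nat_numeral)
      also have "\<dots> \<le> (1/2) ^ n" using M by (intro power_mono) (auto simp: field_simps)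
      finally show "(real M ^ n) ^ 3 / l n ^ k \<le> (1/2) ^ n" .
    qed auto
    finally show ?thesis .
  qed
  have "(\<lambda>n. (real n + 1) ^ k * (1/2) ^ n) \<in> O(\<lambda>n. 1 / real n ^ 2)" by real_asymp
  then have "summable (\<lambda>n. (real n + 1) ^ k * (1/2) ^ n)"
    by (rule summable_comparison_test_bigo[rotated]) (simp add: inverse_power_summable inverse_eq_divide[symmetric])
  then have smb: "summable (\<lambda>n. 45 * (real (k + 1) * 97) ^ k * ((real n + 1) ^ k * (1/2) ^ n))"
    by (rule summable_mult)
  have "summable (\<lambda>n. prob (Bad n))"
  proof (rule summable_comparison_test'[OF smb, of 0])
    fix n :: nat
    have "prob (Bad n) \<le> 45 * (real (k * n + 1) * 97) ^ k * (1/2) ^ n" by (rule bound)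
    also have "\<dots> \<le> 45 * (real ((k + 1) * (n + 1)) * 97) ^ k * (1/2) ^ n"
      by (intro mult_right_mono mult_left_mono power_mono) (auto simp del: of_nat_add of_nat_mult)
    also have "\<dots> = 45 * (real (k + 1) * 97) ^ k * ((real n + 1) ^ k * (1/2) ^ n)"
      by (simp add: power_mult_distrib[symmetric] algebra_simps)
    finally show "norm (prob (Bad n)) \<le> 45 * (real (k + 1) * 97) ^ k * ((real n + 1) ^ k * (1/2) ^ n)"
      by simp
  qed
  then have "AE \<omega> in \<Omega>. \<forall>\<^sub>F n in sequentially. \<omega> \<in> space \<Omega> - Bad n"
    by (intro borel_cantelli_AE1 Bad_ev) (auto simp: emeasure_eq_measure)
  then show ?thesis
    by eventually_elim (auto simp: Bad_def l_def elim!: eventually_mono)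
qed

end

section \<open>Cutsets of the tree of retained cells\<close>

type_synonym decision_tree = "nat \<times> nat \<times> nat \<Rightarrow> bool"

definition tree_index :: "nat \<Rightarrow> (nat \<times> nat \<times> nat) set" where
  "tree_index M = (SIGMA n:UNIV. cell_indices M n)"

text \<open>Prepends \<open>a\<close> as the most significant base-\<open>M\<close> digit of both
  indices, whereas \<open>retained\<close> strips the least significant one. Peeling off the top
  level is what turns subtrees into copies of the whole tree.\<close>

definition child_pos :: "nat \<Rightarrow> nat \<times> nat \<Rightarrow> nat \<times> nat \<times> nat \<Rightarrow> nat \<times> nat \<times> nat" where
  "child_pos M a v = (Suc (fst v), fst a * M ^ fst v + fst (snd v), snd a * M ^ fst v + snd (snd v))"

text \<open>Restricted to \<open>tree_index M\<close> so that the value is a point of the product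
  space.\<close>

definition subtree :: "nat \<Rightarrow> nat \<times> nat \<Rightarrow> decision_tree \<Rightarrow> decision_tree" where
  "subtree M a R = (\<lambda>v\<in>tree_index M. R (child_pos M a v))"

definition tree_measure :: "nat \<Rightarrow> real \<Rightarrow> decision_tree measure" where
  "tree_measure M p = PiM (tree_index M) (\<lambda>_. measure_pmf (bernoulli_pmf p))"

text \<open>The coordinate \<open>(0, 0, 0)\<close> of a decision tree decides about the root, so that the retention of a child
  is the root decision of its subtree. \<open>min_cut \<theta> M n\<close> is the minimal cost of a set of
  vertices of level at most \<open>n\<close> separating the root from the surviving vertices of level \<open>n\<close>, where a vertex
  of level \<open>m\<close> costs \<open>\<theta> ^ m\<close>.\<close>

primrec min_cut :: "real \<Rightarrow> nat \<Rightarrow> nat \<Rightarrow> decision_tree \<Rightarrow> real" where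
  "min_cut \<theta> M 0 R = of_bool (R (0, 0, 0))"
| "min_cut \<theta> M (Suc n) R =
     of_bool (R (0, 0, 0)) * min 1 (\<theta> * (\<Sum>a\<in>cell_indices M 1. min_cut \<theta> M n (subtree M a R)))"

section \<open>Passing from a tree to the subtrees of its children\<close>

lemma child_index_bound: "a < M \<Longrightarrow> i < M ^ n \<Longrightarrow> a * M ^ n + i < M ^ Suc n" for a i M n :: nat
proof -
  assume "a < M" "i < M ^ n"
  then have "a * M ^ n + i < (a + 1) * M ^ n" by simp
  also have "\<dots> \<le> M * M ^ n" using \<open>a < M\<close> by (intro mult_right_mono) auto
  finally show ?thesis by simp
qed

lemma child_pos_in_tree_index:
  "a \<in> cell_indices M 1 \<Longrightarrow> v \<in> tree_index M \<Longrightarrow> child_pos M a v \<in> tree_index M"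
  using child_index_bound[of _ M] by (auto simp: child_pos_def tree_index_def cell_indices_def)

lemma child_pos_inj:
  assumes "v \<in> tree_index M" "w \<in> tree_index M" "child_pos M a v = child_pos M b w"
  shows "a = b \<and> v = w"
proof -
  obtain n i j where v: "v = (n, i, j)" by (cases v)
  obtain n' i' j' where w: "w = (n', i', j')" by (cases w)
  have n: "n' = n" using assms(3) by (simp add: v w child_pos_def)
  have lt: "i < M ^ n" "j < M ^ n" "i' < M ^ n" "j' < M ^ n"
    using assms(1,2) by (auto simp: v w n tree_index_def cell_indices_def)
  have key: "x = y \<and> k = l" if "x * L + k = y * L + l" "k < L" "l < L" for x y k l L :: nat
  proof -
    have "(x * L + k) div L = x" using that(2) by simp
    moreover have "(y * L + l) div L = y" using that(3) by simp
    ultimately have "x = y" using that(1) by metis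
    then show ?thesis using that(1) by simp
  qed
  have e: "fst a * M ^ n + i = fst b * M ^ n + i'" "snd a * M ^ n + j = snd b * M ^ n + j'"
    using assms(3) by (auto simp: v w n child_pos_def)
  show ?thesis using key[OF e(1) lt(1,3)] key[OF e(2) lt(2,4)] by (simp add: v w n prod_eq_iff)
qed

lemma inj_on_child_pos: "inj_on (child_pos M a) (tree_index M)"
proof (rule inj_onI)
  fix v w assume "v \<in> tree_index M" "w \<in> tree_index M" "child_pos M a v = child_pos M a w"
  then show "v = w" using child_pos_inj[of v M w a a] by simp
qed

lemma child_decompose:
  assumes "Q \<in> cell_indices M (Suc n)"
  obtains a P where "a \<in> cell_indices M 1" "P \<in> cell_indices M n" "child_pos M a (n, P) = (Suc n, Q)"
proof -
  obtain i j where Q: "Q = (i, j)" by (cases Q)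
  have ij: "i < M * M ^ n" "j < M * M ^ n" using assms by (auto simp: Q cell_indices_def)
  then have pos: "M ^ n > 0" using mult_not_zero by fastforce
  show thesis
    using that[of "(i div M ^ n, j div M ^ n)" "(i mod M ^ n, j mod M ^ n)"] ij pos
    by (auto simp: Q cell_indices_def child_pos_def less_mult_imp_div_less div_mult_mod_eq)
qed

lemma ancestor_child_pos:
  assumes "P \<in> cell_indices M n" "m \<le> n" "M \<ge> 1"
  shows "ancestor M (Suc n) (Suc m) (snd (child_pos M a (n, P))) = snd (child_pos M a (m, ancestor M n m P))"
proof -
  have "M ^ n = M ^ m * M ^ (n - m)" using assms(2) by (simp add: power_add[symmetric])
  then have "(x * M ^ n + i) div M ^ (n - m) = x * M ^ m + i div M ^ (n - m)" for x i
    using assms(3) by (simp add: mult.assoc[symmetric] div_mult_self3)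
  then show ?thesis by (simp add: ancestor_def child_pos_def)
qed

lemma root_in_tree_index [simp]: "(0, 0, 0) \<in> tree_index M"
  by (simp add: tree_index_def cell_indices_def)

text \<open>Reconciles two readings of the tree: the recursion of \<open>retained\<close> extends it
  at the leaves, that of \<open>min_cut\<close> unfolds it at the root. Level \<open>m\<close> of
  the subtree is level \<open>m + 1\<close> of the tree, so the decision about the child reappears
  as the root decision of its subtree.\<close>

lemma retained_child_pos:
  assumes M: "M \<ge> 1" and a: "a \<in> cell_indices M 1" and P: "P \<in> cell_indices M n"
  shows "snd (child_pos M a (n, P)) \<in> retained M (\<lambda>m c. R (m, c)) (Suc n) \<longleftrightarrow>
    subtree M a R (0, 0, 0) \<and> P \<in> retained M (\<lambda>m c. subtree M a R (m, c)) n"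
proof -
  have v: "(m, ancestor M n m P) \<in> tree_index M" if "m \<le> n" for m
    using ancestor_in_cell_indices[OF P that] by (simp add: tree_index_def)
  have sub: "subtree M a R (m, ancestor M n m P) \<longleftrightarrow>
      R (Suc m, ancestor M (Suc n) (Suc m) (snd (child_pos M a (n, P))))" if "m \<le> n" for m
    using v[OF that] ancestor_child_pos[OF P that M] by (simp add: subtree_def child_pos_def)
  have "(n, P) \<in> tree_index M" using P by (simp add: tree_index_def)
  then have "snd (child_pos M a (n, P)) \<in> cell_indices M (Suc n)"
    using child_pos_in_tree_index[OF a, of "(n, P)"] by (auto simp: tree_index_def child_pos_def)
  then have "snd (child_pos M a (n, P)) \<in> retained M (\<lambda>m c. R (m, c)) (Suc n) \<longleftrightarrow>
      (\<forall>m\<in>{1..Suc n}. R (m, ancestor M (Suc n) m (snd (child_pos M a (n, P)))))"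
    by (subst retained_iff) (auto simp: lineage_def)
  also have "\<dots> \<longleftrightarrow> (\<forall>m\<in>{0..n}. R (Suc m, ancestor M (Suc n) (Suc m) (snd (child_pos M a (n, P)))))"
  proof -
    have eq: "{1..Suc n} = Suc ` {0..n}" by (simp add: image_Suc_atLeastAtMost)
    show ?thesis unfolding eq by blast
  qed
  also have "\<dots> \<longleftrightarrow> (\<forall>m\<in>{0..n}. subtree M a R (m, ancestor M n m P))" using sub by simp
  also have "\<dots> \<longleftrightarrow> subtree M a R (0, ancestor M n 0 P) \<and> (\<forall>m\<in>{1..n}. subtree M a R (m, ancestor M n m P))"
  proof -
    have eq: "{0..n} = insert 0 {1..n}" by auto
    show ?thesis unfolding eq by blast
  qed
  also have "\<dots> \<longleftrightarrow> subtree M a R (0, 0, 0) \<and> P \<in> retained M (\<lambda>m c. subtree M a R (m, c)) n"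
    using P by (auto simp: retained_iff lineage_def ancestor_0)
  finally show ?thesis .
qed

section \<open>Monotonicity of the cut cost and its relation to cutsets\<close>

lemma min_cut_bounds: "\<theta> \<ge> 0 \<Longrightarrow> 0 \<le> min_cut \<theta> M n R" "min_cut \<theta> M n R \<le> 1"
proof -
  show "0 \<le> min_cut \<theta> M n R" if "\<theta> \<ge> 0"
    using that by (induction n arbitrary: R) (auto intro!: mult_nonneg_nonneg sum_nonneg)
  show "min_cut \<theta> M n R \<le> 1" by (cases n) auto
qed

lemma min_cut_Suc_le: "\<theta> \<ge> 0 \<Longrightarrow> min_cut \<theta> M (Suc n) R \<le> min_cut \<theta> M n R"
proof (induction n arbitrary: R)
  case (Suc n)
  have "(\<Sum>a\<in>cell_indices M 1. min_cut \<theta> M (Suc n) (subtree M a R))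
      \<le> (\<Sum>a\<in>cell_indices M 1. min_cut \<theta> M n (subtree M a R))"
    by (intro sum_mono Suc)
  then show ?case using \<open>\<theta> \<ge> 0\<close>
    unfolding min_cut.simps(2)[of \<theta> M "Suc n"] min_cut.simps(2)[of \<theta> M n]
    by (intro mult_left_mono min.mono) auto
qed auto

lemma min_cut_antimono: "\<theta> \<ge> 0 \<Longrightarrow> m \<le> n \<Longrightarrow> min_cut \<theta> M n R \<le> min_cut \<theta> M m R"
  by (rule lift_Suc_antimono_le[of "\<lambda>n. min_cut \<theta> M n R"]) (rule min_cut_Suc_le)

text \<open>A sum of nonnegative costs vanishes only if every summand does. The root is assumed
  retained because \<open>retained\<close> at level 0 is \<open>{(0, 0)}\<close> whatever the root
  decision.\<close>

lemma min_cut_eq_0_imp_extinct: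
  assumes M: "M \<ge> 1" and \<theta>: "\<theta> > 0"
  shows "min_cut \<theta> M n R = 0 \<Longrightarrow> R (0, 0, 0) \<Longrightarrow> retained M (\<lambda>m c. R (m, c)) n = {}"
proof (induction n arbitrary: R)
  case (Suc n)
  have "(\<Sum>a\<in>cell_indices M 1. min_cut \<theta> M n (subtree M a R)) = 0"
    using Suc.prems \<theta> by (auto simp: min_def split: if_splits)
  then have zero: "min_cut \<theta> M n (subtree M a R) = 0" if "a \<in> cell_indices M 1" for a
    using that min_cut_bounds(1)[of \<theta>] \<theta> by (subst (asm) sum_nonneg_eq_0_iff) auto
  show ?case
  proof (rule ccontr)
    assume "retained M (\<lambda>m c. R (m, c)) (Suc n) \<noteq> {}"
    then obtain Q where Q: "Q \<in> retained M (\<lambda>m c. R (m, c)) (Suc n)" by blast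
    then have "Q \<in> cell_indices M (Suc n)" using retained_subset by blast
    then obtain a P where aP: "a \<in> cell_indices M 1" "P \<in> cell_indices M n" "child_pos M a (n, P) = (Suc n, Q)"
      by (rule child_decompose)
    then have "subtree M a R (0, 0, 0) \<and> P \<in> retained M (\<lambda>m c. subtree M a R (m, c)) n"
      using Q retained_child_pos[OF M aP(1,2), of R] by simp
    then show False using Suc.IH[OF zero[OF aP(1)]] by simp
  qed
qed auto

text \<open>A cutset containing the root costs at least \<open>\<theta> ^ 0 = 1\<close>; any other
  one splits into cutsets of the subtrees, in which each vertex sits one level higher, and the
  factor \<open>\<theta>\<close> of the recursion restores its cost. \<open>\<C>\<close> may be any
  finite set of positions, so it can come from a geometric cover.\<close>

lemma min_cut_le_cutset:
  assumes M: "M \<ge> 1" and \<theta>: "\<theta> > 0"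
  shows "finite \<C> \<Longrightarrow>
    (\<And>Q. Q \<in> retained M (\<lambda>m c. R (m, c)) n \<Longrightarrow> \<exists>m\<le>n. (m, ancestor M n m Q) \<in> \<C>) \<Longrightarrow>
    min_cut \<theta> M n R \<le> (\<Sum>v\<in>\<C>. \<theta> ^ fst v)"
proof (induction n arbitrary: R \<C>)
  case 0
  have "(0, 0, 0) \<in> \<C>" using 0(2)[of "(0, 0)"] by simp
  then have "\<theta> ^ fst (0::nat, 0::nat, 0::nat) \<le> (\<Sum>v\<in>\<C>. \<theta> ^ fst v)"
    using 0(1) \<theta> by (intro member_le_sum) auto
  then show ?case using min_cut_bounds(2)[of \<theta> M 0 R] by simp
next
  case (Suc n)
  show ?case
  proof (cases "(0, 0, 0) \<in> \<C>")
    case True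
    then have "\<theta> ^ fst (0::nat, 0::nat, 0::nat) \<le> (\<Sum>v\<in>\<C>. \<theta> ^ fst v)"
      using Suc.prems(1) \<theta> by (intro member_le_sum) auto
    then show ?thesis using min_cut_bounds(2)[of \<theta> M "Suc n" R] by simp
  next
    case False
    define \<D> where "\<D> a = {v \<in> tree_index M. child_pos M a v \<in> \<C>}" for a
    have inj: "inj_on (child_pos M a) (\<D> a)" for a
      by (rule inj_on_subset[OF inj_on_child_pos]) (auto simp: \<D>_def)
    have fin: "finite (\<D> a)" for a
      using finite_imageD[OF finite_subset[OF _ Suc.prems(1)] inj[of a]] by (auto simp: \<D>_def)
    have le: "min_cut \<theta> M n (subtree M a R) \<le> (\<Sum>v\<in>\<D> a. \<theta> ^ fst v)" if a: "a \<in> cell_indices M 1" for a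
    proof (cases "subtree M a R (0, 0, 0)")
      case True
      show ?thesis
      proof (rule Suc.IH[OF fin])
        fix P assume P: "P \<in> retained M (\<lambda>m c. subtree M a R (m, c)) n"
        then have PC: "P \<in> cell_indices M n" using retained_subset by blast
        have "snd (child_pos M a (n, P)) \<in> retained M (\<lambda>m c. R (m, c)) (Suc n)"
          using retained_child_pos[OF M a PC, of R] P True by simp
        then obtain m where m: "m \<le> Suc n" "(m, ancestor M (Suc n) m (snd (child_pos M a (n, P)))) \<in> \<C>"
          and cell: "snd (child_pos M a (n, P)) \<in> cell_indices M (Suc n)"
          using Suc.prems(2) retained_subset by blast
        have "m \<noteq> 0"
        proof
          assume "m = 0"
          then show False using m(2) False ancestor_0[OF cell] by simp
        qed
        then obtain m' where m': "m = Suc m'" "m' \<le> n" using m(1) by (cases m) auto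
        have "child_pos M a (m', ancestor M n m' P) \<in> \<C>"
          using m(2) ancestor_child_pos[OF PC m'(2) M, of a] by (simp add: m' child_pos_def)
        then have "(m', ancestor M n m' P) \<in> \<D> a"
          using ancestor_in_cell_indices[OF PC m'(2)] by (simp add: \<D>_def tree_index_def)
        then show "\<exists>m\<le>n. (m, ancestor M n m P) \<in> \<D> a" using m'(2) by blast
      qed
    next
      \<comment> \<open>A discarded child costs 0 and has to be treated apart:
        \<open>retained\<close> ignores the root decision of its subtree and may still list
        descendants that \<open>\<C>\<close> does not cut off.\<close>
      case False
      then have "min_cut \<theta> M n (subtree M a R) = 0" by (cases n) auto
      then show ?thesis using \<theta> by (simp add: sum_nonneg)
    qed
    have "min_cut \<theta> M (Suc n) R \<le> \<theta> * (\<Sum>a\<in>cell_indices M 1. min_cut \<theta> M n (subtree M a R))"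
      using \<theta> min_cut_bounds(1)[of \<theta>] by (auto simp: sum_nonneg)
    also have "\<dots> \<le> \<theta> * (\<Sum>a\<in>cell_indices M 1. \<Sum>v\<in>\<D> a. \<theta> ^ fst v)"
      using \<theta> by (intro mult_left_mono sum_mono le) auto
    also have "\<dots> = (\<Sum>a\<in>cell_indices M 1. \<Sum>v\<in>\<D> a. \<theta> ^ fst (child_pos M a v))"
      by (simp add: sum_distrib_left child_pos_def)
    also have "\<dots> = (\<Sum>a\<in>cell_indices M 1. \<Sum>v\<in>child_pos M a ` \<D> a. \<theta> ^ fst v)"
      by (simp add: sum.reindex[OF inj])
    also have "\<dots> = (\<Sum>v\<in>(\<Union>a\<in>cell_indices M 1. child_pos M a ` \<D> a). \<theta> ^ fst v)"
    proof (rule sum.UNION_disjoint[symmetric])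
      show "\<forall>a\<in>cell_indices M 1. \<forall>b\<in>cell_indices M 1. a \<noteq> b \<longrightarrow>
          child_pos M a ` \<D> a \<inter> child_pos M b ` \<D> b = {}"
      proof (intro ballI impI, rule ccontr)
        fix a b assume "a \<noteq> b" "child_pos M a ` \<D> a \<inter> child_pos M b ` \<D> b \<noteq> {}"
        then obtain v w where "v \<in> \<D> a" "w \<in> \<D> b" "child_pos M a v = child_pos M b w" by blast
        then show False using child_pos_inj[of v M w a b] \<open>a \<noteq> b\<close> by (simp add: \<D>_def)
      qed
    qed (use fin in auto)
    also have "\<dots> \<le> (\<Sum>v\<in>\<C>. \<theta> ^ fst v)"
      using \<theta> by (intro sum_mono2 Suc.prems(1)) (auto simp: \<D>_def)
    finally show ?thesis .
  qed
qed

section \<open>The product space of decision trees\<close>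

lemma sets_tree_measure:
  "sets (tree_measure M p) = sets (PiM (tree_index M) (\<lambda>_. count_space UNIV))"
  unfolding tree_measure_def by (intro sets_PiM_cong) auto

lemma space_tree_measure: "space (tree_measure M p) = extensional (tree_index M)"
  by (simp add: tree_measure_def space_PiM PiE_def)

lemma measurable_into_tree_measure:
  "measurable N (tree_measure M p) = measurable N (PiM (tree_index M) (\<lambda>_. count_space UNIV))"
  by (intro measurable_cong_sets sets_tree_measure) simp

lemma prob_space_tree_measure: "prob_space (tree_measure M p)"
  unfolding tree_measure_def by (intro prob_space_PiM measure_pmf.prob_space_axioms)

section \<open>The law of the decision tree\<close>

text \<open>This carries almost sure statements from the canonical product space to a percolation on
  an arbitrary probability space.\<close>

lemma (in prob_space) distr_bernoulli_PiM:
  assumes p: "0 \<le> p" "p \<le> 1" and I: "I \<noteq> {}"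
    and ind: "indep_vars (\<lambda>_. count_space UNIV) Y I"
    and prob: "\<And>i. i \<in> I \<Longrightarrow> prob {\<omega> \<in> space M. Y i \<omega>} = p"
  shows "distr M (PiM I (\<lambda>_. measure_pmf (bernoulli_pmf p))) (\<lambda>\<omega>. \<lambda>i\<in>I. Y i \<omega>)
    = PiM I (\<lambda>_. measure_pmf (bernoulli_pmf p))"
proof -
  have rv: "Y i \<in> measurable M (count_space UNIV)" if "i \<in> I" for i
    using ind that by (simp add: indep_vars_def)
  have eq: "distr M (count_space UNIV) (Y i) = measure_pmf (bernoulli_pmf p)" if i: "i \<in> I" for i
  proof (rule measure_eqI_countable[of _ UNIV])
    fix b :: bool
    have "prob {\<omega> \<in> space M. \<not> Y i \<omega>} = 1 - p"
      using prob_neg[of "Y i"] prob[OF i] rv[OF i] by simp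
    then have "prob (Y i -` {b} \<inter> space M) = pmf (bernoulli_pmf p) b"
      using prob[OF i] p by (cases b) (auto simp: vimage_def Int_def conj_commute)
    then show "emeasure (distr M (count_space UNIV) (Y i)) {b} = emeasure (measure_pmf (bernoulli_pmf p)) {b}"
      using rv[OF i] by (simp add: emeasure_distr emeasure_eq_measure emeasure_pmf_single)
  qed auto
  have "distr M (PiM I (\<lambda>_. measure_pmf (bernoulli_pmf p))) (\<lambda>\<omega>. \<lambda>i\<in>I. Y i \<omega>)
      = distr M (PiM I (\<lambda>_. count_space UNIV)) (\<lambda>\<omega>. \<lambda>i\<in>I. Y i \<omega>)"
    by (intro distr_cong sets_PiM_cong) auto
  also have "\<dots> = PiM I (\<lambda>i. distr M (count_space UNIV) (Y i))"
    using indep_vars_iff_distr_eq_PiM'[OF I, where M' = "\<lambda>_. count_space UNIV" and X = Y] rv ind by blast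
  also have "\<dots> = PiM I (\<lambda>_. measure_pmf (bernoulli_pmf p))"
    by (intro PiM_cong refl eq)
  finally show ?thesis .
qed

text \<open>There are finitely many children and costs decrease in \<open>n\<close>, so the largest
  of the levels at which their costs vanish works for all of them.\<close>

lemma min_cut_extinct_inherited:
  assumes \<theta>: "\<theta> > 0"
  shows "(\<exists>n. min_cut \<theta> M n R = 0) \<longleftrightarrow>
    \<not> R (0, 0, 0) \<or> (\<forall>a\<in>cell_indices M 1. \<exists>n. min_cut \<theta> M n (subtree M a R) = 0)"
proof (cases "R (0, 0, 0)")
  case False
  then have "min_cut \<theta> M 0 R = 0" by simp
  then show ?thesis using False by blast
next
  case True
  have mono0: "min_cut \<theta> M n S = 0" if "min_cut \<theta> M m S = 0" "m \<le> n" for m n S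
    using min_cut_antimono[of \<theta> m n M S] min_cut_bounds(1)[of \<theta> M n S] that \<theta> by simp
  have iff: "min_cut \<theta> M (Suc n) R = 0 \<longleftrightarrow> (\<forall>a\<in>cell_indices M 1. min_cut \<theta> M n (subtree M a R) = 0)" for n
  proof -
    have "0 \<le> (\<Sum>a\<in>cell_indices M 1. min_cut \<theta> M n (subtree M a R))"
      using min_cut_bounds(1) \<theta> by (intro sum_nonneg) auto
    then have "min_cut \<theta> M (Suc n) R = 0 \<longleftrightarrow> (\<Sum>a\<in>cell_indices M 1. min_cut \<theta> M n (subtree M a R)) = 0"
      using True \<theta> by (auto simp: min_def)
    also have "\<dots> \<longleftrightarrow> (\<forall>a\<in>cell_indices M 1. min_cut \<theta> M n (subtree M a R) = 0)"
      using min_cut_bounds(1)[of \<theta>] \<theta> by (intro sum_nonneg_eq_0_iff) auto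
    finally show ?thesis .
  qed
  show ?thesis
  proof
    assume "\<exists>n. min_cut \<theta> M n R = 0"
    then obtain n where "min_cut \<theta> M (Suc n) R = 0" using mono0[of _ R] le_Suc_eq by blast
    then show "\<not> R (0, 0, 0) \<or> (\<forall>a\<in>cell_indices M 1. \<exists>n. min_cut \<theta> M n (subtree M a R) = 0)"
      using iff by blast
  next
    assume "\<not> R (0, 0, 0) \<or> (\<forall>a\<in>cell_indices M 1. \<exists>n. min_cut \<theta> M n (subtree M a R) = 0)"
    then obtain N where N: "\<And>a. a \<in> cell_indices M 1 \<Longrightarrow> min_cut \<theta> M (N a) (subtree M a R) = 0"
      using True by metis
    have "min_cut \<theta> M (Max (N ` cell_indices M 1)) (subtree M a R) = 0" if "a \<in> cell_indices M 1" for a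
      using that by (intro mono0[OF N[OF that]] Max_ge) auto
    then show "\<exists>n. min_cut \<theta> M n R = 0" using iff by blast
  qed
qed

text \<open>The cap at 1 in the recursion is inactive once the cost is below 1, so the limit is
  decided by the sum over the children, and a sum of nonnegative sequences tends to 0 exactly when
  every summand does.\<close>

lemma min_cut_null_inherited:
  assumes \<theta>: "\<theta> > 0"
  shows "(\<lambda>n. min_cut \<theta> M n R) \<longlonglongrightarrow> 0 \<longleftrightarrow>
    \<not> R (0, 0, 0) \<or> (\<forall>a\<in>cell_indices M 1. (\<lambda>n. min_cut \<theta> M n (subtree M a R)) \<longlonglongrightarrow> 0)"
proof (cases "R (0, 0, 0)")
  case False
  then have "min_cut \<theta> M n R = 0" for n by (cases n) auto
  then show ?thesis using False by simp
next
  case True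
  define s where "s n = (\<Sum>a\<in>cell_indices M 1. min_cut \<theta> M n (subtree M a R))" for n
  have Suc: "min_cut \<theta> M (Suc n) R = min 1 (\<theta> * s n)" for n using True by (simp add: s_def)
  have "(\<lambda>n. min_cut \<theta> M n R) \<longlonglongrightarrow> 0 \<longleftrightarrow> (\<lambda>n. min 1 (\<theta> * s n)) \<longlonglongrightarrow> 0"
    using filterlim_sequentially_Suc[of "\<lambda>n. min_cut \<theta> M n R" "nhds 0"] by (simp only: Suc)
  also have "\<dots> \<longleftrightarrow> (\<forall>a\<in>cell_indices M 1. (\<lambda>n. min_cut \<theta> M n (subtree M a R)) \<longlonglongrightarrow> 0)"
  proof
    assume lim: "(\<lambda>n. min 1 (\<theta> * s n)) \<longlonglongrightarrow> 0"
    then have "\<forall>\<^sub>F n in sequentially. min 1 (\<theta> * s n) < 1" by (rule order_tendstoD) simp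
    then have "\<forall>\<^sub>F n in sequentially. min 1 (\<theta> * s n) = \<theta> * s n"
      by eventually_elim (auto simp: min_def split: if_splits)
    then have "(\<lambda>n. \<theta> * s n) \<longlonglongrightarrow> 0" using lim by (simp add: filterlim_cong)
    then have s: "s \<longlonglongrightarrow> 0" using tendsto_mult_left_iff[of \<theta> s 0] \<theta> by simp
    show "\<forall>a\<in>cell_indices M 1. (\<lambda>n. min_cut \<theta> M n (subtree M a R)) \<longlonglongrightarrow> 0"
    proof
      fix a assume a: "a \<in> cell_indices M 1"
      have "min_cut \<theta> M n (subtree M a R) \<le> s n" for n
        unfolding s_def using a min_cut_bounds(1)[of \<theta>] \<theta> by (intro member_le_sum) auto
      then show "(\<lambda>n. min_cut \<theta> M n (subtree M a R)) \<longlonglongrightarrow> 0"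
        using min_cut_bounds(1)[of \<theta>] \<theta>
        by (intro tendsto_sandwich[OF _ _ tendsto_const s]) (auto intro: always_eventually)
    qed
  next
    assume "\<forall>a\<in>cell_indices M 1. (\<lambda>n. min_cut \<theta> M n (subtree M a R)) \<longlonglongrightarrow> 0"
    then have "s \<longlonglongrightarrow> (\<Sum>a\<in>cell_indices M 1. 0)"
      unfolding s_def[abs_def] by (intro tendsto_sum) auto
    then have "(\<lambda>n. min 1 (\<theta> * s n)) \<longlonglongrightarrow> min 1 (\<theta> * (\<Sum>a\<in>cell_indices M 1. 0))"
      by (intro tendsto_intros)
    then show "(\<lambda>n. min 1 (\<theta> * s n)) \<longlonglongrightarrow> 0" by simp
  qed
  finally show ?thesis using True by simp
qed

text \<open>Dividing \<open>1 - y = p * (1 - y ^ k)\<close> by \<open>1 - y\<close>, and the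
  difference of the two equations by \<open>y - x\<close>, gives two sums that both equal
  \<open>1 / p\<close>. For \<open>x < y\<close> the second is strictly smaller, since its term
  \<open>i = 0\<close> is \<open>x ^ (k - 1) < 1\<close>.\<close>

lemma branching_fixed_point_unique:
  fixes x y :: real
  assumes p: "p > 0" and xy01: "0 \<le> x" "x \<le> y" "y < 1" and k: "k \<ge> 2"
    and x: "x = 1 - p + p * x ^ k" and y: "y = 1 - p + p * y ^ k"
  shows "x = y"
proof (rule ccontr)
  assume "x \<noteq> y"
  then have xy: "x < y" using xy01 by simp
  have "1 - y = p * (1 - y ^ k)" using y unfolding right_diff_distrib by linarith
  also have "\<dots> = (1 - y) * (p * (\<Sum>i<k. y ^ i))" unfolding one_diff_power_eq by simp
  finally have "1 - y = (1 - y) * (p * (\<Sum>i<k. y ^ i))" .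
  then have 1: "p * (\<Sum>i<k. y ^ i) = 1" using \<open>y < 1\<close> by simp
  have "y - x = p * (y ^ k - x ^ k)" using x y unfolding right_diff_distrib by linarith
  also have "\<dots> = (y - x) * (p * (\<Sum>i<k. x ^ (k - Suc i) * y ^ i))"
    using power_diff_sumr2[of y k x] by (simp add: mult_ac)
  finally have 2: "p * (\<Sum>i<k. x ^ (k - Suc i) * y ^ i) = 1" using xy by simp
  have "(\<Sum>i<k. x ^ (k - Suc i) * y ^ i) < (\<Sum>i<k. y ^ i)"
  proof (rule sum_strict_mono_ex1)
    show "\<forall>i\<in>{..<k}. x ^ (k - Suc i) * y ^ i \<le> y ^ i"
      using xy01 by (auto intro!: mult_left_le_one_le power_le_one)
    show "\<exists>i\<in>{..<k}. x ^ (k - Suc i) * y ^ i < y ^ i"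
    proof (rule bexI[of _ 0])
      have "k - Suc 0 = Suc (k - 2)" using k by simp
      then show "x ^ (k - Suc 0) * y ^ 0 < y ^ 0"
        using power_Suc_less_one[of x "k - 2"] xy01(1,3) xy
        by (cases "x = 0") simp_all
    qed (use k in auto)
  qed auto
  then have "p * (\<Sum>i<k. x ^ (k - Suc i) * y ^ i) < p * (\<Sum>i<k. y ^ i)" using p by simp
  then show False using 1 2 by simp
qed

section \<open>Independence and law of the subtrees\<close>

context
  fixes M :: nat and p :: real
  assumes M: "M \<ge> 1" and p: "0 < p" "p \<le> 1"
begin

interpretation T: prob_space "tree_measure M p"
  by (rule prob_space_tree_measure)

lemma measurable_decision [measurable]:
  assumes "v \<in> tree_index M"
  shows "(\<lambda>R. R v) \<in> measurable (tree_measure M p) (count_space UNIV)"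
proof -
  have "(\<lambda>R. R v) \<in> measurable (tree_measure M p) (measure_pmf (bernoulli_pmf p))"
    unfolding tree_measure_def using assms by (rule measurable_component_singleton)
  then show ?thesis by (simp cong: measurable_cong_sets)
qed

lemma measurable_subtree [measurable]:
  assumes "a \<in> cell_indices M 1"
  shows "subtree M a \<in> measurable (tree_measure M p) (tree_measure M p)"
  unfolding measurable_into_tree_measure subtree_def[abs_def]
  by (intro measurable_restrict measurable_decision child_pos_in_tree_index assms)

text \<open>An injective selection of coordinates from a product of identical factors has again the
  product law.\<close>

lemma distr_subtree:
  assumes a: "a \<in> cell_indices M 1"
  shows "distr (tree_measure M p) (tree_measure M p) (subtree M a) = tree_measure M p"
  unfolding tree_measure_def subtree_def[abs_def]
  by (rule distr_PiM_reindex[of "tree_index M" "\<lambda>_. measure_pmf (bernoulli_pmf p)"])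
     (use child_pos_in_tree_index[OF a] inj_on_child_pos in \<open>auto intro: measure_pmf.prob_space_axioms\<close>)

lemma integral_subtree:
  fixes f :: "decision_tree \<Rightarrow> real"
  assumes "a \<in> cell_indices M 1" "f \<in> borel_measurable (tree_measure M p)"
  shows "T.expectation (\<lambda>R. f (subtree M a R)) = T.expectation f"
  using integral_distr[OF measurable_subtree[OF assms(1)] assms(2)] distr_subtree[OF assms(1)] by simp

lemma distr_decision:
  assumes "v \<in> tree_index M"
  shows "distr (tree_measure M p) (count_space UNIV) (\<lambda>R. R v) = measure_pmf (bernoulli_pmf p)"
proof -
  have "distr (tree_measure M p) (count_space UNIV) (\<lambda>R. R v)
      = distr (tree_measure M p) (measure_pmf (bernoulli_pmf p)) (\<lambda>R. R v)"
    by (intro distr_cong) auto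
  also have "\<dots> = measure_pmf (bernoulli_pmf p)"
    unfolding tree_measure_def by (rule distr_PiM_component[OF measure_pmf.prob_space_axioms assms])
  finally show ?thesis .
qed

lemma indep_decisions_tree:
  "T.indep_vars (\<lambda>_. count_space UNIV) (\<lambda>v R. R v) (tree_index M)"
proof (subst T.indep_vars_iff_distr_eq_PiM')
  show "tree_index M \<noteq> {}" using root_in_tree_index by blast
  have "distr (tree_measure M p) (PiM (tree_index M) (\<lambda>_. count_space UNIV)) (\<lambda>R. \<lambda>v\<in>tree_index M. R v)
      = distr (tree_measure M p) (tree_measure M p) (\<lambda>R. R)"
    by (intro distr_cong) (auto simp: sets_tree_measure space_tree_measure extensional_restrict)
  also have "\<dots> = tree_measure M p" by simp
  also have "\<dots> = PiM (tree_index M) (\<lambda>v. distr (tree_measure M p) (count_space UNIV) (\<lambda>R. R v))"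
    unfolding tree_measure_def[of M p] by (intro PiM_cong refl) (simp add: distr_decision[unfolded tree_measure_def])
  finally show "distr (tree_measure M p) (PiM (tree_index M) (\<lambda>_. count_space UNIV)) (\<lambda>R. \<lambda>v\<in>tree_index M. R v)
      = PiM (tree_index M) (\<lambda>v. distr (tree_measure M p) (count_space UNIV) (\<lambda>R. R v))" .
qed simp

text \<open>The root coordinate and the ranges of \<open>child_pos\<close> for different children
  are disjoint blocks of coordinates. \<open>None\<close> stands for the root and
  \<open>Some a\<close> for the child \<open>a\<close>, so that all of them form one independent
  family.\<close>

lemma indep_root_subtrees:
  fixes \<phi>\<^sub>0 :: "bool \<Rightarrow> real" and \<phi> :: "nat \<times> nat \<Rightarrow> decision_tree \<Rightarrow> real"
  assumes \<phi>: "\<And>a. a \<in> cell_indices M 1 \<Longrightarrow> \<phi> a \<in> borel_measurable (tree_measure M p)"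
  shows "T.indep_vars (\<lambda>_. borel)
    (\<lambda>j R. case j of None \<Rightarrow> \<phi>\<^sub>0 (R (0, 0, 0)) | Some a \<Rightarrow> \<phi> a (subtree M a R))
    (insert None (Some ` cell_indices M 1))"
proof -
  define K where "K j = (case j of None \<Rightarrow> {(0, 0, 0)} | Some a \<Rightarrow> child_pos M a ` tree_index M)" for j
  define J where "J = insert None (Some ` cell_indices M 1)"
  define Y where "Y j r = (case j of None \<Rightarrow> \<phi>\<^sub>0 (r (0, 0, 0))
      | Some a \<Rightarrow> \<phi> a (\<lambda>v\<in>tree_index M. r (child_pos M a v)))" for j and r :: decision_tree
  have "T.indep_vars (\<lambda>j. PiM (K j) (\<lambda>_. count_space UNIV)) (\<lambda>j R. restrict (\<lambda>v. R v) (K j)) J"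
  proof (rule T.indep_vars_restrict[OF indep_decisions_tree])
    show "K j \<subseteq> tree_index M" if "j \<in> J" for j
      using that child_pos_in_tree_index by (auto simp: K_def J_def)
    show "disjoint_family_on K J"
      unfolding disjoint_family_on_def K_def J_def
      by (auto split: option.splits dest: child_pos_inj) (auto simp: child_pos_def)
  qed
  then have "T.indep_vars (\<lambda>_. borel) (\<lambda>j R. Y j (restrict (\<lambda>v. R v) (K j))) J"
  proof (rule T.indep_vars_compose2)
    fix j assume "j \<in> J"
    then consider "j = None" | a where "j = Some a" "a \<in> cell_indices M 1" by (auto simp: J_def)
    then show "Y j \<in> measurable (PiM (K j) (\<lambda>_. count_space UNIV)) borel"
    proof cases
      case 1
      have "(\<lambda>r. r (0, 0, 0)) \<in> measurable (PiM (K j) (\<lambda>_. count_space (UNIV :: bool set))) (count_space UNIV)"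
        using 1 by (intro measurable_component_singleton) (auto simp: K_def)
      then have "(\<lambda>r. \<phi>\<^sub>0 (r (0, 0, 0))) \<in> borel_measurable (PiM (K j) (\<lambda>_. count_space UNIV))"
        by (rule measurable_compose) simp
      then show ?thesis using 1 by (simp add: Y_def[abs_def])
    next
      case 2
      have "(\<lambda>r. \<lambda>v\<in>tree_index M. r (child_pos M a v)) \<in>
          measurable (PiM (K j) (\<lambda>_. count_space UNIV)) (tree_measure M p)"
        unfolding measurable_into_tree_measure
        by (intro measurable_restrict measurable_component_singleton) (auto simp: 2 K_def)
      then have "(\<lambda>r. \<phi> a (\<lambda>v\<in>tree_index M. r (child_pos M a v))) \<in> borel_measurable (PiM (K j) (\<lambda>_. count_space UNIV))"
        using \<phi>[OF 2(2)] by (rule measurable_compose)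
      then show ?thesis by (simp add: Y_def[abs_def] 2)
    qed
  qed
  also have "(\<lambda>j R. Y j (restrict (\<lambda>v. R v) (K j)))
      = (\<lambda>j R. case j of None \<Rightarrow> \<phi>\<^sub>0 (R (0, 0, 0)) | Some a \<Rightarrow> \<phi> a (subtree M a R))"
  proof (intro ext)
    fix j and R :: decision_tree
    have "(\<lambda>v\<in>tree_index M. (restrict (\<lambda>v. R v) (child_pos M a ` tree_index M)) (child_pos M a v)) = subtree M a R" for a
      unfolding subtree_def by (rule restrict_ext) auto
    then show "Y j (restrict (\<lambda>v. R v) (K j)) = (case j of None \<Rightarrow> \<phi>\<^sub>0 (R (0, 0, 0)) | Some a \<Rightarrow> \<phi> a (subtree M a R))"
      by (auto simp: Y_def K_def split: option.split)
  qed
  finally show ?thesis by (simp add: J_def)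
qed

lemma expectation_root: "T.expectation (\<lambda>R. of_bool (R (0, 0, 0))) = p"
proof -
  have "T.expectation (\<lambda>R. of_bool (R (0, 0, 0)) :: real)
      = integral\<^sup>L (distr (tree_measure M p) (count_space UNIV) (\<lambda>R. R (0, 0, 0))) of_bool"
    by (rule integral_distr[symmetric]) (auto intro: measurable_decision)
  also have "\<dots> = integral\<^sup>L (measure_pmf (bernoulli_pmf p)) of_bool"
    by (simp add: distr_decision)
  finally show ?thesis using p by simp
qed

lemma integrable_unit_bounded:
  fixes f :: "decision_tree \<Rightarrow> real"
  assumes "f \<in> borel_measurable (tree_measure M p)"
    "\<And>R. R \<in> space (tree_measure M p) \<Longrightarrow> 0 \<le> f R" "\<And>R. R \<in> space (tree_measure M p) \<Longrightarrow> f R \<le> c"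
  shows "integrable (tree_measure M p) f"
  using assms by (intro T.integrable_const_bound[where B = c]) (auto intro!: AE_I2)

lemma integrable_root: "integrable (tree_measure M p) (\<lambda>R. of_bool (R (0, 0, 0)) :: real)"
proof (rule integrable_unit_bounded[where c = 1])
  show "(\<lambda>R. of_bool (R (0, 0, 0)) :: real) \<in> borel_measurable (tree_measure M p)"
    by (rule measurable_compose[OF measurable_decision[OF root_in_tree_index]]) simp
qed simp_all

lemma subtree_in_space: "subtree M a R \<in> space (tree_measure M p)"
  by (simp add: space_tree_measure subtree_def)

lemma expectation_root_prod:
  fixes f :: "decision_tree \<Rightarrow> real"
  assumes f: "f \<in> borel_measurable (tree_measure M p)"
    "\<And>R. R \<in> space (tree_measure M p) \<Longrightarrow> 0 \<le> f R" "\<And>R. R \<in> space (tree_measure M p) \<Longrightarrow> f R \<le> 1"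
  shows "T.expectation (\<lambda>R. of_bool (R (0, 0, 0)) * (\<Prod>a\<in>cell_indices M 1. f (subtree M a R)))
    = p * T.expectation f ^ card (cell_indices M 1)"
proof -
  define Z where "Z j R = (case j of None \<Rightarrow> of_bool (R (0, 0, 0)) | Some a \<Rightarrow> f (subtree M a R))"
    for j and R :: decision_tree
  have int: "integrable (tree_measure M p) (Z j)" if "j \<in> insert None (Some ` cell_indices M 1)" for j
  proof (cases j)
    case None
    then show ?thesis using integrable_root by (simp add: Z_def[abs_def])
  next
    case (Some a)
    then have a: "a \<in> cell_indices M 1" using that by auto
    have "integrable (tree_measure M p) (\<lambda>R. f (subtree M a R))"
      using f(2,3) subtree_in_space by (intro integrable_unit_bounded[where c = 1]
        measurable_compose[OF measurable_subtree[OF a] f(1)]) auto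
    then show ?thesis by (simp add: Z_def[abs_def] Some)
  qed
  have "T.expectation (\<lambda>R. \<Prod>j\<in>insert None (Some ` cell_indices M 1). Z j R)
      = (\<Prod>j\<in>insert None (Some ` cell_indices M 1). T.expectation (Z j))"
    using indep_root_subtrees[of "\<lambda>_. f" of_bool] f(1) int unfolding Z_def[symmetric]
    by (intro T.indep_vars_lebesgue_integral) (auto simp: Z_def[abs_def])
  then show ?thesis
    by (simp add: prod.reindex Z_def[abs_def] expectation_root integral_subtree f(1))
qed

text \<open>The root decision is independent of everything below it. \<open>h\<close> will be the
  truncation in the recursion of \<open>min_cut\<close>, and its square for the second
  moment.\<close>

lemma expectation_root_comp_sum:
  fixes f :: "decision_tree \<Rightarrow> real" and h :: "real \<Rightarrow> real"
  assumes f: "f \<in> borel_measurable (tree_measure M p)"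
    and h: "h \<in> borel_measurable borel" "\<And>x. 0 \<le> h x" "\<And>x. h x \<le> 1"
  shows "T.expectation (\<lambda>R. of_bool (R (0, 0, 0)) * h (\<Sum>a\<in>cell_indices M 1. f (subtree M a R)))
    = p * T.expectation (\<lambda>R. h (\<Sum>a\<in>cell_indices M 1. f (subtree M a R)))"
proof -
  define Z where "Z j R = (case j of None \<Rightarrow> of_bool (R (0, 0, 0)) | Some a \<Rightarrow> f (subtree M a R))"
    for j and R :: decision_tree
  have "T.indep_vars (\<lambda>_. borel) Z (insert None (Some ` cell_indices M 1))"
    using indep_root_subtrees[of "\<lambda>_. f" of_bool] f by (simp add: Z_def[abs_def])
  then have "T.indep_var borel (Z None) borel (\<lambda>R. \<Sum>j\<in>Some ` cell_indices M 1. Z j R)"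
    by (intro T.indep_vars_sum) auto
  then have "T.indep_var borel ((\<lambda>x. x) \<circ> Z None) borel (h \<circ> (\<lambda>R. \<Sum>j\<in>Some ` cell_indices M 1. Z j R))"
    by (rule T.indep_var_compose) (use h in auto)
  then have ind: "T.indep_var borel (\<lambda>R. of_bool (R (0, 0, 0)) :: real)
      borel (\<lambda>R. h (\<Sum>a\<in>cell_indices M 1. f (subtree M a R)))"
    by (simp add: Z_def[abs_def] comp_def sum.reindex)
  have [measurable]: "(\<lambda>R. f (subtree M a R)) \<in> borel_measurable (tree_measure M p)" if "a \<in> cell_indices M 1" for a
    by (rule measurable_compose[OF measurable_subtree[OF that] f])
  have "integrable (tree_measure M p) (\<lambda>R. h (\<Sum>a\<in>cell_indices M 1. f (subtree M a R)))"
    using h by (intro integrable_unit_bounded[where c = 1] measurable_compose[OF _ h(1)]) auto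
  then show ?thesis
    using T.indep_var_lebesgue_integral[OF ind integrable_root] by (simp add: expectation_root)
qed

lemma expectation_subtree_mult:
  fixes f :: "decision_tree \<Rightarrow> real"
  assumes f: "f \<in> borel_measurable (tree_measure M p)"
    "\<And>R. R \<in> space (tree_measure M p) \<Longrightarrow> 0 \<le> f R" "\<And>R. R \<in> space (tree_measure M p) \<Longrightarrow> f R \<le> 1"
    and ab: "a \<in> cell_indices M 1" "b \<in> cell_indices M 1" "a \<noteq> b"
  shows "T.expectation (\<lambda>R. f (subtree M a R) * f (subtree M b R)) = (T.expectation f)\<^sup>2"
proof -
  define Z where "Z j R = (case j of None \<Rightarrow> of_bool (R (0, 0, 0)) | Some a \<Rightarrow> f (subtree M a R))"
    for j and R :: decision_tree
  have "T.indep_vars (\<lambda>_. borel) Z (insert None (Some ` cell_indices M 1))"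
    using indep_root_subtrees[of "\<lambda>_. f" of_bool] f by (simp add: Z_def[abs_def])
  then have "T.indep_vars (\<lambda>_. borel) Z {Some a, Some b}"
    by (rule T.indep_vars_subset) (use ab in auto)
  moreover have intZ: "integrable (tree_measure M p) (Z (Some c))" if "c \<in> cell_indices M 1" for c
  proof -
    have "integrable (tree_measure M p) (\<lambda>R. f (subtree M c R))"
      using f(2,3)[OF subtree_in_space] by (intro integrable_unit_bounded[where c = 1]
        measurable_compose[OF measurable_subtree[OF that] f(1)])
    then show ?thesis by (simp add: Z_def[abs_def])
  qed
  ultimately have "T.expectation (\<lambda>R. \<Prod>j\<in>{Some a, Some b}. Z j R) = (\<Prod>j\<in>{Some a, Some b}. T.expectation (Z j))"
    using ab(1,2) by (intro T.indep_vars_lebesgue_integral) (auto intro: intZ simp del: split_paired_All)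
  then show ?thesis
    using ab by (simp add: Z_def[abs_def] integral_subtree f(1) power2_eq_square)
qed

lemma expectation_sum_subtrees:
  fixes f :: "decision_tree \<Rightarrow> real"
  defines "k \<equiv> real (card (cell_indices M 1))"
  assumes f: "f \<in> borel_measurable (tree_measure M p)"
    "\<And>R. R \<in> space (tree_measure M p) \<Longrightarrow> 0 \<le> f R" "\<And>R. R \<in> space (tree_measure M p) \<Longrightarrow> f R \<le> 1"
  shows "T.expectation (\<lambda>R. \<Sum>a\<in>cell_indices M 1. f (subtree M a R)) = k * T.expectation f"
    and "T.expectation (\<lambda>R. (\<Sum>a\<in>cell_indices M 1. f (subtree M a R))\<^sup>2)
      \<le> k * T.expectation (\<lambda>R. (f R)\<^sup>2) + k\<^sup>2 * (T.expectation f)\<^sup>2"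
proof -
  have meas: "(\<lambda>R. f (subtree M a R)) \<in> borel_measurable (tree_measure M p)" if "a \<in> cell_indices M 1" for a
    by (rule measurable_compose[OF measurable_subtree[OF that] f(1)])
  have int1: "integrable (tree_measure M p) (\<lambda>R. f (subtree M a R))" if "a \<in> cell_indices M 1" for a
    using f(2,3) subtree_in_space meas[OF that] by (intro integrable_unit_bounded[where c = 1]) auto
  have int2: "integrable (tree_measure M p) (\<lambda>R. f (subtree M a R) * f (subtree M b R))"
    if "a \<in> cell_indices M 1" "b \<in> cell_indices M 1" for a b
    by (intro integrable_unit_bounded[where c = 1] borel_measurable_times meas that
        mult_nonneg_nonneg mult_le_one f(2,3) subtree_in_space)
  show "T.expectation (\<lambda>R. \<Sum>a\<in>cell_indices M 1. f (subtree M a R)) = k * T.expectation f"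
    using int1 by (simp add: k_def integral_subtree f(1))
  have f2: "(\<lambda>R. (f R)\<^sup>2) \<in> borel_measurable (tree_measure M p)" using f(1) by measurable
  have "T.expectation (\<lambda>R. (\<Sum>a\<in>cell_indices M 1. f (subtree M a R))\<^sup>2)
      = (\<Sum>a\<in>cell_indices M 1. T.expectation (\<lambda>R. \<Sum>b\<in>cell_indices M 1. f (subtree M a R) * f (subtree M b R)))"
    unfolding power2_eq_square sum_product
    by (intro Bochner_Integration.integral_sum Bochner_Integration.integrable_sum int2)
  also have "\<dots> = (\<Sum>a\<in>cell_indices M 1. \<Sum>b\<in>cell_indices M 1. T.expectation (\<lambda>R. f (subtree M a R) * f (subtree M b R)))"
    by (intro sum.cong refl Bochner_Integration.integral_sum int2)
  \<comment> \<open>Off the diagonal the covariances vanish. Adding the squared mean on the diagonal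
    too gives the round factor \<open>k\<^sup>2\<close>.\<close>
  also have "\<dots> \<le> (\<Sum>a\<in>cell_indices M 1. \<Sum>b\<in>cell_indices M 1.
      (if b = a then T.expectation (\<lambda>R. (f R)\<^sup>2) else 0) + (T.expectation f)\<^sup>2)"
  proof (intro sum_mono)
    fix a b assume ab: "a \<in> cell_indices M 1" "b \<in> cell_indices M 1"
    show "T.expectation (\<lambda>R. f (subtree M a R) * f (subtree M b R))
        \<le> (if b = a then T.expectation (\<lambda>R. (f R)\<^sup>2) else 0) + (T.expectation f)\<^sup>2"
    proof (cases "b = a")
      case True
      have "T.expectation (\<lambda>R. f (subtree M a R) * f (subtree M a R)) = T.expectation (\<lambda>R. (f R)\<^sup>2)"
        using integral_subtree[OF ab(1) f2] by (simp add: power2_eq_square)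
      then show ?thesis using True by simp
    next
      case False
      then show ?thesis using expectation_subtree_mult[OF f ab] by simp
    qed
  qed
  also have "\<dots> = k * T.expectation (\<lambda>R. (f R)\<^sup>2) + k\<^sup>2 * (T.expectation f)\<^sup>2"
    by (simp add: sum.distrib k_def power2_eq_square distrib_left mult.assoc)
  finally show "T.expectation (\<lambda>R. (\<Sum>a\<in>cell_indices M 1. f (subtree M a R))\<^sup>2)
      \<le> k * T.expectation (\<lambda>R. (f R)\<^sup>2) + k\<^sup>2 * (T.expectation f)\<^sup>2" .
qed

section \<open>Expected cut cost and extinction\<close>

lemma measurable_min_cut [measurable]: "min_cut \<theta> M n \<in> borel_measurable (tree_measure M p)"
proof (induction n)
  case 0
  then show ?case unfolding min_cut.simps(1)[abs_def] by measurable
next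
  case (Suc n)
  have [measurable]: "(\<lambda>R. min_cut \<theta> M n (subtree M a R)) \<in> borel_measurable (tree_measure M p)"
    if "a \<in> cell_indices M 1" for a
    by (rule measurable_compose[OF measurable_subtree[OF that] Suc])
  show ?case unfolding min_cut.simps(2)[abs_def] by measurable
qed

text \<open>The recursion for \<open>min_cut\<close> is applied to smaller functions \<open>f\<close>, rescaled by a constant \<open>t \<le> 1\<close> in
  every step to keep the mean equal to \<open>\<delta>\<close>. The inequality \<open>min 1 x \<ge> x - x\<^sup>2 / 4\<close> bounds the loss caused by
  the truncation, and \<open>p * \<theta>\<^sup>2 * k < 1\<close> keeps the second moments bounded.\<close>

lemma expectation_min_cut_bounded_below:
  fixes \<theta> :: real
  defines "k \<equiv> real (card (cell_indices M 1))"
  assumes \<theta>: "0 < \<theta>" "1 < p * \<theta> * k" "p * \<theta>\<^sup>2 * k < 1"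
  obtains \<delta> where "\<delta> > 0" "\<And>n. \<delta> \<le> T.expectation (min_cut \<theta> M n)"
proof -
  \<comment> \<open>\<open>m\<close> is the growth factor of the mean in one step without
    truncation, \<open>\<gamma>\<close> the contraction factor of the second moment.
    \<open>D\<close> is large enough for the start (\<open>1 / p\<close>) and satisfies
    \<open>\<gamma> * D + p * \<theta>\<^sup>2 * k\<^sup>2 \<le> D\<close>. The bound
    \<open>\<delta> \<le> p\<close> keeps \<open>f\<close> below \<open>min_cut\<close> at level 0,
    and \<open>D * \<delta> \<le> 4 * (m - 1)\<close> makes the truncation loss
    \<open>D * \<delta>\<^sup>2 / 4\<close> at most the gain
    \<open>(m - 1) * \<delta>\<close>.\<close>
  define m \<gamma> D \<delta> where "m = p * \<theta> * k" and "\<gamma> = p * \<theta>\<^sup>2 * k"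
    and "D = max (1 / p) (p * \<theta>\<^sup>2 * k\<^sup>2 / (1 - \<gamma>))" and "\<delta> = min p (4 * (m - 1) / D)"
  have m: "m > 1" "\<gamma> < 1" using \<theta> by (auto simp: m_def \<gamma>_def)
  have "1 / p \<le> D" by (simp add: D_def)
  moreover have "1 / p > 0" using p by simp
  ultimately have D: "D > 0" "1 / p \<le> D" by linarith+
  have "p * \<theta>\<^sup>2 * k\<^sup>2 / (1 - \<gamma>) \<le> D" by (simp add: D_def)
  then have D2: "\<gamma> * D + p * \<theta>\<^sup>2 * k\<^sup>2 \<le> D" using m by (simp add: field_simps)
  have \<delta>: "\<delta> > 0" "\<delta> \<le> p" using m p D by (auto simp: \<delta>_def)
  have "\<delta> \<le> 4 * (m - 1) / D" by (simp add: \<delta>_def)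
  then have D\<delta>: "D * \<delta> \<le> 4 * (m - 1)" using D by (simp add: field_simps)
  have k: "k \<ge> 0" by (simp add: k_def)
  have step: "\<exists>f\<in>borel_measurable (tree_measure M p).
      (\<forall>R\<in>space (tree_measure M p). 0 \<le> f R \<and> f R \<le> min_cut \<theta> M n R) \<and>
      T.expectation f = \<delta> \<and> T.expectation (\<lambda>R. (f R)\<^sup>2) \<le> D * \<delta>\<^sup>2" for n
  proof (induction n)
    case 0
    define f where "f R = \<delta> / p * of_bool (R (0, 0, 0))" for R :: decision_tree
    have "f \<in> borel_measurable (tree_measure M p)"
      unfolding f_def[abs_def]
      by (rule measurable_compose[OF measurable_decision[OF root_in_tree_index]]) simp
    moreover have "0 \<le> f R \<and> f R \<le> min_cut \<theta> M 0 R" for R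
      using \<delta> p by (simp add: f_def)
    moreover have "T.expectation f = \<delta>"
      using expectation_root p by (simp add: f_def[abs_def])
    moreover have "T.expectation (\<lambda>R. (f R)\<^sup>2) \<le> D * \<delta>\<^sup>2"
    proof -
      have "(\<lambda>R. (f R)\<^sup>2) = (\<lambda>R. (\<delta> / p)\<^sup>2 * of_bool (R (0, 0, 0)))"
        by (auto simp: f_def fun_eq_iff)
      then have "T.expectation (\<lambda>R. (f R)\<^sup>2) = (1 / p) * \<delta>\<^sup>2"
        using expectation_root p by (simp add: power2_eq_square)
      also have "\<dots> \<le> D * \<delta>\<^sup>2" using D by (intro mult_right_mono) auto
      finally show ?thesis .
    qed
    ultimately show ?case by blast
  next
    case (Suc n)
    then obtain f where f: "f \<in> borel_measurable (tree_measure M p)"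
      "\<And>R. R \<in> space (tree_measure M p) \<Longrightarrow> 0 \<le> f R"
      "\<And>R. R \<in> space (tree_measure M p) \<Longrightarrow> f R \<le> min_cut \<theta> M n R"
      "T.expectation f = \<delta>" "T.expectation (\<lambda>R. (f R)\<^sup>2) \<le> D * \<delta>\<^sup>2" by blast
    have f1: "f R \<le> 1" if "R \<in> space (tree_measure M p)" for R
      using f(3)[OF that] min_cut_bounds(2)[of \<theta> M n R] by linarith
    define S where "S R = (\<Sum>a\<in>cell_indices M 1. f (subtree M a R))" for R
    \<comment> \<open>The \<open>max 0\<close> makes \<open>h\<close> nonnegative on all reals, as
      \<open>expectation_root_comp_sum\<close> demands; the values of \<open>S\<close> are
      nonnegative anyway.\<close>
    define h where "h x = min 1 (max 0 (\<theta> * x))" for x :: real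
    have S0: "S R \<ge> 0" for R unfolding S_def by (intro sum_nonneg f(2) subtree_in_space)
    have Sk: "S R \<le> k" for R
    proof -
      have "S R \<le> (\<Sum>a\<in>cell_indices M 1. 1)" unfolding S_def by (intro sum_mono f1 subtree_in_space)
      then show ?thesis by (simp add: k_def)
    qed
    have Sm[measurable]: "S \<in> borel_measurable (tree_measure M p)"
      unfolding S_def[abs_def]
      by (intro borel_measurable_sum measurable_compose[OF measurable_subtree f(1)])
    have hm[measurable]: "h \<in> borel_measurable borel" unfolding h_def[abs_def] by measurable
    have h01: "0 \<le> h x" "h x \<le> 1" for x by (auto simp: h_def)
    have hlow: "\<theta> * x - \<theta>\<^sup>2 / 4 * x\<^sup>2 \<le> h x" if "x \<ge> 0" for x
    proof -
      have "0 \<le> (\<theta> * x / 2 - 1)\<^sup>2" by simp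
      then have "\<theta> * x - \<theta>\<^sup>2 / 4 * x\<^sup>2 \<le> 1" by (simp add: power2_eq_square field_simps)
      moreover have "\<theta> * x - \<theta>\<^sup>2 / 4 * x\<^sup>2 \<le> \<theta> * x" by simp
      ultimately show ?thesis using that \<theta>(1) by (simp add: h_def)
    qed
    have hup: "(h x)\<^sup>2 \<le> \<theta>\<^sup>2 * x\<^sup>2" if "x \<ge> 0" for x
    proof -
      have "h x \<le> \<theta> * x" using that \<theta>(1) by (simp add: h_def)
      then have "(h x)\<^sup>2 \<le> (\<theta> * x)\<^sup>2" using h01 by (intro power_mono) auto
      then show ?thesis by (simp add: power_mult_distrib)
    qed
    have int: "integrable (tree_measure M p) S" "integrable (tree_measure M p) (\<lambda>R. (S R)\<^sup>2)"
      "integrable (tree_measure M p) (\<lambda>R. h (S R))" "integrable (tree_measure M p) (\<lambda>R. (h (S R))\<^sup>2)"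
    proof -
      show "integrable (tree_measure M p) S"
        by (rule integrable_unit_bounded[where c = k]) (use S0 Sk in auto)
      show "integrable (tree_measure M p) (\<lambda>R. (S R)\<^sup>2)"
        by (rule integrable_unit_bounded[where c = "k\<^sup>2"]) (use S0 Sk in \<open>auto intro: power_mono\<close>)
      show "integrable (tree_measure M p) (\<lambda>R. h (S R))"
        by (rule integrable_unit_bounded[where c = 1]) (use h01 in auto)
      show "integrable (tree_measure M p) (\<lambda>R. (h (S R))\<^sup>2)"
        by (rule integrable_unit_bounded[where c = 1]) (use h01 in \<open>auto intro: power_le_one\<close>)
    qed
    have ES: "T.expectation S = k * \<delta>"
      using expectation_sum_subtrees(1)[OF f(1,2) f1] by (simp add: S_def[abs_def] k_def f(4))
    have ES2: "T.expectation (\<lambda>R. (S R)\<^sup>2) \<le> k * (D * \<delta>\<^sup>2) + k\<^sup>2 * \<delta>\<^sup>2"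
    proof -
      have "T.expectation (\<lambda>R. (S R)\<^sup>2) \<le> k * T.expectation (\<lambda>R. (f R)\<^sup>2) + k\<^sup>2 * \<delta>\<^sup>2"
        using expectation_sum_subtrees(2)[OF f(1,2) f1] by (simp add: S_def[abs_def] k_def f(4))
      also have "\<dots> \<le> k * (D * \<delta>\<^sup>2) + k\<^sup>2 * \<delta>\<^sup>2" using f(5) k by (intro add_right_mono mult_left_mono)
      finally show ?thesis .
    qed
    have pES2: "p * \<theta>\<^sup>2 * T.expectation (\<lambda>R. (S R)\<^sup>2) \<le> D * \<delta>\<^sup>2"
    proof -
      have "p * \<theta>\<^sup>2 * T.expectation (\<lambda>R. (S R)\<^sup>2) \<le> p * \<theta>\<^sup>2 * (k * (D * \<delta>\<^sup>2) + k\<^sup>2 * \<delta>\<^sup>2)"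
        using ES2 p by (intro mult_left_mono) auto
      also have "\<dots> = (\<gamma> * D + p * \<theta>\<^sup>2 * k\<^sup>2) * \<delta>\<^sup>2" by (simp add: \<gamma>_def algebra_simps)
      also have "\<dots> \<le> D * \<delta>\<^sup>2" using D2 by (intro mult_right_mono) auto
      finally show ?thesis .
    qed
    define e where "e = p * T.expectation (\<lambda>R. h (S R))"
    have "T.expectation (\<lambda>R. \<theta> * S R - \<theta>\<^sup>2 / 4 * (S R)\<^sup>2) \<le> T.expectation (\<lambda>R. h (S R))"
      using int hlow[OF S0] by (intro integral_mono) auto
    then have "\<theta> * (k * \<delta>) - \<theta>\<^sup>2 / 4 * T.expectation (\<lambda>R. (S R)\<^sup>2) \<le> T.expectation (\<lambda>R. h (S R))"
      using int by (simp add: ES)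
    then have "p * (\<theta> * (k * \<delta>) - \<theta>\<^sup>2 / 4 * T.expectation (\<lambda>R. (S R)\<^sup>2)) \<le> e"
      unfolding e_def using p by (intro mult_left_mono) auto
    then have "m * \<delta> - (p * \<theta>\<^sup>2 * T.expectation (\<lambda>R. (S R)\<^sup>2)) / 4 \<le> e"
      by (simp add: m_def algebra_simps)
    moreover have "\<delta> \<le> m * \<delta> - D * \<delta>\<^sup>2 / 4"
    proof -
      have "D * \<delta> * \<delta> \<le> 4 * (m - 1) * \<delta>" using D\<delta> \<delta> by (intro mult_right_mono) auto
      then show ?thesis by (simp add: power2_eq_square algebra_simps)
    qed
    ultimately have e: "\<delta> \<le> e" using pES2 by linarith
    \<comment> \<open>Scaling down keeps \<open>f'\<close> below \<open>min_cut\<close>, and pinning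
      the mean at \<open>\<delta>\<close> stops the term with the squared mean in the second moment
      from growing from level to level.\<close>
    define t where "t = \<delta> / e"
    have t: "0 < t" "t \<le> 1" "t * e = \<delta>" using e \<delta> by (auto simp: t_def)
    define f' where "f' R = t * (of_bool (R (0, 0, 0)) * h (S R))" for R
    have fm: "f' \<in> borel_measurable (tree_measure M p)"
    proof -
      have [measurable]: "(\<lambda>R. of_bool (R (0, 0, 0)) :: real) \<in> borel_measurable (tree_measure M p)"
        using integrable_root by simp
      show ?thesis unfolding f'_def[abs_def] by measurable
    qed
    have bnd: "0 \<le> f' R \<and> f' R \<le> min_cut \<theta> M (Suc n) R" for R
    proof
      show "0 \<le> f' R" using t h01 by (simp add: f'_def)
      have "S R \<le> (\<Sum>a\<in>cell_indices M 1. min_cut \<theta> M n (subtree M a R))"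
        unfolding S_def by (intro sum_mono f(3) subtree_in_space)
      then have "\<theta> * S R \<le> \<theta> * (\<Sum>a\<in>cell_indices M 1. min_cut \<theta> M n (subtree M a R))"
        using \<theta>(1) by (intro mult_left_mono) auto
      then have "h (S R) \<le> min 1 (\<theta> * (\<Sum>a\<in>cell_indices M 1. min_cut \<theta> M n (subtree M a R)))"
      proof -
        assume le: "\<theta> * S R \<le> \<theta> * (\<Sum>a\<in>cell_indices M 1. min_cut \<theta> M n (subtree M a R))"
        have "h (S R) = min 1 (\<theta> * S R)" using S0[of R] \<theta>(1) by (simp add: h_def)
        also have "\<dots> \<le> min 1 (\<theta> * (\<Sum>a\<in>cell_indices M 1. min_cut \<theta> M n (subtree M a R)))"
          using le by (intro min.mono order_refl)
        finally show ?thesis .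
      qed
      moreover have "f' R \<le> of_bool (R (0, 0, 0)) * h (S R)"
        unfolding f'_def using t h01 by (intro mult_left_le_one_le) auto
      ultimately show "f' R \<le> min_cut \<theta> M (Suc n) R"
        unfolding min_cut.simps(2) by (auto simp: of_bool_def)
    qed
    have Ef: "T.expectation f' = \<delta>"
      using expectation_root_comp_sum[OF f(1) hm h01] t(3) by (simp add: f'_def[abs_def] S_def e_def mult.assoc)
    have Ef2: "T.expectation (\<lambda>R. (f' R)\<^sup>2) \<le> D * \<delta>\<^sup>2"
    proof -
      have "(\<lambda>R. (f' R)\<^sup>2) = (\<lambda>R. t\<^sup>2 * (of_bool (R (0, 0, 0)) * (h (S R))\<^sup>2))"
        by (auto simp: f'_def power_mult_distrib)
      then have "T.expectation (\<lambda>R. (f' R)\<^sup>2) = t\<^sup>2 * (p * T.expectation (\<lambda>R. (h (S R))\<^sup>2))"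
        using expectation_root_comp_sum[OF f(1), of "\<lambda>x. (h x)\<^sup>2"] h01 hm
        by (simp add: S_def power_le_one)
      also have "\<dots> \<le> 1 * (p * T.expectation (\<lambda>R. (h (S R))\<^sup>2))"
        using t p by (intro mult_right_mono) (auto intro!: power_le_one mult_nonneg_nonneg integral_nonneg_AE)
      also have "T.expectation (\<lambda>R. (h (S R))\<^sup>2) \<le> T.expectation (\<lambda>R. \<theta>\<^sup>2 * (S R)\<^sup>2)"
        using int hup[OF S0] by (intro integral_mono) auto
      then have "1 * (p * T.expectation (\<lambda>R. (h (S R))\<^sup>2)) \<le> p * \<theta>\<^sup>2 * T.expectation (\<lambda>R. (S R)\<^sup>2)"
        using p by (simp add: mult.assoc)
      also note pES2
      finally show ?thesis .
    qed
    show ?case by (rule bexI[OF _ fm]) (use bnd Ef Ef2 in blast)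
  qed
  have "\<delta> \<le> T.expectation (min_cut \<theta> M n)" for n
  proof -
    obtain f where f: "f \<in> borel_measurable (tree_measure M p)"
      "\<And>R. R \<in> space (tree_measure M p) \<Longrightarrow> 0 \<le> f R"
      "\<And>R. R \<in> space (tree_measure M p) \<Longrightarrow> f R \<le> min_cut \<theta> M n R"
      "T.expectation f = \<delta>" using step[of n] by blast
    have "integrable (tree_measure M p) (min_cut \<theta> M n)"
      using min_cut_bounds \<theta>(1) by (intro integrable_unit_bounded[where c = 1] measurable_min_cut) auto
    moreover have "integrable (tree_measure M p) f"
      using f(1,2) order_trans[OF f(3) min_cut_bounds(2)] by (rule integrable_unit_bounded)
    ultimately show ?thesis using f(3) unfolding f(4)[symmetric] by (intro integral_mono) auto
  qed
  then show thesis using that \<delta>(1) by blast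
qed

text \<open>Split by the root: it is discarded with probability \<open>1 - p\<close>, and otherwise
  all the independent subtrees must lie in \<open>A\<close>. Since a tree includes the decision
  about its own root, the map is \<open>1 - p + p * x ^ k\<close> and not the
  \<open>(1 - p + p * x) ^ k\<close> of the number of retained children.\<close>

lemma prob_inherited:
  assumes A: "A \<in> sets (tree_measure M p)"
    and inh: "\<And>R. R \<in> space (tree_measure M p) \<Longrightarrow>
      R \<in> A \<longleftrightarrow> \<not> R (0, 0, 0) \<or> (\<forall>a\<in>cell_indices M 1. subtree M a R \<in> A)"
  shows "T.prob A = 1 - p + p * T.prob A ^ card (cell_indices M 1)"
proof -
  define f where "f = (indicator A :: decision_tree \<Rightarrow> real)"
  have f: "f \<in> borel_measurable (tree_measure M p)" "\<And>R. 0 \<le> f R" "\<And>R. f R \<le> 1"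
    using A by (auto simp: f_def indicator_def)
  have Ef: "T.expectation f = T.prob A" using A by (simp add: f_def)
  define G where "G R = of_bool (R (0, 0, 0)) * (\<Prod>a\<in>cell_indices M 1. f (subtree M a R))" for R
  have EG: "T.expectation G = p * T.prob A ^ card (cell_indices M 1)"
    using expectation_root_prod[OF f] Ef by (simp add: G_def[abs_def])
  have meas: "(\<lambda>R. f (subtree M a R)) \<in> borel_measurable (tree_measure M p)" if "a \<in> cell_indices M 1" for a
    by (rule measurable_compose[OF measurable_subtree[OF that] f(1)])
  have prod01: "0 \<le> (\<Prod>a\<in>cell_indices M 1. f (subtree M a R))" "(\<Prod>a\<in>cell_indices M 1. f (subtree M a R)) \<le> 1" for R
    using f by (auto intro: prod_nonneg prod_le_1)
  have "integrable (tree_measure M p) G"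
  proof (rule integrable_unit_bounded[where c = 1])
    have "(\<lambda>R. of_bool (R (0, 0, 0)) :: real) \<in> borel_measurable (tree_measure M p)"
      using integrable_root by simp
    then show "G \<in> borel_measurable (tree_measure M p)"
      unfolding G_def[abs_def] by (intro borel_measurable_times borel_measurable_prod meas)
  qed (use prod01 in \<open>auto simp: G_def\<close>)
  then have "T.expectation (\<lambda>R. 1 - of_bool (R (0, 0, 0)) + G R) = 1 - p + p * T.prob A ^ card (cell_indices M 1)"
    using integrable_root by (simp add: EG expectation_root T.prob_space)
  moreover have "T.expectation (\<lambda>R. 1 - of_bool (R (0, 0, 0)) + G R) = T.expectation f"
  proof (rule Bochner_Integration.integral_cong[OF refl])
    fix R assume R: "R \<in> space (tree_measure M p)"
    have "(\<Prod>a\<in>cell_indices M 1. f (subtree M a R)) = of_bool (\<forall>a\<in>cell_indices M 1. subtree M a R \<in> A)"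
    proof (cases "\<forall>a\<in>cell_indices M 1. subtree M a R \<in> A")
      case True
      then show ?thesis by (simp add: f_def)
    next
      case False
      then obtain a where "a \<in> cell_indices M 1" "f (subtree M a R) = 0" by (auto simp: f_def)
      then have "(\<Prod>a\<in>cell_indices M 1. f (subtree M a R)) = 0" by (intro prod_zero) auto
      with False show ?thesis by (simp only: of_bool_eq)
    qed
    then show "1 - of_bool (R (0, 0, 0)) + G R = f R"
      using inh[OF R] by (simp add: G_def f_def indicator_def)
  qed
  ultimately show ?thesis using Ef by simp
qed

lemma AE_min_cut_null_imp_extinct:
  fixes \<theta> :: real
  defines "k \<equiv> card (cell_indices M 1)"
  assumes \<theta>: "0 < \<theta>" "1 < p * \<theta> * real k" "p * \<theta>\<^sup>2 * real k < 1" and k: "k \<ge> 2"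
  shows "AE R in tree_measure M p. (\<lambda>n. min_cut \<theta> M n R) \<longlonglongrightarrow> 0 \<longrightarrow> (\<exists>n. min_cut \<theta> M n R = 0)"
proof -
  define A where "A = {R \<in> space (tree_measure M p). \<exists>n. min_cut \<theta> M n R = 0}"
  define B where "B = {R \<in> space (tree_measure M p). (\<lambda>n. min_cut \<theta> M n R) \<longlonglongrightarrow> 0}"
  have A: "A \<in> sets (tree_measure M p)" unfolding A_def by measurable
  have B: "B \<in> sets (tree_measure M p)" unfolding B_def by measurable
  have AB: "A \<subseteq> B"
  proof
    fix R assume R: "R \<in> A"
    then obtain m where m: "min_cut \<theta> M m R = 0" by (auto simp: A_def)
    have "min_cut \<theta> M n R = 0" if "n \<ge> m" for n
      using min_cut_antimono[of \<theta> m n M R] min_cut_bounds(1)[of \<theta> M n R] that \<theta> m by simp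
    then have "\<forall>\<^sub>F n in sequentially. min_cut \<theta> M n R = 0"
      by (auto simp: eventually_sequentially)
    then show "R \<in> B" using R by (auto simp: A_def B_def intro: tendsto_eventually)
  qed
  have fixA: "T.prob A = 1 - p + p * T.prob A ^ k"
    unfolding k_def
  proof (rule prob_inherited[OF A])
    show "R \<in> A \<longleftrightarrow> \<not> R (0, 0, 0) \<or> (\<forall>a\<in>cell_indices M 1. subtree M a R \<in> A)"
      if "R \<in> space (tree_measure M p)" for R
      unfolding A_def using min_cut_extinct_inherited[OF \<theta>(1), of M R] subtree_in_space that by blast
  qed
  have fixB: "T.prob B = 1 - p + p * T.prob B ^ k"
    unfolding k_def
  proof (rule prob_inherited[OF B])
    show "R \<in> B \<longleftrightarrow> \<not> R (0, 0, 0) \<or> (\<forall>a\<in>cell_indices M 1. subtree M a R \<in> B)"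
      if "R \<in> space (tree_measure M p)" for R
      unfolding B_def using min_cut_null_inherited[OF \<theta>(1), of M R] subtree_in_space that by blast
  qed
  \<comment> \<open>Rules out the trivial fixed point 1: if the cost tended to 0 almost surely, so
    would its expectation by dominated convergence, against the uniform lower bound.\<close>
  have "T.prob B \<noteq> 1"
  proof
    assume "T.prob B = 1"
    then have "AE R in tree_measure M p. R \<in> B" using T.prob_eq_1[OF B] by simp
    then have lim: "AE R in tree_measure M p. (\<lambda>n. min_cut \<theta> M n R) \<longlonglongrightarrow> 0"
      by eventually_elim (simp add: B_def)
    have "(\<lambda>n. T.expectation (min_cut \<theta> M n)) \<longlonglongrightarrow> T.expectation (\<lambda>_. 0)"
      using min_cut_bounds \<theta>(1) lim
      by (intro integral_dominated_convergence[where w = "\<lambda>_. 1"] measurable_min_cut) (auto intro!: AE_I2)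
    moreover obtain \<delta> where "\<delta> > 0" "\<And>n. \<delta> \<le> T.expectation (min_cut \<theta> M n)"
      using expectation_min_cut_bounded_below[OF \<theta>[unfolded k_def]] by blast
    ultimately show False using LIMSEQ_le_const[of _ 0 \<delta>] by fastforce
  qed
  then have "T.prob B < 1" using T.prob_le_1[of B] by linarith
  moreover have "T.prob A \<le> T.prob B" using AB B by (intro T.finite_measure_mono)
  ultimately have "T.prob A = T.prob B"
    using branching_fixed_point_unique[OF p(1) _ _ _ k fixA fixB] by simp
  then have "T.prob (B - A) = 0" using T.finite_measure_Diff[OF B A AB] by simp
  then have "B - A \<in> null_sets (tree_measure M p)"
    using A B by (intro null_setsI) (auto simp: T.emeasure_eq_measure)
  then show ?thesis
    by (rule AE_I') (auto simp: A_def B_def)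
qed

end

section \<open>Dimension of the percolation set and of its projections\<close>

text \<open>A cheap cover would yield a cheap cutset: thicken the covering sets to open ones, keep
  finitely many by compactness, and replace each by the at most 49 cells of its own level near one
  of its points. A cell of level \<open>n\<close> costs \<open>((1 / M) ^ n) powr s\<close>, so the
  cutset costs at most 49 times as much as the cover.\<close>

lemma hausdorff_measure_pos_if_min_cut_bounded_below:
  assumes M: "M \<ge> 2" and s: "s > 0" and \<eta>: "\<eta> > 0"
    and cut: "\<And>n. \<eta> \<le> min_cut ((1 / real M) powr s) M n R"
  shows "hausdorff_measure s (percolation_set M (\<lambda>n c. R (n, c))) \<noteq> 0"
proof
  define R' where "R' = (\<lambda>n c. R (n, c))"
  define \<theta> where "\<theta> = (1 / real M) powr s"
  assume "hausdorff_measure s (percolation_set M (\<lambda>n c. R (n, c))) = 0"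
  then have null: "hausdorff_measure s (percolation_set M R') = 0" by (simp add: R'_def)
  have M1: "M \<ge> 1" using M by simp
  have \<theta>: "\<theta> > 0" using M by (simp add: \<theta>_def)
  \<comment> \<open>\<open>98 = 2 * 49\<close>, so that the cutset built below costs at most
    \<open>\<eta> / 2\<close>.\<close>
  obtain U n where U: "percolation_set M R' \<subseteq> (\<Union>i. U i)" "\<And>i. bounded (U i)"
    "\<And>i. diameter (U i) \<le> (1 / real M) ^ n i" "summable (\<lambda>i. ((1 / real M) ^ n i) powr s)"
    "(\<Sum>i. ((1 / real M) ^ n i) powr s) \<le> \<eta> / 98"
    using hausdorff_null_scaled_cover[OF M s null, of "\<eta> / 98" 0] \<eta> by auto
  define V where "V i = (\<Union>y\<in>U i. ball y ((1 / real M) ^ n i))" for i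
  have "percolation_set M R' \<subseteq> (\<Union>i. V i)"
  proof
    fix x assume "x \<in> percolation_set M R'"
    then obtain i where "x \<in> U i" using U(1) by blast
    then have "x \<in> V i" using M by (auto simp: V_def intro!: bexI[of _ x])
    then show "x \<in> (\<Union>i. V i)" by blast
  qed
  moreover have "open (V i)" for i by (auto simp: V_def)
  ultimately obtain I N where I: "finite I" "\<And>m. m \<ge> N \<Longrightarrow> percolation_stage M R' m \<subseteq> (\<Union>i\<in>I. V i)"
    using percolation_set_open_cover[OF M1] by metis
  \<comment> \<open>Deep enough for the stage to be covered and for each \<open>n i\<close> to be
    the level of an ancestor of a level-\<open>k\<close> cell.\<close>
  define k where "k = Max (insert N (n ` I))"
  have k: "N \<le> k" "\<And>i. i \<in> I \<Longrightarrow> n i \<le> k" using I(1) by (auto simp: k_def)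
  \<comment> \<open>For empty \<open>U i\<close> the choice is arbitrary, but then
    \<open>V i\<close> is empty too and no cell is assigned to it.\<close>
  define y where "y i = (SOME y. y \<in> U i)" for i
  define \<D> where "\<D> i = {c. \<exists>x\<in>cell M (n i) c. dist x (y i) \<le> 2 * (1 / real M) ^ n i}" for i
  have D: "finite (\<D> i)" "card (\<D> i) \<le> 49" for i
    using card_cells_near[OF M1, of "n i" "y i"] by (auto simp: \<D>_def)
  define \<C> where "\<C> = (\<lambda>(i, c). (n i, c)) ` (SIGMA i:I. \<D> i)"
  have fin: "finite (SIGMA i:I. \<D> i)" using I(1) D by auto
  have "min_cut \<theta> M k R \<le> (\<Sum>v\<in>\<C>. \<theta> ^ fst v)"
  proof (rule min_cut_le_cutset[OF M1 \<theta>])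
    show "finite \<C>" unfolding \<C>_def using fin by (rule finite_imageI)
    fix Q assume Q: "Q \<in> retained M (\<lambda>m c. R (m, c)) k"
    \<comment> \<open>One point of a retained cell suffices to find a covering set near it; the
      corner is an explicit choice.\<close>
    define x where "x = (vector [real (fst Q) / real M ^ k, real (snd Q) / real M ^ k] :: real ^ 2)"
    have x: "x \<in> cell M k Q" unfolding x_def by (rule cell_corner[OF M1])
    then have "x \<in> percolation_stage M R' k" using Q by (auto simp: percolation_stage_def R'_def)
    then obtain i z where i: "i \<in> I" "z \<in> U i" "dist z x < (1 / real M) ^ n i"
      using I(2)[OF k(1)] by (auto simp: V_def)
    have "y i \<in> U i" unfolding y_def using i(2) by (rule someI)
    then have "dist z (y i) \<le> (1 / real M) ^ n i"
      using order_trans[OF diameter_bounded_bound[OF U(2) i(2)] U(3)[of i]] by blast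
    then have "dist x (y i) \<le> 2 * (1 / real M) ^ n i"
      using i(3) dist_triangle2[of x "y i" z] by (simp add: dist_commute)
    moreover have "x \<in> cell M (n i) (ancestor M k (n i) Q)"
      using cell_ancestor[OF M1 k(2)[OF i(1)]] x by blast
    ultimately have "ancestor M k (n i) Q \<in> \<D> i" by (auto simp: \<D>_def)
    then have "(n i, ancestor M k (n i) Q) \<in> \<C>" using i(1) by (force simp: \<C>_def)
    then show "\<exists>m\<le>k. (m, ancestor M k m Q) \<in> \<C>" using k(2)[OF i(1)] by blast
  qed
  also have "\<dots> \<le> (\<Sum>v\<in>(SIGMA i:I. \<D> i). \<theta> ^ n (fst v))"
    unfolding \<C>_def using sum_image_le[OF fin, of "\<lambda>v. \<theta> ^ fst v" "\<lambda>(i, c). (n i, c)"] \<theta>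
    by (simp add: comp_def case_prod_beta)
  also have "\<dots> = (\<Sum>i\<in>I. \<Sum>c\<in>\<D> i. \<theta> ^ n i)"
    using sum.Sigma[OF I(1), of \<D> "\<lambda>i c. \<theta> ^ n i"] D by (simp add: case_prod_beta)
  also have "\<dots> \<le> (\<Sum>i\<in>I. 49 * \<theta> ^ n i)"
    using D(2) \<theta> by (intro sum_mono) (auto intro!: mult_right_mono)
  also have "\<dots> = 49 * (\<Sum>i\<in>I. ((1 / real M) ^ n i) powr s)"
    using M by (simp add: sum_distrib_left \<theta>_def powr_realpow[symmetric] powr_powr mult.commute)
  also have "\<dots> \<le> 49 * (\<Sum>i. ((1 / real M) ^ n i) powr s)"
    using U(4) by (intro mult_left_mono sum_le_suminf I(1)) auto
  also have "\<dots> \<le> 49 * (\<eta> / 98)" using U(5) by (intro mult_left_mono) auto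
  also have "\<dots> < \<eta>" using \<eta> by simp
  finally show False using cut[of k] by (simp add: \<theta>_def)
qed

section \<open>Comparing the percolation set with its projections\<close>

definition line_proj :: "'a::real_inner \<Rightarrow> 'a \<Rightarrow> 'a \<Rightarrow> 'a" where
  "line_proj z u x = z + ((x - z) \<bullet> u) *\<^sub>R u"

lemma dist_line_proj:
  assumes "norm u = 1"
  shows "dist (line_proj z u x) (line_proj z u y) = \<bar>(x - y) \<bullet> u\<bar>"
proof -
  have "line_proj z u x - line_proj z u y = ((x - y) \<bullet> u) *\<^sub>R u"
    by (simp add: line_proj_def inner_diff_left scaleR_left.diff)
  then show ?thesis using assms by (simp add: dist_norm)
qed

lemma hausdorff_dim_line_proj_le:
  fixes A :: "'a::euclidean_space set"
  assumes u: "norm u = 1" and A: "bounded A"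
  shows "hausdorff_dim (line_proj z u ` A) \<le> min 1 (hausdorff_dim A)"
proof (rule min.boundedI)
  show "hausdorff_dim (line_proj z u ` A) \<le> hausdorff_dim A"
  proof (rule hausdorff_dim_image_le)
    fix x y
    have "\<bar>(x - y) \<bullet> u\<bar> \<le> norm (x - y) * norm u" by (rule Cauchy_Schwarz_ineq2)
    then show "dist (line_proj z u x) (line_proj z u y) \<le> dist x y"
      unfolding dist_line_proj[OF u] by (simp add: u dist_norm)
  qed
  obtain b where b: "\<And>x. x \<in> A \<Longrightarrow> dist z x \<le> b" using A unfolding bounded_any_center[of _ z] by blast
  have "line_proj z u ` A \<subseteq> (\<lambda>t. z + t *\<^sub>R u) ` {-b..b}"
  proof
    fix w assume "w \<in> line_proj z u ` A"
    then obtain x where x: "x \<in> A" "w = line_proj z u x" by blast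
    have "\<bar>(x - z) \<bullet> u\<bar> \<le> norm (x - z) * norm u" by (rule Cauchy_Schwarz_ineq2)
    then have "\<bar>(x - z) \<bullet> u\<bar> \<le> b" using b[OF x(1)] by (simp add: u dist_norm norm_minus_commute)
    then show "w \<in> (\<lambda>t. z + t *\<^sub>R u) ` {-b..b}"
      unfolding x(2) line_proj_def by (intro imageI) auto
  qed
  then have "hausdorff_dim (line_proj z u ` A) \<le> hausdorff_dim ((\<lambda>t. z + t *\<^sub>R u) ` {-b..b})"
    by (rule hausdorff_dim_mono)
  also have "\<dots> \<le> hausdorff_dim {-b..b}"
    by (rule hausdorff_dim_image_le) (simp add: dist_norm scaleR_left.diff[symmetric] u)
  also have "\<dots> \<le> 1" by (rule hausdorff_dim_interval_le)
  finally show "hausdorff_dim (line_proj z u ` A) \<le> 1" .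
qed

text \<open>Purely deterministic. A set of width \<open>(1 / M) ^ n\<close> in the projection pulls
  back into a strip with at most \<open>M powr (n * (\<tau> + \<epsilon>))\<close> retained cells of
  level \<open>n\<close>; raising the exponent from \<open>t\<close> to
  \<open>t + \<tau> + \<epsilon>\<close> pays for exactly that number.\<close>

lemma hausdorff_dim_le_line_proj_plus:
  assumes M: "M \<ge> 2" and \<tau>: "\<tau> \<ge> 0" and u: "norm u = 1"
    and count: "\<And>\<epsilon>. \<epsilon> > 0 \<Longrightarrow> \<forall>\<^sub>F n in sequentially. \<forall>v\<in>line_params M n.
      real (card (strip_cells M n v \<inter> retained M R n)) \<le> (real M powr \<epsilon>) ^ n * (real M powr \<tau>) ^ n"
  shows "hausdorff_dim (percolation_set M R) \<le> hausdorff_dim (line_proj z u ` percolation_set M R) + ennreal \<tau>"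
proof -
  define E where "E = percolation_set M R"
  define f where "f = line_proj z u"
  have M1: "M \<ge> 1" using M by simp
  have null: "hausdorff_measure (t + \<tau> + \<epsilon>) E = 0"
    if t: "t > 0" and t0: "hausdorff_measure t (f ` E) = 0" and \<epsilon>: "\<epsilon> > 0" for t \<epsilon>
  proof (rule hausdorff_measure_0I)
    define s where "s = t + \<tau> + \<epsilon>"
    show s0: "t + \<tau> + \<epsilon> > 0" using t \<tau> \<epsilon> by simp
    fix \<delta> \<eta> :: real assume pos: "\<delta> > 0" "\<eta> > 0"
    obtain n1 where n1: "\<And>n v. n \<ge> n1 \<Longrightarrow> v \<in> line_params M n \<Longrightarrow>
        real (card (strip_cells M n v \<inter> retained M R n)) \<le> (real M powr \<epsilon>) ^ n * (real M powr \<tau>) ^ n"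
      using count[OF \<epsilon>] unfolding eventually_sequentially by blast
    obtain n2 where n2: "(1 / real M) ^ n2 < \<delta> / 2"
      using real_arch_pow_inv[of "\<delta> / 2" "1 / real M"] pos M by auto
    \<comment> \<open>\<open>1\<close> for \<open>strip_cells_cover\<close>, \<open>n1\<close> for
      the strip counts, \<open>n2\<close> for cells of diameter at most
      \<open>\<delta>\<close>.\<close>
    define n0 where "n0 = max 1 (max n1 n2)"
    obtain U n where U: "f ` E \<subseteq> (\<Union>i. U i)" "\<And>i. bounded (U i)"
        "\<And>i. diameter (U i) \<le> (1 / real M) ^ n i" "\<And>i. n i \<ge> n0"
        "summable (\<lambda>i. ((1 / real M) ^ n i) powr t)"
        "(\<Sum>i. ((1 / real M) ^ n i) powr t) \<le> \<eta> / 2 powr s"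
      using hausdorff_null_scaled_cover[OF M t t0, of "\<eta> / 2 powr s" n0] pos by auto
    \<comment> \<open>Demanding a point of \<open>E\<close> in the cell provides a centre in the
      unit square for the strip whenever \<open>C i\<close> is nonempty.\<close>
    define C where "C i = {c \<in> retained M R (n i). \<exists>x\<in>cell M (n i) c \<inter> E. f x \<in> U i}" for i
    define F where "F i = cell M (n i) ` C i" for i
    define r where "r i = 2 * (1 / real M) ^ n i" for i
    have finC: "finite (C i)" for i by (simp add: C_def)
    have cardC: "real (card (C i)) \<le> (real M powr \<epsilon>) ^ n i * (real M powr \<tau>) ^ n i" for i
    proof (cases "C i = {}")
      case True
      then show ?thesis by simp
    next
      case False
      then obtain x0 where x0: "x0 \<in> E" "f x0 \<in> U i" by (auto simp: C_def)
      note sq = percolation_set_unit_square[OF M1 x0(1)[unfolded E_def]]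
      have "n i \<ge> 1" using U(4)[of i] by (simp add: n0_def)
      from strip_cells_cover[OF M this u sq] obtain v where v: "v \<in> line_params M (n i)"
        "\<And>c x. c \<in> cell_indices M (n i) \<Longrightarrow> x \<in> cell M (n i) c \<Longrightarrow> \<bar>(x - x0) \<bullet> u\<bar> \<le> (1 / real M) ^ n i
           \<Longrightarrow> c \<in> strip_cells M (n i) v" by blast
      have "C i \<subseteq> strip_cells M (n i) v \<inter> retained M R (n i)"
      proof
        fix c assume "c \<in> C i"
        then obtain x where x: "c \<in> retained M R (n i)" "x \<in> cell M (n i) c" "f x \<in> U i"
          by (auto simp: C_def)
        have "\<bar>(x - x0) \<bullet> u\<bar> = dist (f x) (f x0)" by (simp add: f_def dist_line_proj[OF u])
        also have "\<dots> \<le> diameter (U i)" using x(3) x0(2) U(2) by (intro diameter_bounded_bound)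
        also note U(3)[of i]
        finally have "c \<in> strip_cells M (n i) v"
          using retained_subset x(1,2) by (intro v(2)[of _ x]) auto
        then show "c \<in> strip_cells M (n i) v \<inter> retained M R (n i)" using x(1) by simp
      qed
      then have "card (C i) \<le> card (strip_cells M (n i) v \<inter> retained M R (n i))"
        by (intro card_mono) auto
      also have "real \<dots> \<le> (real M powr \<epsilon>) ^ n i * (real M powr \<tau>) ^ n i"
        using U(4)[of i] v(1) by (intro n1) (auto simp: n0_def)
      finally show ?thesis by simp
    qed
    have bound: "real (card (F i)) * r i powr s \<le> 2 powr s * ((1 / real M) ^ n i) powr t" for i
    proof -
      have M0: "real M > 0" using M by simp
      then have x: "(1 / real M) ^ n i = real M powr (- real (n i))"
        by (simp add: powr_minus powr_realpow power_one_over inverse_eq_divide)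
      have "real (card (F i)) \<le> real (card (C i))" unfolding F_def using card_image_le[OF finC] by simp
      also note cardC
      finally have "real (card (F i)) * r i powr s
          \<le> (real M powr \<epsilon>) ^ n i * (real M powr \<tau>) ^ n i * r i powr s"
        by (intro mult_right_mono) auto
      also have "\<dots> = real M powr (real (n i) * \<epsilon>) * real M powr (real (n i) * \<tau>) *
          (2 powr s * real M powr (- (real (n i) * s)))"
        using M0 by (simp add: r_def x powr_mult powr_powr powr_power mult.commute)
      also have "\<dots> = 2 powr s * real M powr (real (n i) * \<epsilon> + real (n i) * \<tau> - real (n i) * s)"
        using M0 by (simp add: powr_add powr_diff powr_minus divide_inverse)
      also have "real (n i) * \<epsilon> + real (n i) * \<tau> - real (n i) * s = - (real (n i) * t)"
        by (simp add: s_def algebra_simps)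
      also have "real M powr (- (real (n i) * t)) = ((1 / real M) ^ n i) powr t"
        by (simp add: x powr_powr)
      finally show ?thesis .
    qed
    have smb0: "summable (\<lambda>i. 2 powr s * ((1 / real M) ^ n i) powr t)" by (intro summable_mult U)
    have smb: "summable (\<lambda>i. real (card (F i)) * r i powr s)"
      by (rule summable_comparison_test'[OF smb0, of 0]) (use bound in auto)
    have "(\<Sum>i. real (card (F i)) * r i powr s) \<le> (\<Sum>i. 2 powr s * ((1 / real M) ^ n i) powr t)"
      by (intro suminf_le bound smb smb0)
    also have "\<dots> = 2 powr s * (\<Sum>i. ((1 / real M) ^ n i) powr t)" by (intro suminf_mult U)
    also have "\<dots> \<le> 2 powr s * (\<eta> / 2 powr s)" by (intro mult_left_mono U) auto
    finally have le: "(\<Sum>i. real (card (F i)) * r i powr s) \<le> \<eta>" by simp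
    have cov: "E \<subseteq> (\<Union>i. \<Union>(F i))"
    proof
      fix x assume x: "x \<in> E"
      then obtain i where i: "f x \<in> U i" using U(1) by blast
      have "x \<in> percolation_stage M R (n i)" using x percolation_set_subset[OF M1] unfolding E_def by blast
      then obtain c where c: "c \<in> retained M R (n i)" "x \<in> cell M (n i) c"
        unfolding percolation_stage_def by blast
      then have "c \<in> C i" using x i unfolding C_def by blast
      then have "x \<in> \<Union>(F i)" using c(2) unfolding F_def by blast
      then show "x \<in> (\<Union>i. \<Union>(F i))" by blast
    qed
    have "r i \<le> \<delta>" for i
    proof -
      have "(1 / real M) ^ n i \<le> (1 / real M) ^ n2"
        using M U(4)[of i] by (intro power_decreasing) (auto simp: n0_def)
      then show ?thesis using n2 by (simp add: r_def)
    qed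
    then have "\<forall>i. finite (F i) \<and> 0 \<le> r i \<and> r i \<le> \<delta> \<and> (\<forall>V\<in>F i. bounded V \<and> diameter V \<le> r i)"
      using finC bounded_cell[OF M1] diameter_cell_le[OF M1] by (auto simp: F_def r_def)
    then show "\<exists>F r. E \<subseteq> (\<Union>i::nat. \<Union>(F i)) \<and>
        (\<forall>i. finite (F i) \<and> 0 \<le> r i \<and> r i \<le> \<delta> \<and> (\<forall>V\<in>F i. bounded V \<and> diameter V \<le> r i)) \<and>
        summable (\<lambda>i. real (card (F i)) * r i powr (t + \<tau> + \<epsilon>)) \<and>
        (\<Sum>i. real (card (F i)) * r i powr (t + \<tau> + \<epsilon>)) \<le> \<eta>"
      using cov smb le by (intro exI[of _ F] exI[of _ r]) (simp add: s_def)
  qed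
  have "hausdorff_dim E \<le> ennreal t + ennreal \<tau>" if t: "0 \<le> t" "hausdorff_measure t (f ` E) = 0" for t
  proof (rule ennreal_le_epsilon)
    fix e :: real assume e: "e > 0"
    \<comment> \<open>\<open>null\<close> needs a positive exponent, while \<open>t\<close> may be
      0: half of \<open>e\<close> is spent on that, the other half is the \<open>\<epsilon>\<close>
      of the strip counts.\<close>
    have "hausdorff_measure (t + e / 2) (f ` E) = 0"
      by (rule hausdorff_measure_0_mono[OF t(2,1)]) (use e in simp)
    then have "hausdorff_measure (t + e / 2 + \<tau> + e / 2) E = 0"
      using t e by (intro null) auto
    then have "hausdorff_dim E \<le> ennreal (t + e / 2 + \<tau> + e / 2)"
      using t e \<tau> by (intro hausdorff_dim_le) auto
    also have "t + e / 2 + \<tau> + e / 2 = t + \<tau> + e" by simp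
    finally show "hausdorff_dim E \<le> ennreal t + ennreal \<tau> + ennreal e"
      using t e \<tau> by (simp add: ennreal_plus[symmetric] del: ennreal_plus)
  qed
  then have "hausdorff_dim E - ennreal \<tau> \<le> hausdorff_dim (f ` E)"
    by (intro hausdorff_dim_ge) (auto simp: ennreal_minus_le_iff add.commute)
  then show ?thesis
    by (simp add: ennreal_minus_le_iff E_def f_def add.commute)
qed

section \<open>The given percolation as a random tree\<close>

context fractal_percolation
begin

text \<open>The unit square is subject to no decision, so the root is declared retained. For
  \<open>p < 1\<close> this tree therefore does not have the law \<open>tree_measure M p\<close>;
  its first-level subtrees do.\<close>

abbreviation kept_tree :: "'w \<Rightarrow> decision_tree" where
  "kept_tree \<omega> \<equiv> (\<lambda>(n, c). n = 0 \<or> X n c \<omega>)"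

text \<open>A first-level subtree reads only coordinates of level at least 1, where the decisions
  form an independent Bernoulli family. It is the injective selection \<open>g\<close> applied to
  the joint decisions \<open>U\<close>.\<close>

lemma distr_subtree_kept_tree:
  assumes M: "M \<ge> 1" and p: "0 \<le> p" "p \<le> 1" and a: "a \<in> cell_indices M 1"
  shows "(\<lambda>\<omega>. subtree M a (kept_tree \<omega>)) \<in> measurable \<Omega> (tree_measure M p)"
    and "distr \<Omega> (tree_measure M p) (\<lambda>\<omega>. subtree M a (kept_tree \<omega>)) = tree_measure M p"
proof -
  define B where "B = measure_pmf (bernoulli_pmf p)"
  define U where "U \<omega> = (\<lambda>i\<in>decisions. (case i of (n, c) \<Rightarrow> X n c) \<omega>)" for \<omega>
  define g where "g r = (\<lambda>v\<in>tree_index M. r (child_pos M a v))" for r :: decision_tree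
  have ne: "decisions \<noteq> {}" using M by (auto simp: cell_indices_def Sigma_empty_iff lessThan_empty_iff intro!: exI[of _ 1])
  have child: "child_pos M a v \<in> decisions" if "v \<in> tree_index M" for v
    using child_pos_in_tree_index[OF a that] by (auto simp: tree_index_def child_pos_def)
  have dU: "distr \<Omega> (PiM decisions (\<lambda>_. B)) U = PiM decisions (\<lambda>_. B)"
    unfolding B_def U_def
    by (rule distr_bernoulli_PiM[OF p ne indep_decisions]) (auto intro: prob_decision)
  have mU: "U \<in> measurable \<Omega> (PiM decisions (\<lambda>_. B))"
    unfolding U_def
  proof (rule measurable_restrict)
    fix i assume "i \<in> decisions"
    then have "(case i of (n, c) \<Rightarrow> X n c) \<in> measurable \<Omega> (count_space UNIV)"
      using indep_decisions unfolding indep_vars_def by blast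
    also have "measurable \<Omega> (count_space UNIV) = measurable \<Omega> B"
      by (rule measurable_cong_sets) (auto simp: B_def)
    finally show "(case i of (n, c) \<Rightarrow> X n c) \<in> measurable \<Omega> B" .
  qed
  have mg: "g \<in> measurable (PiM decisions (\<lambda>_. B)) (tree_measure M p)"
    unfolding g_def tree_measure_def B_def[symmetric]
    by (intro measurable_restrict measurable_component_singleton child)
  have dg: "distr (PiM decisions (\<lambda>_. B)) (tree_measure M p) g = tree_measure M p"
    unfolding g_def tree_measure_def B_def[symmetric]
    by (rule distr_PiM_reindex[of decisions "\<lambda>_. B" "child_pos M a" "tree_index M"])
       (use child inj_on_child_pos in \<open>auto simp: B_def intro: measure_pmf.prob_space_axioms\<close>)
  have eq: "(\<lambda>\<omega>. subtree M a (kept_tree \<omega>)) = g \<circ> U"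
  proof
    fix \<omega>
    have "kept_tree \<omega> (child_pos M a v) = U \<omega> (child_pos M a v)" if "v \<in> tree_index M" for v
      using child[OF that] by (auto simp: U_def)
    then show "subtree M a (kept_tree \<omega>) = (g \<circ> U) \<omega>"
      unfolding subtree_def g_def comp_def by (intro restrict_ext) auto
  qed
  show "(\<lambda>\<omega>. subtree M a (kept_tree \<omega>)) \<in> measurable \<Omega> (tree_measure M p)"
    unfolding eq by (rule measurable_comp[OF mU mg])
  show "distr \<Omega> (tree_measure M p) (\<lambda>\<omega>. subtree M a (kept_tree \<omega>)) = tree_measure M p"
    unfolding eq using distr_distr[OF mg mU] unfolding dU dg by (rule sym)
qed

lemma retained_kept_tree: "retained M (\<lambda>n c. kept_tree \<omega> (n, c)) n = retained M (\<lambda>n c. X n c \<omega>) n"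
  by (auto simp: retained_iff lineage_def)

lemma AE_hausdorff_measure_pos:
  assumes M: "M \<ge> 2" and p: "0 < p" "p \<le> 1" and s: "1 < s" "s < 2 + log (real M) p"
  shows "AE \<omega> in \<Omega>. percolation_set M (\<lambda>n c. X n c \<omega>) \<noteq> {} \<longrightarrow>
    hausdorff_measure s (percolation_set M (\<lambda>n c. X n c \<omega>)) \<noteq> 0"
proof -
  have M1: "M \<ge> 1" and M0: "real M > 1" using M by auto
  define \<theta> where "\<theta> = (1 / real M) powr s"
  have \<theta>M: "\<theta> = real M powr (- s)" using M0 by (simp add: \<theta>_def powr_divide powr_minus inverse_eq_divide)
  have \<theta>: "\<theta> > 0" using M0 by (simp add: \<theta>M)
  define k where "k = card (cell_indices M 1)"
  have k: "k = M * M" by (simp add: k_def cell_indices_def)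
  have k2: "k \<ge> 2" using M mult_le_mono[of 1 M 2 M] by (simp add: k)
  have kr: "real k = real M powr 2" using M0 by (simp add: k power2_eq_square)
  have "p * \<theta> * real k = real M powr (log (real M) p - s + 2)"
    using M0 p by (simp add: \<theta>M kr powr_add powr_diff powr_minus divide_inverse del: powr_numeral)
  moreover have "1 < real M powr (log (real M) p - s + 2)"
    using M0 s by (intro gr_one_powr) auto
  ultimately have c1: "1 < p * \<theta> * real k" by simp
  have "p * \<theta>\<^sup>2 * real k \<le> \<theta>\<^sup>2 * real k" using p by (intro mult_right_mono) (auto intro: mult_left_le_one_le)
  also have "\<dots> = real M powr (2 - 2 * s)"
    using M0 by (simp add: \<theta>M kr power2_eq_square powr_add[symmetric] del: powr_numeral)
  also have "\<dots> < 1" using M0 s by (intro powr_less_one) auto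
  finally have c2: "p * \<theta>\<^sup>2 * real k < 1" .
  \<comment> \<open>As the root is always retained here, the alternative is applied to the
    first-level subtrees and passed up to the root afterwards.\<close>
  have "AE \<omega> in \<Omega>. (\<lambda>n. min_cut \<theta> M n (subtree M a (kept_tree \<omega>))) \<longlonglongrightarrow> 0 \<longrightarrow>
      (\<exists>n. min_cut \<theta> M n (subtree M a (kept_tree \<omega>)) = 0)" if a: "a \<in> cell_indices M 1" for a
  proof (rule AE_distrD[OF distr_subtree_kept_tree(1)[OF M1 _ p(2) a]])
    show "AE R in distr \<Omega> (tree_measure M p) (\<lambda>\<omega>. subtree M a (kept_tree \<omega>)).
        (\<lambda>n. min_cut \<theta> M n R) \<longlonglongrightarrow> 0 \<longrightarrow> (\<exists>n. min_cut \<theta> M n R = 0)"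
      unfolding distr_subtree_kept_tree(2)[OF M1 less_imp_le[OF p(1)] p(2) a]
      by (rule AE_min_cut_null_imp_extinct[OF M1 p \<theta>, folded k_def, OF c1 c2 k2])
  qed (use p in simp)
  then have "AE \<omega> in \<Omega>. \<forall>a\<in>cell_indices M 1. (\<lambda>n. min_cut \<theta> M n (subtree M a (kept_tree \<omega>))) \<longlonglongrightarrow> 0 \<longrightarrow>
      (\<exists>n. min_cut \<theta> M n (subtree M a (kept_tree \<omega>)) = 0)"
    by (intro AE_finite_allI) auto
  then show ?thesis
  proof eventually_elim
    case (elim \<omega>)
    show ?case
    proof
      assume ne: "percolation_set M (\<lambda>n c. X n c \<omega>) \<noteq> {}"
      have surv: "retained M (\<lambda>n c. kept_tree \<omega> (n, c)) n \<noteq> {}" for n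
        using percolation_set_subset[OF M1, of "\<lambda>n c. X n c \<omega>" n] ne
        unfolding retained_kept_tree percolation_stage_def by blast
      have "min_cut \<theta> M n (kept_tree \<omega>) \<noteq> 0" for n
        using min_cut_eq_0_imp_extinct[OF M1 \<theta>, of n "kept_tree \<omega>"] surv[of n] by auto
      \<comment> \<open>A surviving tree has a child whose cost never vanishes. By the alternative
        that cost does not tend to 0, and hence neither does the cost of the tree.\<close>
      then obtain a where "a \<in> cell_indices M 1" "\<forall>n. min_cut \<theta> M n (subtree M a (kept_tree \<omega>)) \<noteq> 0"
        using min_cut_extinct_inherited[OF \<theta>, of M "kept_tree \<omega>"] by blast
      then have nlim: "\<not> (\<lambda>n. min_cut \<theta> M n (kept_tree \<omega>)) \<longlonglongrightarrow> 0"
        using elim min_cut_null_inherited[OF \<theta>, of M "kept_tree \<omega>"] by auto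
      have "\<exists>\<eta>>0. \<forall>n. \<eta> \<le> min_cut \<theta> M n (kept_tree \<omega>)"
      proof (rule ccontr)
        assume "\<not> ?thesis"
        then have small: "\<exists>n. min_cut \<theta> M n (kept_tree \<omega>) < \<eta>" if "\<eta> > 0" for \<eta>
          using that by (meson not_le)
        have "(\<lambda>n. min_cut \<theta> M n (kept_tree \<omega>)) \<longlonglongrightarrow> 0"
        proof (rule LIMSEQ_I)
          fix r :: real assume "r > 0"
          then obtain m where "min_cut \<theta> M m (kept_tree \<omega>) < r" using small by blast
          then have "norm (min_cut \<theta> M n (kept_tree \<omega>) - 0) < r" if "n \<ge> m" for n
            using min_cut_antimono[of \<theta> m n M "kept_tree \<omega>"] min_cut_bounds(1)[of \<theta> M n "kept_tree \<omega>"] \<theta> that by simp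
          then show "\<exists>m. \<forall>n\<ge>m. norm (min_cut \<theta> M n (kept_tree \<omega>) - 0) < r" by blast
        qed
        then show False using nlim by simp
      qed
      then obtain \<eta> where \<eta>: "\<eta> > 0" "\<And>n. \<eta> \<le> min_cut \<theta> M n (kept_tree \<omega>)" by blast
      have "percolation_set M (\<lambda>n c. kept_tree \<omega> (n, c)) = percolation_set M (\<lambda>n c. X n c \<omega>)"
        unfolding percolation_set_def percolation_stage_def retained_kept_tree by simp
      then show "hausdorff_measure s (percolation_set M (\<lambda>n c. X n c \<omega>)) \<noteq> 0"
        using hausdorff_measure_pos_if_min_cut_bounded_below[OF M _ \<eta>(1), of s "kept_tree \<omega>"] \<eta>(2) s
        by (simp add: \<theta>_def)
    qed
  qed
qed

lemma AE_hausdorff_dim_ge: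
  assumes M: "M \<ge> 2" and p: "0 < p" "p \<le> 1" and s: "1 < 2 + log (real M) p"
  shows "AE \<omega> in \<Omega>. percolation_set M (\<lambda>n c. X n c \<omega>) \<noteq> {} \<longrightarrow>
    ennreal (2 + log (real M) p) \<le> hausdorff_dim (percolation_set M (\<lambda>n c. X n c \<omega>))"
proof -
  define s where "s = 2 + log (real M) p"
  \<comment> \<open>Countably many exponents between 1 and \<open>s\<close> with limit
    \<open>s\<close>, so that their exceptional null sets can be united.\<close>
  define t where "t j = s - (s - 1) / real (j + 2)" for j
  have t: "1 < t j" "t j < s" for j
  proof -
    have "(s - 1) / real (j + 2) < (s - 1) / 1" using s by (intro divide_strict_left_mono) (auto simp: s_def)
    then show "1 < t j" by (simp add: t_def)
    show "t j < s" using s by (simp add: t_def s_def)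
  qed
  have "AE \<omega> in \<Omega>. \<forall>j. percolation_set M (\<lambda>n c. X n c \<omega>) \<noteq> {} \<longrightarrow>
      hausdorff_measure (t j) (percolation_set M (\<lambda>n c. X n c \<omega>)) \<noteq> 0"
    unfolding AE_all_countable
    using AE_hausdorff_measure_pos[OF M p t(1)] t(2) by (auto simp: s_def)
  then show ?thesis
  proof eventually_elim
    case (elim \<omega>)
    define E where "E = percolation_set M (\<lambda>n c. X n c \<omega>)"
    have "ennreal s \<le> hausdorff_dim E" if ne: "E \<noteq> {}"
    proof (rule hausdorff_dim_ge)
      fix r :: real assume r: "0 \<le> r" "hausdorff_measure r E = 0"
      show "ennreal s \<le> ennreal r"
      proof (rule ccontr)
        assume "\<not> ennreal s \<le> ennreal r"
        then have "r < s" using ennreal_leI not_le by blast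
        obtain j :: nat where "(s - 1) / (s - r) \<le> real j" using real_arch_simple by blast
        then have "s - 1 \<le> real j * (s - r)" using \<open>r < s\<close> by (simp add: field_simps)
        also have "\<dots> \<le> real (j + 2) * (s - r)" using \<open>r < s\<close> by (intro mult_right_mono) auto
        finally have "(s - 1) / real (j + 2) \<le> s - r" by (simp add: field_simps)
        then have "r \<le> t j" by (simp add: t_def)
        then have "hausdorff_measure (t j) E = 0" using hausdorff_measure_0_mono[OF r(2,1)] by blast
        then show False using elim ne by (auto simp: E_def)
      qed
    qed
    then show ?case by (simp add: E_def s_def)
  qed
qed

end

section \<open>Combining the dimension bounds for all lines at once\<close>

theorem corollary3:
  fixes \<Omega> :: "'w measure" and M :: nat and p :: real
    and X :: "nat \<Rightarrow> nat \<times> nat \<Rightarrow> 'w \<Rightarrow> bool"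
    and E :: "'w \<Rightarrow> (real ^ 2) set"
  assumes "M \<ge> 2" and "0 < p" and "p \<le> 1"
    and "fractal_percolation \<Omega> M p X"
    and E_def: "\<And>\<omega>. E \<omega> = percolation_set M (\<lambda>n c. X n c \<omega>)"
  shows "AE \<omega> in \<Omega>. E \<omega> \<noteq> {} \<longrightarrow>
           (\<forall>L :: (real ^ 2) set. affine L \<and> aff_dim L = 1 \<longrightarrow>
              hausdorff_dim (orth_proj L ` E \<omega>) = min 1 (hausdorff_dim (E \<omega>)))"
proof -
  interpret fractal_percolation \<Omega> M p X by fact
  note M = \<open>M \<ge> 2\<close> and p = \<open>0 < p\<close> \<open>p \<le> 1\<close>
  have M0: "real M > 1" using M by simp
  define \<tau> where "\<tau> = max 0 (1 + log (real M) p)"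
  have \<tau>: "\<tau> \<ge> 0" by (simp add: \<tau>_def)
  have "real M powr (1 + log (real M) p) = real M * p"
    using M0 p by (simp add: powr_add)
  then have M\<tau>: "max 1 (real M * p) = real M powr \<tau>"
  proof (cases "0 \<le> 1 + log (real M) p")
    case True
    then have "1 \<le> real M powr (1 + log (real M) p)" using M0 by (simp add: ge_one_powr_ge_zero)
    then show ?thesis using True \<open>real M powr (1 + log (real M) p) = real M * p\<close> by (simp add: \<tau>_def max_def)
  next
    case False
    then have "real M powr (1 + log (real M) p) \<le> real M powr 0" using M0 by (intro powr_mono) auto
    then show ?thesis using False M0 \<open>real M powr (1 + log (real M) p) = real M * p\<close> by (simp add: \<tau>_def max_def)
  qed
  \<comment> \<open>Countably many values \<open>1 / Suc j\<close> stand in for all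
    \<open>\<epsilon> > 0\<close>, which keeps a single null set.\<close>
  have strips: "AE \<omega> in \<Omega>. \<forall>j::nat. \<forall>\<^sub>F n in sequentially. \<forall>v\<in>line_params M n.
      kept_count n (strip_cells M n v) \<omega> \<le> (real M powr (1 / real (Suc j))) ^ n * (real M powr \<tau>) ^ n"
    unfolding AE_all_countable M\<tau>[symmetric] using p by (intro allI AE_strip_counts[OF M]) auto
  have dim: "AE \<omega> in \<Omega>. E \<omega> \<noteq> {} \<longrightarrow> \<tau> > 0 \<longrightarrow> ennreal (1 + \<tau>) \<le> hausdorff_dim (E \<omega>)"
  proof (cases "\<tau> > 0")
    case True
    then have eq: "1 + \<tau> = 2 + log (real M) p" by (auto simp: \<tau>_def max_def split: if_splits)
    have "AE \<omega> in \<Omega>. percolation_set M (\<lambda>n c. X n c \<omega>) \<noteq> {} \<longrightarrow>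
        ennreal (2 + log (real M) p) \<le> hausdorff_dim (percolation_set M (\<lambda>n c. X n c \<omega>))"
      by (rule AE_hausdorff_dim_ge[OF M p]) (use True eq in linarith)
    then show ?thesis unfolding eq E_def by eventually_elim simp
  qed simp
  show ?thesis
    using strips dim
  proof eventually_elim
    case (elim \<omega>)
    define R where "R = (\<lambda>n c. X n c \<omega>)"
    have E: "E \<omega> = percolation_set M R" by (simp add: E_def R_def)
    have count: "\<forall>\<^sub>F n in sequentially. \<forall>v\<in>line_params M n.
      real (card (strip_cells M n v \<inter> retained M R n)) \<le> (real M powr \<epsilon>) ^ n * (real M powr \<tau>) ^ n"
      if \<epsilon>: "\<epsilon> > 0" for \<epsilon>
    proof -
      obtain j where j: "1 / real (Suc j) < \<epsilon>" using \<epsilon> nat_approx_posE by blast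
      have "(real M powr (1 / real (Suc j))) ^ n * (real M powr \<tau>) ^ n \<le> (real M powr \<epsilon>) ^ n * (real M powr \<tau>) ^ n" for n
        using M0 j by (intro mult_right_mono power_mono powr_mono) auto
      then show ?thesis
        using elim(1)[rule_format, of j]
        by (elim eventually_mono) (fastforce simp: kept_count_def R_def intro: order_trans)
    qed
    show ?case
    proof (intro impI allI)
      fix L :: "(real ^ 2) set"
      assume ne: "E \<omega> \<noteq> {}" and L: "affine L \<and> aff_dim L = 1"
      obtain z u where u: "norm u = 1" and orth: "\<And>x. orth_proj L x = z + ((x - z) \<bullet> u) *\<^sub>R u"
        using orth_proj_line[of L] L by metis
      have proj: "orth_proj L = line_proj z u" by (rule ext) (simp add: orth line_proj_def)
      have M1: "M \<ge> 1" using M by simp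
      have "bounded (E \<omega>)"
        using percolation_set_subset[OF M1, of R 0] compact_imp_bounded[OF compact_percolation_stage[OF M1]]
        unfolding E by (rule bounded_subset[rotated])
      then have upper: "hausdorff_dim (orth_proj L ` E \<omega>) \<le> min 1 (hausdorff_dim (E \<omega>))"
        unfolding proj by (rule hausdorff_dim_line_proj_le[OF u])
      have lower: "hausdorff_dim (E \<omega>) \<le> hausdorff_dim (orth_proj L ` E \<omega>) + ennreal \<tau>"
        unfolding proj E by (rule hausdorff_dim_le_line_proj_plus[OF M \<tau> u count])
      have "min 1 (hausdorff_dim (E \<omega>)) \<le> hausdorff_dim (orth_proj L ` E \<omega>)"
      proof (cases "\<tau> > 0")
        case True
        then have "ennreal (1 + \<tau>) \<le> hausdorff_dim (orth_proj L ` E \<omega>) + ennreal \<tau>"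
          using elim(2) ne by (intro order_trans[OF _ lower]) blast
        \<comment> \<open>The set exceeds dimension 1 by at least the \<open>\<tau>\<close> that a
          projection may lose, and the finite \<open>\<tau>\<close> cancels.\<close>
        then have "1 \<le> hausdorff_dim (orth_proj L ` E \<omega>)"
          using \<tau> by (simp add: ennreal_add_left_cancel_le add.commute)
        then show ?thesis by (simp add: min.coboundedI1)
      next
        \<comment> \<open>Here \<open>\<tau> = 0\<close>, and \<open>lower\<close> says that the
          projection loses no dimension.\<close>
        case False
        then show ?thesis using lower \<tau> by (simp add: min.coboundedI2)
      qed
      then show "hausdorff_dim (orth_proj L ` E \<omega>) = min 1 (hausdorff_dim (E \<omega>))"
        using upper by (rule antisym[rotated])
    qed
  qed
qed

end
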